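(* Let $p$ be an odd prime and let $\varepsilon$ be a fixed integer that is a nonsquare modulo $p$. Every nonabelian group of order $p^4$ realizes precisely one of the extension types $(N,p,\tau,v)$ in the following list. With $N=C_{p^2}\times C_p$: 1. $\tau=\begin{pmatrix}1&p\\0&1\end{pmatrix}$, $v=\begin{pmatrix}0\\0\end{pmatrix}$; 2. $\tau=\begin{pmatrix}1&p\\0&1\end{pmatrix}$, $v=\begin{pmatrix}1\\0\end{pmatrix}$; 3. $\tau=\begin{pmatrix}1+p&0\\0&1\end{pmatrix}$, $v=\begin{pmatrix}0\\0\end{pmatrix}$; 4. $\tau=\begin{pmatrix}1+p&0\\0&1\end{pmatrix}$, $v=\begin{pmatrix}0\\1\end{pmatrix}$; 5. $\tau=\begin{pmatrix}1&0\\1&1\end{pmatrix}$, $v=\begin{pmatrix}0\\0\end{pmatrix}$; 6. $\tau=\begin{pmatrix}1&p\\1&1\end{pmatrix}$, $v=\begin{pmatrix}0\\0\end{pmatrix}$; 7. $\tau=\begin{pmatrix}1&\varepsilon p\\1&1\end{pmatrix}$, $v=\begin{pmatrix}0\\0\end{pmatrix}$; 8. (only if $p=3$) $\tau=\begin{pmatrix}1&\varepsilon p\\1&1\end{pmatrix}$, $v=\begin{pmatrix}p\\0\end{pmatrix}$. With $N=C_p\times C_p\times C_p$: 9. $\tau=\begin{pmatrix}1&1&0\\0&1&0\\0&0&1\end{pmatrix}$, $v=\begin{pmatrix}0\\0\\0\end{pmatrix}$; 10. $\tau=\begin{pmatrix}1&1&0\\0&1&1\\0&0&1\end{pmatrix}$,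 $v=\begin{pmatrix}0\\0\\0\end{pmatrix}$; 11. (only if $p>3$) $\tau=\begin{pmatrix}1&1&0\\0&1&1\\0&0&1\end{pmatrix}$, $v=\begin{pmatrix}1\\0\\0\end{pmatrix}$. Thus, for each odd prime $p$ the list contains $10$ extension types, and there are exactly $10$ nonabelian groups of order $p^4$ up to isomorphism.
   Context: $C_n$ denotes the cyclic group of order $n$. For $v$ in a group $N$, $\operatorname{Int}(v)$ is the automorphism $x\mapsto vxv^{-1}$ of $N$. An extension type for a group $N$ is a quadruple $(N,n,\tau,v)$ where $n$ is a positive integer, $\tau\in\operatorname{Aut}(N)$, and $v\in N$ satisfies $\tau(v)=v$ and $\tau^n=\operatorname{Int}(v)$. A group $G$ realizes $(N,n,\tau,v)$ if there are a normal subgroup $N'$ of $G$ with $G/N'$ cyclic of order $n$, an element $a\in G$ whose coset generates $G/N'$, and an isomorphism $\phi:N\to N'$ such that $a^n=\phi(v)$ and $a\phi(y)a^{-1}=\phi(\tau(y))$ for all $y\in N$. For $N=C_{p^2}\times C_p$, let $x$ be a generator of $C_{p^2}$ and $y$ a generator of $C_p$. The column vector $\begin{pmatrix}i\\ j\end{pmatrix}$ denotes $x^iy^j$ (with $i$ taken modulo $p^2$ and $j$ modulo $p$), and the matrix $\begin{pmatrix}a&c\\ b&d\end{pmatrix}$ (first row modulo $p^2$, second row modulo $p$) denotes the automorphism $x\mapsto x^ay^b$, $y\mapsto x^cy^d$. For $N=C_p\times C_p\times C_p$, $N$ is identified with the space of column vectors $\mathbf{F}_p^3$ over the field $\mathbf{F}_p$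 with $p$ elements, and $\operatorname{Aut}(N)$ with $\operatorname{GL}_3(\mathbf{F}_p)$. *)

theory Defs
  imports "HOL-Algebra.Product_Groups" "HOL-Algebra.Bij" "HOL-Number_Theory.Residues"
begin

text \<open>Automorphisms follow \<^theory>\<open>HOL-Algebra.Bij\<close>: they are functions that are
  extensional on the carrier, so equality of automorphisms is equality of functions.\<close>

definition inner_aut :: "('a, 'm) monoid_scheme \<Rightarrow> 'a \<Rightarrow> 'a \<Rightarrow> 'a" where
  "inner_aut N v = (\<lambda>x\<in>carrier N. v \<otimes>\<^bsub>N\<^esub> x \<otimes>\<^bsub>N\<^esub> inv\<^bsub>N\<^esub> v)"

type_synonym 'a ext_data = "'a monoid \<times> nat \<times> ('a \<Rightarrow> 'a) \<times> 'a"

definition extension_type :: "'a ext_data \<Rightarrow> bool" where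
  "extension_type = (\<lambda>(N, n, \<tau>, v).
     group N \<and> 0 < n \<and> \<tau> \<in> auto N \<and> v \<in> carrier N \<and> \<tau> v = v \<and>
     \<tau> [^]\<^bsub>AutoGroup N\<^esub> n = inner_aut N v)"

definition realizes :: "('g, 'm) monoid_scheme \<Rightarrow> 'a ext_data \<Rightarrow> bool" where
  "realizes G = (\<lambda>(N, n, \<tau>, v).
     \<exists>N' a \<phi>. N' \<lhd> G \<and>
       cyclic_group (G Mod N') \<and> order (G Mod N') = n \<and>
       a \<in> carrier G \<and>
       generate (G Mod N') {N' #>\<^bsub>G\<^esub> a} = carrier (G Mod N') \<and>
       \<phi> \<in> iso N (G\<lparr>carrier := N'\<rparr>) \<and>
       a [^]\<^bsub>G\<^esub> n = \<phi> v \<and>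
       (\<forall>y\<in>carrier N. a \<otimes>\<^bsub>G\<^esub> \<phi> y \<otimes>\<^bsub>G\<^esub> inv\<^bsub>G\<^esub> a = \<phi> (\<tau> y)))"

text \<open>For a list \<open>ms\<close> of positive moduli, \<open>cyclic_prod ms\<close> is the product of the cyclic groups
  of these orders, written additively. An element is a column vector \<open>u\<close> whose entry \<open>u i\<close> is the
  reduced residue modulo \<open>ms ! i\<close>: in \<open>cyclic_prod [p\<^sup>2, p]\<close> the vector with entries \<open>i\<close>, \<open>j\<close> is
  \<open>x\<^sup>iy\<^sup>j\<close>, and \<open>cyclic_prod [p, p, p]\<close> is the additive group of \<open>\<bbbF>\<^sub>p\<^sup>3\<close>. All these groups have
  the same element type, so that quadruples over different groups can be put in one list.\<close>

definition cyclic_prod :: "nat list \<Rightarrow> (nat \<Rightarrow> int) monoid" where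
  "cyclic_prod ms = product_group {..<length ms} (\<lambda>i. integer_mod_group (ms ! i))"

definition col :: "nat list \<Rightarrow> int list \<Rightarrow> nat \<Rightarrow> int" where
  "col ms c = (\<lambda>i\<in>{..<length ms}. c ! i mod int (ms ! i))"

text \<open>A matrix is given by its list of rows and acts on column vectors from the left, row \<open>i\<close>
  being read modulo \<open>ms ! i\<close>; its columns are thus the images of the standard generators.
  For unequal moduli this need not be a homomorphism for every integer matrix.\<close>

definition mat_map :: "nat list \<Rightarrow> int list list \<Rightarrow> (nat \<Rightarrow> int) \<Rightarrow> nat \<Rightarrow> int" where
  "mat_map ms A = (\<lambda>u\<in>carrier (cyclic_prod ms).
     \<lambda>i\<in>{..<length ms}. (\<Sum>j<length ms. A ! i ! j * u j) mod int (ms ! i))"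

definition mat_ext :: "nat \<Rightarrow> nat list \<Rightarrow> int list list \<Rightarrow> int list \<Rightarrow> (nat \<Rightarrow> int) ext_data" where
  "mat_ext n ms A c = (cyclic_prod ms, n, mat_map ms A, col ms c)"

definition ext_list :: "nat \<Rightarrow> int \<Rightarrow> (nat \<Rightarrow> int) ext_data list" where
  "ext_list p \<epsilon> =
     [mat_ext p [p^2, p] [[1, int p], [0, 1]] [0, 0],
      mat_ext p [p^2, p] [[1, int p], [0, 1]] [1, 0],
      mat_ext p [p^2, p] [[1 + int p, 0], [0, 1]] [0, 0],
      mat_ext p [p^2, p] [[1 + int p, 0], [0, 1]] [0, 1],
      mat_ext p [p^2, p] [[1, 0], [1, 1]] [0, 0],
      mat_ext p [p^2, p] [[1, int p], [1, 1]] [0, 0],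
      mat_ext p [p^2, p] [[1, \<epsilon> * int p], [1, 1]] [0, 0]] @
     (if p = 3 then
       [mat_ext p [p^2, p] [[1, \<epsilon> * int p], [1, 1]] [int p, 0]] else []) @
     [mat_ext p [p, p, p] [[1, 1, 0], [0, 1, 0], [0, 0, 1]] [0, 0, 0],
      mat_ext p [p, p, p] [[1, 1, 0], [0, 1, 1], [0, 0, 1]] [0, 0, 0]] @
     (if p > 3 then
       [mat_ext p [p, p, p] [[1, 1, 0], [0, 1, 1], [0, 0, 1]] [1, 0, 0]] else [])"

definition nonabelian_group_of_order :: "nat \<Rightarrow> ('g, 'm) monoid_scheme \<Rightarrow> bool" where
  "nonabelian_group_of_order k G \<longleftrightarrow> group G \<and> \<not> comm_group G \<and> order G = k"

end

theory Submission
  imports Defs "HOL-Algebra.Group_Action" "HOL-Number_Theory.Euler_Criterion"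
begin

text \<open>
  Let \<open>G\<close> be nonabelian of order \<open>p\<^sup>4\<close>. The class equation yields an abelian subgroup \<open>N\<close> of order
  \<open>p\<^sup>3\<close> (\<open>exists_abelian_subgroup\<close>); it is normal, and any \<open>a\<close> outside \<open>N\<close> generates the quotient.
  Everything is controlled by the endomorphism \<open>D x = [a, x]\<close> of \<open>N\<close>, which is \<open>\<tau> - 1\<close> in additive
  notation: its kernel is the center, its image contains all commutators, and since nontrivial normal
  subgroups meet the center it is nilpotent. Counting kernel and image leaves two cases
  (\<open>class_cases\<close>). Either the center has order \<open>p\<^sup>2\<close> and \<open>D\<^sup>2 = 0\<close>, or it has order \<open>p\<close> and
  \<open>D\<^sup>3 = 0 \<noteq> D\<^sup>2\<close>.

  As \<open>D\<^sup>3 = 0\<close> in all cases, conjugation by \<open>a\<close> acts unipotently and powers are given by binomial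
  coefficients: \<open>(x a\<^sup>k)\<^sup>p\<close> is the product of \<open>x\<^sup>p\<close>, \<open>a\<^sup>k\<^sup>p\<close> and the \<open>k\<^sup>2 (p choose 3)\<close>-th power of
  \<open>D\<^sup>2 x\<close> (\<open>pow_p_formula\<close>). The middle binomial coefficient disappears because \<open>D x\<close> has
  exponent \<open>p\<close>; the remaining one is divisible by \<open>p\<close> unless \<open>p = 3\<close>, and this is the only reason
  why \<open>p = 3\<close> behaves differently.

  In class two the \<open>p\<close>-th power map is a homomorphism into the center, and its position relative to
  the commutator subgroup \<open>W\<close> of order \<open>p\<close> determines the type (\<open>realizes_class2\<close>). In class three
  choose \<open>x\<close> with \<open>z = D\<^sup>2 x \<noteq> 1\<close>. If \<open>x\<^sup>p = 1\<close>, then \<open>x\<close>, \<open>D x\<close>, \<open>z\<close> is a Jordan basis of \<open>N\<close>.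
  Otherwise \<open>x\<^sup>p\<close> generates the center, \<open>z = x\<^sup>p\<^sup>k\<close>, and replacing \<open>a\<close> by \<open>a\<^sup>m\<close> multiplies \<open>k\<close> by
  \<open>m\<^sup>2\<close>, so \<open>k\<close> can be made \<open>1\<close> or \<open>\<epsilon>\<close>. In both situations \<open>a\<^sup>p\<close> is central and is normalized by
  multiplying \<open>a\<close> with a power of \<open>x\<close>, or by replacing \<open>x\<close> by one of its powers (\<open>realizes_max\<close>).

  Conversely, \<open>type_index\<close> recovers the position in the list from the group alone, by asking which
  powers and commutators exist; computing it in a realization (\<open>type_index_listed_type\<close>) shows that no
  group realizes two types. Each type is realized by the usual extension on \<open>N \<times> {0..<n}\<close>, to which
  every other realization is isomorphic (\<open>presents_imp_iso_ext_group\<close>), so that groups up to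
  isomorphism correspond to types.
\<close>

section \<open>Powers in groups\<close>

context group
begin

lemma subgroup_int_pow: "subgroup M G \<Longrightarrow> w \<in> M \<Longrightarrow> w [^] (k::int) \<in> M"
  using group.int_pow_closed[OF subgroup.subgroup_is_group[OF _ is_group], of M w k]
    int_pow_consistent[of M w k] by simp

lemma pow_coprime_mem:
  assumes "subgroup M G" "g \<in> carrier G" "g [^] (k::nat) \<in> M" "g [^] (l::nat) \<in> M" "coprime k l"
  shows "g \<in> M"
proof -
  have "coprime (int k) (int l)" using assms(5) by simp
  then obtain r s where rs: "r * int k + s * int l = 1"
    by (metis coprime_iff_gcd_eq_1 bezout_int)
  have "g = g [^] (int k * r + int l * s)" using rs assms(2) by (simp add: mult.commute)
  also have "\<dots> = (g [^] int k) [^] r \<otimes> (g [^] int l) [^] s"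
    using assms(2) by (simp add: int_pow_mult int_pow_pow)
  also have "\<dots> \<in> M"
    using assms by (auto simp: int_pow_int intro!: subgroup.m_closed[OF assms(1)] subgroup_int_pow)
  finally show ?thesis .
qed

lemma coset_powers_cover:
  assumes "subgroup M G" "finite (carrier G)" "order G = p * card M" "g \<in> carrier G"
    and "\<And>k::nat. 0 < k \<Longrightarrow> k < p \<Longrightarrow> g [^] k \<notin> M" and "h \<in> carrier G"
  shows "\<exists>x\<in>M. \<exists>k<p. h = x \<otimes> g [^] k"
proof -
  interpret M: subgroup M G by fact
  define f where "f = (\<lambda>(u, k). u \<otimes> g [^] (k::nat))"
  have "inj_on f (M \<times> {..<p})"
  proof -
    have aux: False if "u \<in> M" "w \<in> M" "k < l" "l < p" "u \<otimes> g [^] k = w \<otimes> g [^] l"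
      for u w k l
    proof -
      have "w \<otimes> g [^] l = w \<otimes> (g [^] (l - k) \<otimes> g [^] k)"
        using that assms(4) by (simp add: nat_pow_mult)
      then have "u = w \<otimes> g [^] (l - k)"
        using that assms(4) by (simp add: m_assoc[symmetric])
      then have "g [^] (l - k) = inv w \<otimes> u"
        using that assms(4) by (simp add: m_assoc[symmetric])
      also have "\<dots> \<in> M" using that by (intro M.m_closed M.m_inv_closed)
      finally show False using assms(5)[of "l - k"] that by simp
    qed
    show ?thesis
    proof (rule inj_onI, clarify)
      fix u k w l
      assume *: "u \<in> M" "w \<in> M" "k < p" "l < p" "f (u, k) = f (w, l)"
      have "k = l"
        using aux[of u w k l] aux[of w u l k] * by (force simp: f_def not_less_iff_gr_or_eq)
      moreover have "u = w" using * \<open>k = l\<close> assms(4) by (auto simp: f_def)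
      ultimately show "u = w \<and> k = l" by simp
    qed
  qed
  then have "card (f ` (M \<times> {..<p})) = order G"
    using assms(3) by (simp add: card_image card_cartesian_product mult.commute)
  moreover have "f ` (M \<times> {..<p}) \<subseteq> carrier G" using assms(4) by (auto simp: f_def)
  ultimately have "f ` (M \<times> {..<p}) = carrier G"
    using assms(2) by (simp add: card_subset_eq order_def)
  with assms(6) obtain q where "q \<in> M \<times> {..<p}" "h = f q" by blast
  then show ?thesis by (cases q) (auto simp: f_def)
qed

lemma conj_int_pow:
  assumes "a \<in> carrier G" "x \<in> carrier G" "w \<in> carrier G" "a \<otimes> x = w \<otimes> a"
  shows "a \<otimes> x [^] (i::int) = w [^] i \<otimes> a"
proof -
  define h where "h = (\<lambda>g. a \<otimes> g \<otimes> inv a)"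
  have "h \<in> hom G G"
    using assms(1) by (auto simp: hom_def h_def m_assoc) (simp add: m_assoc[symmetric])
  then interpret h: group_hom G G h
    by (simp add: group_hom_def group_hom_axioms_def is_group)
  have "h x = w" using assms by (simp add: h_def m_assoc)
  then have "h (x [^] i) = w [^] i" using h.hom_int_pow assms by metis
  then show ?thesis using assms by (metis h_def inv_solve_right' int_pow_closed m_closed)
qed

lemma int_pow_commute:
  assumes "x \<in> carrier G" "y \<in> carrier G" "x \<otimes> y = y \<otimes> x"
  shows "x [^] (i::int) \<otimes> y [^] (j::int) = y [^] j \<otimes> x [^] i"
  using conj_int_pow[of "x [^] i" y y j] conj_int_pow[of y x x i] assms by simp

lemma int_pow_mod:
  assumes "x \<in> carrier G" "x [^] m = \<one>" shows "x [^] (i mod m) = x [^] (i::int)"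
proof -
  have "x [^] (m * (i div m) + i mod m) = (x [^] m) [^] (i div m) \<otimes> x [^] (i mod m)"
    using assms(1) by (simp only: int_pow_mult int_pow_pow)
  then show ?thesis using assms by simp
qed

lemma comm2_pow_mult:
  fixes i j i' j' :: int
  assumes "x \<in> carrier G" "y \<in> carrier G" "x \<otimes> y = y \<otimes> x"
  shows "x [^] i \<otimes> y [^] j \<otimes> (x [^] i' \<otimes> y [^] j') = x [^] (i + i') \<otimes> y [^] (j + j')"
proof -
  have "x [^] i \<otimes> y [^] j \<otimes> (x [^] i' \<otimes> y [^] j') = x [^] i \<otimes> (y [^] j \<otimes> x [^] i') \<otimes> y [^] j'"
    using assms by (simp add: m_assoc)
  also have "\<dots> = x [^] i \<otimes> (x [^] i' \<otimes> y [^] j) \<otimes> y [^] j'"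
    using int_pow_commute[OF assms, of i' j] by simp
  also have "\<dots> = x [^] (i + i') \<otimes> y [^] (j + j')"
    using assms by (simp add: m_assoc int_pow_mult)
  finally show ?thesis .
qed

lemma comm3_pow_mult:
  fixes i j l i' j' l' :: int
  assumes "x \<in> carrier G" "y \<in> carrier G" "z \<in> carrier G"
    and "x \<otimes> y = y \<otimes> x" "x \<otimes> z = z \<otimes> x" "y \<otimes> z = z \<otimes> y"
  shows "(x [^] i \<otimes> y [^] j \<otimes> z [^] l) \<otimes> (x [^] i' \<otimes> y [^] j' \<otimes> z [^] l') =
    x [^] (i + i') \<otimes> y [^] (j + j') \<otimes> z [^] (l + l')"
proof -
  have c: "z [^] l \<otimes> x [^] i' = x [^] i' \<otimes> z [^] l" "z [^] l \<otimes> y [^] j' = y [^] j' \<otimes> z [^] l"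
    by (rule int_pow_commute[OF assms(3,1) assms(5)[symmetric]], rule int_pow_commute[OF assms(3,2) assms(6)[symmetric]])
  have c': "z [^] l \<otimes> (x [^] i' \<otimes> y [^] j') = (x [^] i' \<otimes> y [^] j') \<otimes> z [^] l"
  proof -
    have "z [^] l \<otimes> (x [^] i' \<otimes> y [^] j') = (z [^] l \<otimes> x [^] i') \<otimes> y [^] j'"
      using assms by (simp add: m_assoc)
    also have "\<dots> = x [^] i' \<otimes> (z [^] l \<otimes> y [^] j')"
      unfolding c(1) using assms by (simp add: m_assoc)
    also have "\<dots> = (x [^] i' \<otimes> y [^] j') \<otimes> z [^] l"
      unfolding c(2) using assms by (simp add: m_assoc)
    finally show ?thesis .
  qed
  have "(x [^] i \<otimes> y [^] j \<otimes> z [^] l) \<otimes> (x [^] i' \<otimes> y [^] j' \<otimes> z [^] l') =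
     x [^] i \<otimes> y [^] j \<otimes> (z [^] l \<otimes> (x [^] i' \<otimes> y [^] j')) \<otimes> z [^] l'"
    using assms by (simp add: m_assoc)
  also have "\<dots> = (x [^] i \<otimes> y [^] j \<otimes> (x [^] i' \<otimes> y [^] j')) \<otimes> (z [^] l \<otimes> z [^] l')"
    unfolding c' using assms by (simp add: m_assoc)
  also have "\<dots> = x [^] (i + i') \<otimes> y [^] (j + j') \<otimes> z [^] (l + l')"
    unfolding comm2_pow_mult[OF assms(1,2,4)] using assms by (simp add: int_pow_mult)
  finally show ?thesis .
qed

end

section \<open>Realizations in terms of elements\<close>

text \<open>The quotient group is replaced by the normal form \<open>\<phi> u a\<^sup>k\<close> with \<open>k < n\<close>: that it exists says
  that the coset of \<open>a\<close> generates the quotient by the image of \<open>\<phi>\<close>, and the last clause says that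
  this coset has order \<open>n\<close>. In this form a realization can be computed with and carried along
  isomorphisms.\<close>

definition presents ::
  "('g, 'm) monoid_scheme \<Rightarrow> 'a ext_data \<Rightarrow> ('a \<Rightarrow> 'g) \<Rightarrow> 'g \<Rightarrow> bool" where
  "presents G = (\<lambda>(N, n, \<tau>, v) \<phi> a.
     \<phi> \<in> hom N G \<and> inj_on \<phi> (carrier N) \<and> a \<in> carrier G \<and> a [^]\<^bsub>G\<^esub> n = \<phi> v \<and>
     (\<forall>u\<in>carrier N. a \<otimes>\<^bsub>G\<^esub> \<phi> u = \<phi> (\<tau> u) \<otimes>\<^bsub>G\<^esub> a) \<and>
     (\<forall>g\<in>carrier G. \<exists>u\<in>carrier N. \<exists>k<n. g = \<phi> u \<otimes>\<^bsub>G\<^esub> a [^]\<^bsub>G\<^esub> k) \<and>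
     (\<forall>k<n. a [^]\<^bsub>G\<^esub> k \<in> \<phi> ` carrier N \<longrightarrow> k = 0))"

lemma (in group) pow_conj_shift:
  assumes "a \<in> carrier G" "\<And>u. u \<in> U \<Longrightarrow> \<tau> u \<in> U" "\<And>u. u \<in> U \<Longrightarrow> \<phi> u \<in> carrier G"
    and "\<And>u. u \<in> U \<Longrightarrow> a \<otimes> \<phi> u = \<phi> (\<tau> u) \<otimes> a" and "u \<in> U"
  shows "a [^] k \<otimes> \<phi> u = \<phi> ((\<tau> ^^ k) u) \<otimes> a [^] (k::nat)" and "(\<tau> ^^ k) u \<in> U"
proof (induction k)
  case 0
  { case 1 then show ?case using assms by simp }
  { case 2 then show ?case using assms by simp }
next
  case (Suc k)
  { case 1
    have c: "\<phi> ((\<tau> ^^ k) u) \<in> carrier G" "\<phi> (\<tau> ((\<tau> ^^ k) u)) \<in> carrier G" "\<phi> u \<in> carrier G"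
      using Suc assms by auto
    have s: "a [^] Suc k = a \<otimes> a [^] k" using assms(1) by (rule nat_pow_Suc2)
    have "a [^] Suc k \<otimes> \<phi> u = a \<otimes> (a [^] k \<otimes> \<phi> u)"
      unfolding s using c assms(1) by (simp add: m_assoc)
    also have "\<dots> = (a \<otimes> \<phi> ((\<tau> ^^ k) u)) \<otimes> a [^] k"
      unfolding Suc.IH(1) using c assms(1) by (simp add: m_assoc)
    also have "\<dots> = \<phi> (\<tau> ((\<tau> ^^ k) u)) \<otimes> (a \<otimes> a [^] k)"
      unfolding assms(4)[OF Suc.IH(2)] using c assms(1) by (simp add: m_assoc)
    also have "\<dots> = \<phi> ((\<tau> ^^ Suc k) u) \<otimes> a [^] Suc k" unfolding s by simp
    finally show ?case . }
  { case 2 then show ?case using assms Suc by simp }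
qed

lemma realizes_imp_presents:
  fixes G (structure)
  assumes "group G" "group N" "0 < n" "\<tau> \<in> carrier N \<rightarrow> carrier N"
    and "realizes G (N, n, \<tau>, v)"
  obtains \<phi> a where "presents G (N, n, \<tau>, v) \<phi> a"
proof -
  interpret group G by fact
  interpret N: group N by fact
  obtain M a \<phi> where M: "M \<lhd> G" and ord: "order (G Mod M) = n" and a: "a \<in> carrier G"
    and gen: "generate (G Mod M) {M #> a} = carrier (G Mod M)"
    and \<phi>: "\<phi> \<in> iso N (G\<lparr>carrier := M\<rparr>)" and pw: "a [^] n = \<phi> v"
    and conj: "\<And>y. y \<in> carrier N \<Longrightarrow> a \<otimes> \<phi> y \<otimes> inv a = \<phi> (\<tau> y)"
    using assms(5) unfolding realizes_def by auto
  interpret M: normal M G by fact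
  interpret Q: group "G Mod M" by (rule M.factorgroup_is_group)
  have im: "\<phi> ` carrier N = M" and inj: "inj_on \<phi> (carrier N)"
    using \<phi> by (auto simp: iso_def bij_betw_def)
  have hom: "\<phi> \<in> hom N G"
    using \<phi> M.subset by (auto simp: iso_def hom_def Pi_iff)
  have Ma: "M #> a \<in> carrier (G Mod M)" using a by (simp add: carrier_FactGroup)
  have fin: "finite (carrier (G Mod M))"
    using ord assms(3) by (metis Q.order_gt_0_iff_finite)
  have ordMa: "Q.ord (M #> a) = n"
    using Q.generate_pow_card[OF Ma] gen ord by (simp add: order_def)
  have step: "a \<otimes> \<phi> u = \<phi> (\<tau> u) \<otimes> a" if "u \<in> carrier N" for u
  proof -
    have c: "\<phi> u \<in> carrier G" "\<phi> (\<tau> u) \<in> carrier G"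
      using that assms(4) hom by (auto simp: hom_def)
    show ?thesis
      using conj[OF that] a c by (metis inv_solve_right m_closed)
  qed
  have zero: "k = 0" if "k < n" "a [^] k \<in> \<phi> ` carrier N" for k
  proof -
    have "(M #> a) [^]\<^bsub>G Mod M\<^esub> k = M #> a [^] k"
      using M.FactGroup_pow[OF a] by simp
    also have "\<dots> = M" using that a im M.rcos_const by simp
    finally have "n dvd k" using Q.pow_eq_id[OF Ma, of k] ordMa by simp
    then show "k = 0" using that by (metis nat_dvd_not_less gr0I)
  qed
  have dec: "\<exists>u\<in>carrier N. \<exists>k<n. g = \<phi> u \<otimes> a [^] k" if g: "g \<in> carrier G" for g
  proof -
    have "M #> g \<in> generate (G Mod M) {M #> a}"
      using g gen by (simp add: carrier_FactGroup)
    then obtain j where j: "M #> g = (M #> a) [^]\<^bsub>G Mod M\<^esub> (j::nat)"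
      using Q.generate_pow_on_finite_carrier[OF fin Ma] by auto
    define k where "k = j mod n"
    have k: "k < n" using assms(3) by (simp add: k_def)
    have "(M #> a) [^]\<^bsub>G Mod M\<^esub> (n * (j div n)) = \<one>\<^bsub>G Mod M\<^esub>"
      using Q.pow_eq_id[OF Ma, of "n * (j div n)"] ordMa by simp
    then have "M #> g = (M #> a) [^]\<^bsub>G Mod M\<^esub> k"
      using Q.nat_pow_mult[OF Ma, of "n * (j div n)" k] Q.l_one[OF Q.nat_pow_closed[OF Ma], of k] j
      by (simp add: k_def)
    then have "M #> g = M #> a [^] k" using M.FactGroup_pow[OF a] by simp
    then have "g \<in> M #> a [^] k" using rcos_self[OF g M.subgroup_axioms] by simp
    then show ?thesis using k im by (auto simp: r_coset_def)
  qed
  show thesis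
    by (rule that[of \<phi> a], unfold presents_def prod.case)
      (intro conjI ballI allI impI hom inj a pw step dec zero; assumption)
qed

lemma presents_imp_realizes:
  fixes G (structure)
  assumes "group G" "group N" "0 < n" "\<tau> \<in> carrier N \<rightarrow> carrier N" "presents G (N, n, \<tau>, v) \<phi> a"
  shows "realizes G (N, n, \<tau>, v)"
proof -
  interpret group G by fact
  interpret N: group N by fact
  from assms(5) have hom: "\<phi> \<in> hom N G" and inj: "inj_on \<phi> (carrier N)" and a: "a \<in> carrier G"
    and pw: "a [^] n = \<phi> v" and step: "\<And>u. u \<in> carrier N \<Longrightarrow> a \<otimes> \<phi> u = \<phi> (\<tau> u) \<otimes> a"
    and dec: "\<And>g. g \<in> carrier G \<Longrightarrow> \<exists>u\<in>carrier N. \<exists>k<n. g = \<phi> u \<otimes> a [^] k"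
    and zero: "\<And>k. k < n \<Longrightarrow> a [^] k \<in> \<phi> ` carrier N \<Longrightarrow> k = 0"
    by (auto simp: presents_def)
  interpret \<phi>: group_hom N G \<phi>
    using hom by (simp add: group_hom_def group_hom_axioms_def N.is_group is_group)
  define M where "M = \<phi> ` carrier N"
  have sub: "subgroup M G" unfolding M_def by (rule \<phi>.img_is_subgroup)
  have norm: "M \<lhd> G"
  proof (rule normal_invI[OF sub])
    fix g h assume g: "g \<in> carrier G" and h: "h \<in> M"
    obtain w where w: "w \<in> carrier N" "h = \<phi> w" using h by (auto simp: M_def)
    obtain u k where u: "u \<in> carrier N" "k < n" "g = \<phi> u \<otimes> a [^] k" using dec[OF g] by (elim bexE exE conjE) (rule that)
    have *: "a [^] k \<otimes> \<phi> w = \<phi> ((\<tau> ^^ k) w) \<otimes> a [^] k" "(\<tau> ^^ k) w \<in> carrier N"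
      using pow_conj_shift[of a "carrier N" \<tau> \<phi> w k] a assms(4) step w by auto
    have "g \<otimes> h \<otimes> inv g = \<phi> u \<otimes> (a [^] k \<otimes> \<phi> w) \<otimes> inv (a [^] k) \<otimes> inv (\<phi> u)"
      using u w a by (simp add: inv_mult_group m_assoc)
    also have "\<dots> = \<phi> u \<otimes> \<phi> ((\<tau> ^^ k) w) \<otimes> inv (\<phi> u)"
      using u w a * by (simp add: m_assoc)
    also have "\<dots> \<in> M"
      using u * sub by (auto simp: M_def subgroup.m_closed subgroup.m_inv_closed)
    finally show "g \<otimes> h \<otimes> inv g \<in> M" .
  qed
  interpret M: normal M G by fact
  interpret Q: group "G Mod M" by (rule M.factorgroup_is_group)
  have Ma: "M #> a \<in> carrier (G Mod M)" using a by (simp add: carrier_FactGroup)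
  have cos: "M #> g \<in> (\<lambda>k. (M #> a) [^]\<^bsub>G Mod M\<^esub> k) ` {..<n}" if g: "g \<in> carrier G" for g
  proof -
    obtain u k where u: "u \<in> carrier N" "k < n" "g = \<phi> u \<otimes> a [^] k" using dec[OF g] by (elim bexE exE conjE) (rule that)
    have "M #> g = M #> a [^] k"
      using u a M.subset M.rcos_const[OF is_group, of "\<phi> u"] by (simp add: coset_mult_assoc[symmetric] M_def)
    then show ?thesis using u M.FactGroup_pow[OF a] by auto
  qed
  have carr: "carrier (G Mod M) = (\<lambda>k. (M #> a) [^]\<^bsub>G Mod M\<^esub> k) ` {..<n}"
  proof
    show "carrier (G Mod M) \<subseteq> (\<lambda>k. (M #> a) [^]\<^bsub>G Mod M\<^esub> k) ` {..<n}"
      using cos by (auto simp: carrier_FactGroup)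
    show "(\<lambda>k. (M #> a) [^]\<^bsub>G Mod M\<^esub> k) ` {..<n} \<subseteq> carrier (G Mod M)"
      using Q.nat_pow_closed[OF Ma] by blast
  qed
  have gen: "generate (G Mod M) {M #> a} = carrier (G Mod M)"
  proof
    show "generate (G Mod M) {M #> a} \<subseteq> carrier (G Mod M)"
      using Ma by (intro Q.generate_incl) auto
    have "(M #> a) [^]\<^bsub>G Mod M\<^esub> (k::nat) \<in> generate (G Mod M) {M #> a}" for k
      unfolding Q.generate_pow[OF Ma] by (auto simp: int_pow_int[symmetric])
    then show "carrier (G Mod M) \<subseteq> generate (G Mod M) {M #> a}"
      unfolding carr by auto
  qed
  have cyc: "cyclic_group (G Mod M)"
  proof -
    have "carrier (G Mod M) = range (\<lambda>k::int. (M #> a) [^]\<^bsub>G Mod M\<^esub> k)"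
      unfolding gen[symmetric] Q.generate_pow[OF Ma] by auto
    then show ?thesis using Ma Q.cyclic_group by blast
  qed
  have "inj_on (\<lambda>k. (M #> a) [^]\<^bsub>G Mod M\<^esub> k) {..<n}"
  proof (rule linorder_inj_onI)
    fix k l assume kl: "k < l" "k \<in> {..<n}" "l \<in> {..<n}"
    show "(M #> a) [^]\<^bsub>G Mod M\<^esub> k \<noteq> (M #> a) [^]\<^bsub>G Mod M\<^esub> l"
    proof
      assume "(M #> a) [^]\<^bsub>G Mod M\<^esub> k = (M #> a) [^]\<^bsub>G Mod M\<^esub> l"
      then have "(M #> a) [^]\<^bsub>G Mod M\<^esub> (l - k) = \<one>\<^bsub>G Mod M\<^esub>"
        using Q.pow_eq_div2[OF Ma, of l k] by simp
      then have "M #> a [^] (l - k) = M"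
        using M.FactGroup_pow[OF a] by simp
      then have "a [^] (l - k) \<in> M"
        using a sub by (metis nat_pow_closed rcos_self)
      then show False using zero[of "l - k"] kl less_imp_diff_less[of l n k] by (auto simp: M_def)
    qed
  qed auto
  then have "order (G Mod M) = n" by (simp add: order_def carr card_image)
  moreover have "\<phi> \<in> iso N (G\<lparr>carrier := M\<rparr>)"
    using hom inj by (auto simp: iso_def hom_def M_def bij_betw_def)
  moreover have "a \<otimes> \<phi> y \<otimes> inv a = \<phi> (\<tau> y)" if "y \<in> carrier N" for y
    using step[OF that] that a assms(4) by (metis \<phi>.hom_closed funcset_mem inv_solve_right m_closed)
  ultimately show ?thesis
    unfolding realizes_def using norm cyc a gen pw by auto
qed

text \<open>For prime index an element outside the image of \<open>N\<close> is enough: its first \<open>p\<close> powers lie in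
  distinct cosets, and the order of \<open>G\<close> leaves no further cosets.\<close>

lemma presentsI_prime:
  fixes G (structure)
  assumes "group G" "group N" "prime p" and hom: "\<phi> \<in> hom N G" and inj: "inj_on \<phi> (carrier N)"
    and a: "a \<in> carrier G" and pw: "a [^]\<^bsub>G\<^esub> p = \<phi> v" and v: "v \<in> carrier N"
    and step: "\<And>u. u \<in> carrier N \<Longrightarrow> a \<otimes>\<^bsub>G\<^esub> \<phi> u = \<phi> (\<tau> u) \<otimes>\<^bsub>G\<^esub> a"
    and out: "a \<notin> \<phi> ` carrier N" and ord: "order G = p * order N" and fin: "finite (carrier G)"
  shows "presents G (N, p, \<tau>, v) \<phi> a"
proof -
  interpret group G by fact
  interpret N: group N by fact
  interpret \<phi>: group_hom N G \<phi>
    using hom by (simp add: group_hom_def group_hom_axioms_def N.is_group is_group)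
  define M where "M = \<phi> ` carrier N"
  have sub: "subgroup M G" unfolding M_def by (rule \<phi>.img_is_subgroup)
  have out_pow: "a [^] k \<notin> M" if "0 < k" "k < p" for k
  proof -
    have "coprime k p" using that assms(3) by (meson coprime_commute nat_dvd_not_less prime_imp_coprime)
    then show ?thesis using pow_coprime_mem[OF sub a, of k p] pw v out by (auto simp: M_def)
  qed
  have "card M = order N" using inj by (simp add: M_def card_image order_def)
  then have cover: "\<exists>x\<in>M. \<exists>k<p. g = x \<otimes> a [^] k" if "g \<in> carrier G" for g
    using coset_powers_cover[OF sub fin _ a out_pow that, of p] ord by simp
  have "\<exists>u\<in>carrier N. \<exists>k<p. g = \<phi> u \<otimes> a [^] k" if "g \<in> carrier G" for g
    using cover[OF that] unfolding M_def by (simp only: bex_simps(7))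
  then show ?thesis
    unfolding presents_def prod.case
    by (intro conjI ballI allI impI hom inj a pw step) (use out_pow in \<open>auto simp: M_def\<close>)
qed

lemma presents_iso:
  assumes "presents G (N, n, \<tau>, v) \<phi> a" "group G" "group H" "group N" "\<psi> \<in> iso G H"
    and "v \<in> carrier N" "\<tau> \<in> carrier N \<rightarrow> carrier N"
  shows "presents H (N, n, \<tau>, v) (\<psi> \<circ> \<phi>) (\<psi> a)"
proof -
  interpret G: group G by fact
  interpret H: group H by fact
  interpret \<psi>: group_hom G H \<psi>
    using assms by (simp add: group_hom_def group_hom_axioms_def iso_def)
  from assms(1) have hom: "\<phi> \<in> hom N G" and inj: "inj_on \<phi> (carrier N)" and a: "a \<in> carrier G"
    and pw: "a [^]\<^bsub>G\<^esub> n = \<phi> v"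
    and step: "\<And>u. u \<in> carrier N \<Longrightarrow> a \<otimes>\<^bsub>G\<^esub> \<phi> u = \<phi> (\<tau> u) \<otimes>\<^bsub>G\<^esub> a"
    and dec: "\<And>g. g \<in> carrier G \<Longrightarrow> \<exists>u\<in>carrier N. \<exists>k<n. g = \<phi> u \<otimes>\<^bsub>G\<^esub> a [^]\<^bsub>G\<^esub> k"
    and zero: "\<And>k. k < n \<Longrightarrow> a [^]\<^bsub>G\<^esub> k \<in> \<phi> ` carrier N \<Longrightarrow> k = 0"
    by (auto simp: presents_def)
  have c: "\<phi> u \<in> carrier G" if "u \<in> carrier N" for u using hom that by (auto simp: hom_def)
  have \<psi>i: "inj_on \<psi> (carrier G)" "\<psi> ` carrier G = carrier H"
    using assms by (auto simp: iso_def bij_betw_def)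
  have "\<psi> \<circ> \<phi> \<in> hom N H" using hom \<psi>.homh by (rule hom_compose)
  moreover have "inj_on (\<psi> \<circ> \<phi>) (carrier N)"
    using inj \<psi>i c by (auto simp: inj_on_def)
  moreover have "\<psi> a [^]\<^bsub>H\<^esub> n = \<psi> (\<phi> v)" using pw a \<psi>.hom_nat_pow by metis
  moreover have "\<psi> a \<otimes>\<^bsub>H\<^esub> \<psi> (\<phi> u) = \<psi> (\<phi> (\<tau> u)) \<otimes>\<^bsub>H\<^esub> \<psi> a" if "u \<in> carrier N" for u
    using step[OF that] a c that assms(7) by (metis \<psi>.hom_mult funcset_mem)
  moreover have "\<exists>u\<in>carrier N. \<exists>k<n. g = \<psi> (\<phi> u) \<otimes>\<^bsub>H\<^esub> \<psi> a [^]\<^bsub>H\<^esub> k" if g: "g \<in> carrier H" for g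
  proof -
    obtain g' where g': "g' \<in> carrier G" "g = \<psi> g'" using g \<psi>i by blast
    obtain u k where "u \<in> carrier N" "k < n" "g' = \<phi> u \<otimes>\<^bsub>G\<^esub> a [^]\<^bsub>G\<^esub> k"
      using dec[OF g'(1)] by (elim bexE exE conjE) (rule that)
    then show ?thesis using g' a c \<psi>.hom_nat_pow[of a k] by force
  qed
  moreover have "k = 0" if k: "k < n" "\<psi> a [^]\<^bsub>H\<^esub> k \<in> (\<psi> \<circ> \<phi>) ` carrier N" for k
  proof -
    obtain u where u: "u \<in> carrier N" "\<psi> (a [^]\<^bsub>G\<^esub> k) = \<psi> (\<phi> u)"
      using k \<psi>.hom_nat_pow[OF a, of k] by auto
    then have "a [^]\<^bsub>G\<^esub> k = \<phi> u" using \<psi>i a c by (auto simp: inj_on_def)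
    then show ?thesis using zero k u by auto
  qed
  ultimately show ?thesis using a by (simp add: presents_def)
qed


section \<open>The group given by an extension type\<close>

text \<open>For abelian \<open>N\<close> the condition \<open>\<tau>\<^sup>n = Int(v)\<close> says that \<open>\<tau>\<^sup>n\<close> is the identity.\<close>

locale abelian_ext_type = N: comm_group N for N :: "'a monoid" (structure) +
  fixes n :: nat and \<tau> and v
  assumes n_pos: "0 < n" and tau_hom: "\<tau> \<in> hom N N" and v_closed: "v \<in> carrier N"
    and tau_v: "\<tau> v = v" and tau_pow_n: "u \<in> carrier N \<Longrightarrow> (\<tau> ^^ n) u = u"
begin

text \<open>The pair \<open>(u, k)\<close> stands for \<open>u a\<^sup>k\<close>. A carry in the addition of the exponents of \<open>a\<close>
  contributes a factor \<open>a\<^sup>n = v\<close>.\<close>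

definition ext_group :: "('a \<times> nat) monoid" where
  "ext_group = \<lparr>carrier = carrier N \<times> {..<n},
     monoid.mult = (\<lambda>(u, k) (w, l). (u \<otimes> (\<tau> ^^ k) w \<otimes> v [^] ((k + l) div n), (k + l) mod n)),
     one = (\<one>, 0)\<rparr>"

lemma tau_closed: "u \<in> carrier N \<Longrightarrow> (\<tau> ^^ k) u \<in> carrier N"
  using tau_hom by (induction k) (auto simp: hom_def)

lemma tau_mult: "u \<in> carrier N \<Longrightarrow> w \<in> carrier N \<Longrightarrow> (\<tau> ^^ k) (u \<otimes> w) = (\<tau> ^^ k) u \<otimes> (\<tau> ^^ k) w"
proof (induction k)
  case (Suc k)
  then show ?case using tau_hom tau_closed[of u k] tau_closed[of w k] by (simp add: hom_def)
qed simp

lemma tau_one: "(\<tau> ^^ k) \<one> = \<one>"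
  using tau_mult[of \<one> \<one> k] tau_closed[of \<one> k] by simp

lemma tau_v_pow: "(\<tau> ^^ k) (v [^] (m::nat)) = v [^] m"
proof (induction m)
  case (Suc m)
  have "(\<tau> ^^ k) v = v" using tau_v by (induction k) auto
  then show ?case using Suc v_closed by (simp add: tau_mult)
qed (simp add: tau_one)

lemma tau_mod: "u \<in> carrier N \<Longrightarrow> (\<tau> ^^ (k mod n)) u = (\<tau> ^^ k) u"
proof -
  assume u: "u \<in> carrier N"
  have "(\<tau> ^^ (n * q)) w = w" if "w \<in> carrier N" for q w
    using that by (induction q) (auto simp: funpow_add tau_pow_n)
  then have "(\<tau> ^^ (n * (k div n) + k mod n)) u = (\<tau> ^^ (k mod n)) u"
    using u tau_closed by (simp only: funpow_add o_apply)
  then show ?thesis by simp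
qed

lemma ext_simps [simp]:
  "carrier ext_group = carrier N \<times> {..<n}"
  "(u, k) \<otimes>\<^bsub>ext_group\<^esub> (w, l) = (u \<otimes> (\<tau> ^^ k) w \<otimes> v [^] ((k + l) div n), (k + l) mod n)"
  "\<one>\<^bsub>ext_group\<^esub> = (\<one>, 0)"
  by (simp_all add: ext_group_def)

lemma ext_group_is_group: "group ext_group"
proof (rule groupI)
  show "x \<otimes>\<^bsub>ext_group\<^esub> y \<in> carrier ext_group"
    if "x \<in> carrier ext_group" "y \<in> carrier ext_group" for x y
    using that n_pos v_closed tau_closed by (cases x; cases y) auto
  show "\<one>\<^bsub>ext_group\<^esub> \<in> carrier ext_group" using n_pos by simp
  show "\<one>\<^bsub>ext_group\<^esub> \<otimes>\<^bsub>ext_group\<^esub> x = x" if "x \<in> carrier ext_group" for x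
    using that by (cases x) auto
  show "x \<otimes>\<^bsub>ext_group\<^esub> y \<otimes>\<^bsub>ext_group\<^esub> z = x \<otimes>\<^bsub>ext_group\<^esub> (y \<otimes>\<^bsub>ext_group\<^esub> z)"
    if "x \<in> carrier ext_group" "y \<in> carrier ext_group" "z \<in> carrier ext_group" for x y z
  proof -
    obtain u k w l t m where xyz: "x = (u, k)" "y = (w, l)" "z = (t, m)"
      by (metis surj_pair)
    have c: "u \<in> carrier N" "w \<in> carrier N" "t \<in> carrier N"
      "\<And>k. (\<tau> ^^ k) u \<in> carrier N" "\<And>k. (\<tau> ^^ k) w \<in> carrier N" "\<And>k. (\<tau> ^^ k) t \<in> carrier N"
      using that xyz tau_closed by auto
    have vp: "v [^] i \<otimes> v [^] j = v [^] (i + j)" for i j :: nat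
      using v_closed by (simp add: N.nat_pow_mult)
    have e: "(k + l) div n + ((k + l) mod n + m) div n = (k + (l + m) mod n) div n + (l + m) div n"
    proof -
      have d: "(x + m) div n = x div n + (x mod n + m) div n" for x m
      proof -
        have "x + m = (x mod n + m) + n * (x div n)" by simp
        then show ?thesis using n_pos by (metis div_mult_self2 less_numeral_extra(3))
      qed
      have "(k + l) div n + ((k + l) mod n + m) div n = (k + l + m) div n" using d[of "k + l" m] by simp
      moreover have "(k + (l + m) mod n) div n + (l + m) div n = (k + l + m) div n"
        using d[of "l + m" k] by (simp add: ac_simps)
      ultimately show ?thesis by simp
    qed
    have "u \<otimes> (\<tau> ^^ k) w \<otimes> v [^] ((k + l) div n) \<otimes> (\<tau> ^^ ((k + l) mod n)) t \<otimes> v [^] (((k + l) mod n + m) div n)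
      = u \<otimes> (\<tau> ^^ k) w \<otimes> (\<tau> ^^ (k + l)) t \<otimes> (v [^] ((k + l) div n) \<otimes> v [^] (((k + l) mod n + m) div n))"
      using c v_closed by (simp add: tau_mod N.m_ac)
    also have "\<dots> = u \<otimes> (\<tau> ^^ k) (w \<otimes> (\<tau> ^^ l) t \<otimes> v [^] ((l + m) div n)) \<otimes> v [^] ((k + (l + m) mod n) div n)"
      unfolding vp e using c v_closed tau_closed
      by (simp add: tau_mult tau_v_pow funpow_add N.nat_pow_mult[symmetric] N.m_assoc add.commute)
    finally show ?thesis
      unfolding xyz by (simp add: mod_add_left_eq mod_add_right_eq add.assoc)
  qed
  show "\<exists>y\<in>carrier ext_group. y \<otimes>\<^bsub>ext_group\<^esub> x = \<one>\<^bsub>ext_group\<^esub>" if xin: "x \<in> carrier ext_group" for x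
  proof -
    obtain u k where x: "x = (u, k)" "u \<in> carrier N" "k < n" using xin by (cases x) auto
    define l where "l = (n - k) mod n"
    define w where "w = inv ((\<tau> ^^ l) u \<otimes> v [^] ((l + k) div n))"
    have kl: "(l + k) mod n = 0" using x by (simp add: l_def mod_add_left_eq)
    have c: "w \<in> carrier N" "(\<tau> ^^ l) u \<in> carrier N" using x v_closed tau_closed by (auto simp: w_def)
    have "w \<otimes> (\<tau> ^^ l) u \<otimes> v [^] ((l + k) div n) = w \<otimes> ((\<tau> ^^ l) u \<otimes> v [^] ((l + k) div n))"
      using c v_closed by (simp add: N.m_assoc)
    also have "\<dots> = \<one>" unfolding w_def using c v_closed by simp
    finally show ?thesis
      using c kl n_pos unfolding x by (intro bexI[of _ "(w, l)"]) (auto simp: l_def)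
  qed
qed

lemma order_ext_group: "order ext_group = order N * n"
  by (simp add: order_def card_cartesian_product)

lemma ext_pow_one:
  assumes "1 < n" "k \<le> n"
  shows "(\<one>, 1) [^]\<^bsub>ext_group\<^esub> k = (if k = n then (v, 0) else (\<one>, k))"
  using assms(2)
proof (induction k)
  case (Suc k)
  then have "(\<one>, 1) [^]\<^bsub>ext_group\<^esub> Suc k = (\<one>, k) \<otimes>\<^bsub>ext_group\<^esub> (\<one>, 1)" by simp
  then show ?case using Suc assms(1) v_closed tau_one by (auto simp: N.nat_pow_eone)
qed (use assms in auto)

lemma presents_ext_group:
  assumes "1 < n" shows "presents ext_group (N, n, \<tau>, v) (\<lambda>u. (u, 0)) (\<one>, 1)"
proof -
  have \<tau>: "\<tau> u \<in> carrier N" if "u \<in> carrier N" for u using that tau_closed[of u 1] by simp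
  show ?thesis
    unfolding presents_def prod.case
  proof (intro conjI ballI allI impI)
    show "(\<lambda>u. (u, 0)) \<in> hom N ext_group" using n_pos by (auto simp: hom_def)
    show "inj_on (\<lambda>u. (u, 0)) (carrier N)" by (simp add: inj_on_def)
    show "(\<one>, 1) \<in> carrier ext_group" using assms by simp
    show "(\<one>, 1) [^]\<^bsub>ext_group\<^esub> n = (v, 0)" using ext_pow_one[OF assms, of n] by simp
    show "(\<one>, 1) \<otimes>\<^bsub>ext_group\<^esub> (u, 0) = (\<tau> u, 0) \<otimes>\<^bsub>ext_group\<^esub> (\<one>, 1)" if "u \<in> carrier N" for u
      using that assms \<tau> by simp
    show "\<exists>u\<in>carrier N. \<exists>k<n. g = (u, 0) \<otimes>\<^bsub>ext_group\<^esub> (\<one>, 1) [^]\<^bsub>ext_group\<^esub> k"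
      if g: "g \<in> carrier ext_group" for g
    proof -
      obtain u k where "g = (u, k)" "u \<in> carrier N" "k < n" using g by (cases g) auto
      then show ?thesis
        using ext_pow_one[OF assms, of k] by (intro bexI[of _ u] exI[of _ k]) auto
    qed
    show "k = 0" if "k < n" "(\<one>, 1) [^]\<^bsub>ext_group\<^esub> k \<in> (\<lambda>u. (u, 0)) ` carrier N" for k
      using that ext_pow_one[OF assms, of k] by auto
  qed
qed

text \<open>A presentation determines the group: the normal forms multiply as in the model.\<close>

lemma presents_imp_iso_ext_group:
  assumes "group G" "presents G (N, n, \<tau>, v) \<phi> a"
  shows "ext_group \<cong> G"
proof -
  interpret G: group G by fact
  from assms(2) have hom: "\<phi> \<in> hom N G" and inj: "inj_on \<phi> (carrier N)" and a: "a \<in> carrier G"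
    and pw: "a [^]\<^bsub>G\<^esub> n = \<phi> v"
    and step: "\<And>u. u \<in> carrier N \<Longrightarrow> a \<otimes>\<^bsub>G\<^esub> \<phi> u = \<phi> (\<tau> u) \<otimes>\<^bsub>G\<^esub> a"
    and dec: "\<And>g. g \<in> carrier G \<Longrightarrow> \<exists>u\<in>carrier N. \<exists>k<n. g = \<phi> u \<otimes>\<^bsub>G\<^esub> a [^]\<^bsub>G\<^esub> k"
    and zero: "\<And>k. k < n \<Longrightarrow> a [^]\<^bsub>G\<^esub> k \<in> \<phi> ` carrier N \<Longrightarrow> k = 0"
    by (auto simp: presents_def)
  interpret \<phi>: group_hom N G \<phi>
    using hom by (simp add: group_hom_def group_hom_axioms_def N.is_group G.is_group)
  define f where "f = (\<lambda>(u, k). \<phi> u \<otimes>\<^bsub>G\<^esub> a [^]\<^bsub>G\<^esub> (k::nat))"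
  have shift: "a [^]\<^bsub>G\<^esub> k \<otimes>\<^bsub>G\<^esub> \<phi> w = \<phi> ((\<tau> ^^ k) w) \<otimes>\<^bsub>G\<^esub> a [^]\<^bsub>G\<^esub> k" if "w \<in> carrier N" for k w
    using G.pow_conj_shift[of a "carrier N" \<tau> \<phi> w k] a that tau_hom step by (auto simp: hom_def)
  have "f \<in> hom ext_group G"
  proof (rule homI)
    fix x assume "x \<in> carrier ext_group"
    then show "f x \<in> carrier G" using a by (auto simp: f_def)
  next
    fix x y assume "x \<in> carrier ext_group" "y \<in> carrier ext_group"
    then obtain u k w l where xy: "x = (u, k)" "y = (w, l)" "u \<in> carrier N" "w \<in> carrier N"
      by (cases x; cases y) auto
    have c: "\<phi> u \<in> carrier G" "\<phi> w \<in> carrier G" "(\<tau> ^^ k) w \<in> carrier N" "\<phi> ((\<tau> ^^ k) w) \<in> carrier G"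
      using xy tau_closed by auto
    define q r where "q = (k + l) div n" and "r = (k + l) mod n"
    have "a [^]\<^bsub>G\<^esub> (k + l) = a [^]\<^bsub>G\<^esub> (n * q + r)" by (simp add: q_def r_def)
    also have "\<dots> = (a [^]\<^bsub>G\<^esub> n) [^]\<^bsub>G\<^esub> q \<otimes>\<^bsub>G\<^esub> a [^]\<^bsub>G\<^esub> r"
      using a by (simp add: G.nat_pow_mult G.nat_pow_pow)
    also have "\<dots> = \<phi> (v [^] q) \<otimes>\<^bsub>G\<^esub> a [^]\<^bsub>G\<^esub> r"
      using pw v_closed by (simp add: \<phi>.hom_nat_pow)
    finally have e: "a [^]\<^bsub>G\<^esub> k \<otimes>\<^bsub>G\<^esub> a [^]\<^bsub>G\<^esub> l = \<phi> (v [^] q) \<otimes>\<^bsub>G\<^esub> a [^]\<^bsub>G\<^esub> r"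
      using a by (simp add: G.nat_pow_mult)
    have "f x \<otimes>\<^bsub>G\<^esub> f y = \<phi> u \<otimes>\<^bsub>G\<^esub> (a [^]\<^bsub>G\<^esub> k \<otimes>\<^bsub>G\<^esub> \<phi> w) \<otimes>\<^bsub>G\<^esub> a [^]\<^bsub>G\<^esub> l"
      using c a by (simp add: xy f_def G.m_assoc)
    also have "\<dots> = \<phi> u \<otimes>\<^bsub>G\<^esub> \<phi> ((\<tau> ^^ k) w) \<otimes>\<^bsub>G\<^esub> (a [^]\<^bsub>G\<^esub> k \<otimes>\<^bsub>G\<^esub> a [^]\<^bsub>G\<^esub> l)"
      unfolding shift[OF xy(4)] using c a by (simp add: G.m_assoc)
    also have "\<dots> = \<phi> (u \<otimes> (\<tau> ^^ k) w \<otimes> v [^] q) \<otimes>\<^bsub>G\<^esub> a [^]\<^bsub>G\<^esub> r"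
      unfolding e using c a xy v_closed by (simp add: G.m_assoc)
    finally show "f (x \<otimes>\<^bsub>ext_group\<^esub> y) = f x \<otimes>\<^bsub>G\<^esub> f y"
      by (simp add: xy f_def q_def r_def)
  qed
  then interpret f: group_hom ext_group G f
    by (simp add: group_hom_def group_hom_axioms_def ext_group_is_group G.is_group)
  have "inj_on f (carrier ext_group)"
  proof (rule f.inj_on_one_iff[THEN iffD2], intro allI impI)
    fix x assume x: "x \<in> carrier ext_group" "f x = \<one>\<^bsub>G\<^esub>"
    obtain u k where uk: "x = (u, k)" "u \<in> carrier N" "k < n" using x by (cases x) auto
    have "\<phi> u \<otimes>\<^bsub>G\<^esub> a [^]\<^bsub>G\<^esub> k = \<one>\<^bsub>G\<^esub>" using x uk by (simp add: f_def)
    then have "a [^]\<^bsub>G\<^esub> k = \<phi> (inv u)"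
      using uk a by (metis G.inv_equality G.inv_inv G.nat_pow_closed \<phi>.hom_closed \<phi>.hom_inv)
    then have "k = 0" using zero[OF uk(3)] imageI[of "inv u" "carrier N" \<phi>] uk by simp
    then have "\<phi> u = \<phi> \<one>" using x uk a by (simp add: f_def)
    then have "u = \<one>" using inj uk by (meson N.one_closed inj_onD)
    then show "x = \<one>\<^bsub>ext_group\<^esub>" using uk \<open>k = 0\<close> by simp
  qed
  moreover have "f ` carrier ext_group = carrier G"
  proof
    show "f ` carrier ext_group \<subseteq> carrier G" using f.hom_closed by blast
    show "carrier G \<subseteq> f ` carrier ext_group"
    proof
      fix g assume "g \<in> carrier G"
      from dec[OF this] obtain u k where "u \<in> carrier N" "k < n" "g = \<phi> u \<otimes>\<^bsub>G\<^esub> a [^]\<^bsub>G\<^esub> k"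
        by (elim bexE exE conjE) (rule that)
      then show "g \<in> f ` carrier ext_group"
        by (intro image_eqI[of _ _ "(u, k)"]) (auto simp: f_def)
    qed
  qed
  ultimately have "f \<in> iso ext_group G" using f.homh by (simp add: iso_def bij_betw_def)
  then show ?thesis by (rule is_isoI)
qed

end

text \<open>Representatives of the isomorphism classes have to be groups on one fixed type.\<close>

lemma finite_group_iso_nat_group:
  assumes "group K" "finite (carrier K)"
  shows "\<exists>H :: nat monoid. group H \<and> K \<cong> H"
proof -
  obtain f where f: "bij_betw f (carrier K) {0..<card (carrier K)}"
    using ex_bij_betw_finite_nat[OF assms(2)] by blast
  define g where "g = the_inv_into (carrier K) f"
  have g: "g (f x) = x" if "x \<in> carrier K" for x
    using that f by (auto simp: g_def bij_betw_def the_inv_into_f_f)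
  define H :: "nat monoid" where
    "H = \<lparr>carrier = f ` carrier K, monoid.mult = (\<lambda>i j. f (g i \<otimes>\<^bsub>K\<^esub> g j)), one = f \<one>\<^bsub>K\<^esub>\<rparr>"
  interpret group K by fact
  have "f \<in> iso K H"
    using f g by (auto simp: iso_def hom_def H_def bij_betw_def)
  moreover from iso_imp_img_group[OF this] have "group H" by (simp add: H_def)
  ultimately show ?thesis by (blast intro: is_isoI)
qed

section \<open>Products of cyclic groups\<close>

lemma comm_group_cyclic_prod: "comm_group (cyclic_prod ms)"
proof -
  have g: "group (cyclic_prod ms)"
    unfolding cyclic_prod_def by (rule product_group) simp
  show ?thesis
    by (rule group.group_comm_groupI[OF g]) (auto simp: cyclic_prod_def add.commute)
qed

text \<open>A modulus \<open>0\<close> would give an infinite factor, whose carrier is not an interval of residues.\<close>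

lemma carrier_cyclic_prod:
  assumes "0 \<notin> set ms"
  shows "carrier (cyclic_prod ms) = (\<Pi>\<^sub>E i\<in>{..<length ms}. {0..<int (ms ! i)})"
  unfolding cyclic_prod_def carrier_product_group
proof (rule PiE_cong)
  fix i assume "i \<in> {..<length ms}"
  then have "ms ! i \<noteq> 0" using assms nth_mem by (metis lessThan_iff)
  then show "carrier (integer_mod_group (ms ! i)) = {0..<int (ms ! i)}"
    by (simp add: carrier_integer_mod_group)
qed

lemma order_cyclic_prod:
  assumes "0 \<notin> set ms"
  shows "order (cyclic_prod ms) = prod_list ms"
proof -
  have "order (cyclic_prod ms) = (\<Prod>i<length ms. ms ! i)"
    using assms by (simp add: order_def carrier_cyclic_prod card_PiE)
  then show ?thesis by (simp add: prod.list_conv_set_nth atLeast0LessThan)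
qed

lemma col_closed: "0 \<notin> set ms \<Longrightarrow> col ms c \<in> carrier (cyclic_prod ms)"
  by (auto simp: carrier_cyclic_prod col_def in_set_conv_nth intro!: pos_mod_bound)

lemma mult_col:
  "col ms c \<otimes>\<^bsub>cyclic_prod ms\<^esub> col ms d = (\<lambda>i\<in>{..<length ms}. (c ! i + d ! i) mod int (ms ! i))"
  by (auto simp: cyclic_prod_def col_def mod_add_eq)

lemma col_eq_iff:
  "col ms c = col ms d \<longleftrightarrow> (\<forall>i<length ms. int (ms ! i) dvd c ! i - d ! i)"
proof -
  have "col ms c = col ms d \<longleftrightarrow> (\<forall>i<length ms. c ! i mod int (ms ! i) = d ! i mod int (ms ! i))"
  proof
    assume "col ms c = col ms d"
    then have "col ms c i = col ms d i" for i by simp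
    then have "(if i < length ms then c ! i mod int (ms ! i) else undefined) =
        (if i < length ms then d ! i mod int (ms ! i) else undefined)" for i
      by (simp add: col_def restrict_def)
    then show "\<forall>i<length ms. c ! i mod int (ms ! i) = d ! i mod int (ms ! i)" by presburger
  qed (auto simp: col_def)
  then show ?thesis by (simp add: mod_eq_dvd_iff)
qed

lemma nat_lt_2_iff: "i < (2::nat) \<longleftrightarrow> i = 0 \<or> i = 1" by auto
lemma lessThan_2: "{..<2::nat} = {0, 1}" by auto
lemma lessThan_3: "{..<3::nat} = {0, 1, 2}" by auto
lemma nat_lt_3_iff: "i < (3::nat) \<longleftrightarrow> i = 0 \<or> i = 1 \<or> i = 2" by auto

lemma one_cyclic_prod:
  "\<one>\<^bsub>cyclic_prod [k, l]\<^esub> = col [k, l] [0, 0]" "\<one>\<^bsub>cyclic_prod [k, l, m]\<^esub> = col [k, l, m] [0, 0, 0]"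
  by (auto simp: cyclic_prod_def col_def fun_eq_iff nat_lt_2_iff nat_lt_3_iff numeral_2_eq_2[symmetric]
      numeral_3_eq_3[symmetric])

lemma col2_mult:
  "col [k, l] [i, j] \<otimes>\<^bsub>cyclic_prod [k, l]\<^esub> col [k, l] [i', j'] = col [k, l] [i + i', j + j']"
  unfolding mult_col by (auto simp: col_def fun_eq_iff nat_lt_2_iff numeral_2_eq_2[symmetric])

lemma col3_mult:
  "col [k, l, m] [i, j, r] \<otimes>\<^bsub>cyclic_prod [k, l, m]\<^esub> col [k, l, m] [i', j', r'] =
     col [k, l, m] [i + i', j + j', r + r']"
  unfolding mult_col by (auto simp: col_def fun_eq_iff nat_lt_3_iff numeral_3_eq_3[symmetric])

lemma col2_eq_iff:
  "col [k, l] [i, j] = col [k, l] [i', j'] \<longleftrightarrow> int k dvd i - i' \<and> int l dvd j - j'"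
  unfolding col_eq_iff by (auto simp: nat_lt_2_iff numeral_2_eq_2[symmetric])

lemma col3_eq_iff:
  "col [k, l, m] [i, j, r] = col [k, l, m] [i', j', r'] \<longleftrightarrow>
     int k dvd i - i' \<and> int l dvd j - j' \<and> int m dvd r - r'"
  unfolding col_eq_iff by (auto simp: nat_lt_3_iff numeral_3_eq_3[symmetric])

lemma col_cases:
  assumes "u \<in> carrier (cyclic_prod ms)" "0 \<notin> set ms"
  shows "u = col ms (map u [0..<length ms])"
proof
  fix i
  have u: "u \<in> (\<Pi>\<^sub>E i\<in>{..<length ms}. {0..<int (ms ! i)})"
    using assms carrier_cyclic_prod by blast
  show "u i = col ms (map u [0..<length ms]) i"
  proof (cases "i < length ms")
    case True
    then have "u i \<in> {0..<int (ms ! i)}" using PiE_mem[OF u, of i] by simp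
    then show ?thesis using True by (simp add: col_def)
  next
    case False
    then show ?thesis using PiE_arb[OF u, of i] by (simp add: col_def)
  qed
qed

lemma col2_cases:
  assumes "u \<in> carrier (cyclic_prod [k, l])" "0 < k" "0 < l"
  shows "u = col [k, l] [u 0, u 1]"
  using col_cases[OF assms(1)] assms(2,3) by simp

lemma col3_cases:
  assumes "u \<in> carrier (cyclic_prod [k, l, m])" "0 < k" "0 < l" "0 < m"
  shows "u = col [k, l, m] [u 0, u 1, u 2]"
  using col_cases[OF assms(1)] assms(2-) by (simp add: numeral_2_eq_2)

section \<open>The two families of extension types\<close>

text \<open>One family covers all types over \<open>C\<^bsub>p\<^sup>2\<^esub> \<times> C\<^sub>p\<close>: here \<open>\<tau> - 1\<close> maps \<open>(i, j)\<close> to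
  \<open>(p (\<alpha> i + \<beta> j), \<gamma> i)\<close>, so its third power vanishes. In the second family \<open>\<gamma>\<close> distinguishes the
  Jordan type \<open>(2, 1)\<close> from a full Jordan block.\<close>

definition fam2 :: "nat \<Rightarrow> int \<Rightarrow> int \<Rightarrow> int \<Rightarrow> int \<Rightarrow> int \<Rightarrow> (nat \<Rightarrow> int) ext_data" where
  "fam2 p \<alpha> \<beta> \<gamma> c d = mat_ext p [p^2, p] [[1 + \<alpha> * int p, \<beta> * int p], [\<gamma>, 1]] [c, d]"

definition fam3 :: "nat \<Rightarrow> int \<Rightarrow> int \<Rightarrow> (nat \<Rightarrow> int) ext_data" where
  "fam3 p \<gamma> c = mat_ext p [p, p, p] [[1, 1, 0], [0, 1, \<gamma>], [0, 0, 1]] [c, 0, 0]"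

abbreviation tau2 :: "nat \<Rightarrow> int \<Rightarrow> int \<Rightarrow> int \<Rightarrow> (nat \<Rightarrow> int) \<Rightarrow> nat \<Rightarrow> int" where
  "tau2 p \<alpha> \<beta> \<gamma> \<equiv> mat_map [p^2, p] [[1 + \<alpha> * int p, \<beta> * int p], [\<gamma>, 1]]"

abbreviation tau3 :: "nat \<Rightarrow> int \<Rightarrow> (nat \<Rightarrow> int) \<Rightarrow> nat \<Rightarrow> int" where
  "tau3 p \<gamma> \<equiv> mat_map [p, p, p] [[1, 1, 0], [0, 1, \<gamma>], [0, 0, 1]]"

text \<open>The second column may only be multiplied by residues modulo \<open>p\<close>, which is harmless since its
  first entry is divisible by \<open>p\<close>.\<close>

lemma tau2_col:
  assumes "0 < p"
  shows "tau2 p \<alpha> \<beta> \<gamma> (col [p^2, p] [i, j]) =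
    col [p^2, p] [i + int p * (\<alpha> * i + \<beta> * j), j + \<gamma> * i]"
proof -
  have c: "col [p^2, p] [i, j] \<in> carrier (cyclic_prod [p^2, p])"
    using assms by (intro col_closed) auto
  have 1: "((1 + \<alpha> * int p) * (i mod int (p^2)) + \<beta> * int p * (j mod int p)) mod int (p^2) =
    (i + int p * (\<alpha> * i + \<beta> * j)) mod int (p^2)"
  proof -
    have "int p * (j - j mod int p) = int (p^2) * (j div int p)"
      by (simp add: power2_eq_square minus_mod_eq_mult_div)
    then have B: "int (p^2) dvd int p * (j - j mod int p)" by simp
    have A: "int (p^2) dvd i - i mod int (p^2)" by (simp add: minus_mod_eq_mult_div)
    have "int (p^2) dvd (1 + \<alpha> * int p) * (i - i mod int (p^2)) + \<beta> * (int p * (j - j mod int p))"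
      by (rule dvd_add[OF dvd_mult[OF A] dvd_mult[OF B]])
    then show ?thesis unfolding mod_eq_dvd_iff
      by (subst dvd_minus_iff[symmetric]) (simp add: algebra_simps)
  qed
  have 2: "(\<gamma> * (i mod int (p^2)) + j mod int p) mod int p = (j + \<gamma> * i) mod int p"
  proof -
    have "int p dvd i - i mod int (p^2)"
      by (simp add: minus_mod_eq_mult_div power2_eq_square mult.assoc)
    then have "int p dvd \<gamma> * (i - i mod int (p^2)) + (j - j mod int p)"
      by (intro dvd_add dvd_mult) (auto simp: minus_mod_eq_mult_div)
    then show ?thesis unfolding mod_eq_dvd_iff
      by (subst dvd_minus_iff[symmetric]) (simp add: algebra_simps)
  qed
  show ?thesis
    using c 1 2 unfolding mat_map_def
    by (auto simp: col_def fun_eq_iff nat_lt_2_iff numeral_2_eq_2[symmetric] lessThan_2)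
qed

lemma tau3_col:
  assumes "0 < p"
  shows "tau3 p \<gamma> (col [p, p, p] [i, j, l]) = col [p, p, p] [i + j, j + \<gamma> * l, l]"
proof -
  have c: "col [p, p, p] [i, j, l] \<in> carrier (cyclic_prod [p, p, p])"
    using assms by (intro col_closed) auto
  have m: "(j + \<gamma> * (l mod int p)) mod int p = (j + \<gamma> * l) mod int p"
    by (metis mod_add_right_eq mod_mult_right_eq)
  show ?thesis
    using c m unfolding mat_map_def
    by (auto simp: col_def fun_eq_iff nat_lt_3_iff numeral_3_eq_3[symmetric] lessThan_3 mod_simps)
qed

text \<open>The binomial expansion of \<open>(1 + D)\<^sup>k\<close> with \<open>D\<^sup>3 = 0\<close>; for \<open>k = p\<close> it is the identity.\<close>

lemma tau2_funpow:
  assumes "0 < p"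
  shows "(tau2 p \<alpha> \<beta> \<gamma> ^^ k) (col [p^2, p] [i, j]) =
    col [p^2, p] [i + int p * (int k * (\<alpha> * i + \<beta> * j) + int (k choose 2) * \<beta> * \<gamma> * i), j + int k * \<gamma> * i]"
proof (induction k)
  case (Suc k)
  show ?case
    unfolding funpow.simps o_apply Suc tau2_col[OF assms] col2_eq_iff
  proof
    have "(i + int p * (int k * (\<alpha> * i + \<beta> * j) + int (k choose 2) * \<beta> * \<gamma> * i) +
      int p * (\<alpha> * (i + int p * (int k * (\<alpha> * i + \<beta> * j) + int (k choose 2) * \<beta> * \<gamma> * i)) + \<beta> * (j + int k * \<gamma> * i)) -
      (i + int p * (int (Suc k) * (\<alpha> * i + \<beta> * j) + int (Suc k choose 2) * \<beta> * \<gamma> * i)))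
      = int (p^2) * (\<alpha> * (int k * (\<alpha> * i + \<beta> * j) + int (k choose 2) * \<beta> * \<gamma> * i))"
      by (simp add: numeral_2_eq_2 algebra_simps power2_eq_square)
    then show "int (p^2) dvd (i + int p * (int k * (\<alpha> * i + \<beta> * j) + int (k choose 2) * \<beta> * \<gamma> * i) +
      int p * (\<alpha> * (i + int p * (int k * (\<alpha> * i + \<beta> * j) + int (k choose 2) * \<beta> * \<gamma> * i)) + \<beta> * (j + int k * \<gamma> * i)) -
      (i + int p * (int (Suc k) * (\<alpha> * i + \<beta> * j) + int (Suc k choose 2) * \<beta> * \<gamma> * i)))" by simp
    have "(j + int k * \<gamma> * i +
      \<gamma> * (i + int p * (int k * (\<alpha> * i + \<beta> * j) + int (k choose 2) * \<beta> * \<gamma> * i)) - (j + int (Suc k) * \<gamma> * i))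
      = int p * (\<gamma> * (int k * (\<alpha> * i + \<beta> * j) + int (k choose 2) * \<beta> * \<gamma> * i))"
      by (simp add: algebra_simps)
    then show "int p dvd (j + int k * \<gamma> * i +
      \<gamma> * (i + int p * (int k * (\<alpha> * i + \<beta> * j) + int (k choose 2) * \<beta> * \<gamma> * i)) - (j + int (Suc k) * \<gamma> * i))"
      by simp
  qed
qed (simp add: col2_eq_iff binomial_eq_0)

lemma tau3_funpow:
  assumes "0 < p"
  shows "(tau3 p \<gamma> ^^ k) (col [p, p, p] [i, j, l]) =
    col [p, p, p] [i + int k * j + int (k choose 2) * \<gamma> * l, j + int k * \<gamma> * l, l]"
proof (induction k)
  case (Suc k)
  show ?case
    unfolding funpow.simps o_apply Suc tau3_col[OF assms] col3_eq_iff
    by (simp add: numeral_2_eq_2 algebra_simps)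
qed (simp add: col3_eq_iff binomial_eq_0)

lemma prime_dvd_choose_2:
  assumes "prime p" "odd p" shows "int p dvd int (p choose 2)"
proof -
  have "2 < p" using prime_ge_2_nat[OF assms(1)] assms(2) by (cases "p = 2") auto
  then show ?thesis using assms dvd_choose_prime[of 2 p] by simp
qed

lemma prime_dvd_choose_3:
  assumes "prime p" "odd p" "p \<noteq> 3" shows "int p dvd int (p choose 3)"
proof -
  have "3 < p" using prime_ge_2_nat[OF assms(1)] assms(2,3) by (cases "p = 2") auto
  then show ?thesis using dvd_choose_prime[of 3 p] assms(1) by simp
qed

text \<open>Bijectivity is automatic, because \<open>\<tau>\<^sup>n\<^sup>-\<^sup>1\<close> inverts \<open>\<tau>\<close>.\<close>

lemma (in abelian_ext_type) extension_typeI: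
  assumes "\<tau> \<in> extensional (carrier N)"
  shows "extension_type (N, n, \<tau>, v)"
proof -
  have cl: "\<tau> u \<in> carrier N" if "u \<in> carrier N" for u using that tau_closed[of u 1] by simp
  have "bij_betw \<tau> (carrier N) (carrier N)"
  proof (rule bij_betwI[where g = "\<tau> ^^ (n - 1)"])
    show "\<tau> \<in> carrier N \<rightarrow> carrier N" "\<tau> ^^ (n - 1) \<in> carrier N \<rightarrow> carrier N"
      using cl tau_closed by auto
    obtain m where m: "n = Suc m" using n_pos gr0_implies_Suc by blast
    show "(\<tau> ^^ (n - 1)) (\<tau> x) = x" if "x \<in> carrier N" for x
      using tau_pow_n[OF that] unfolding m by (simp add: funpow_swap1)
    show "\<tau> ((\<tau> ^^ (n - 1)) x) = x" if "x \<in> carrier N" for x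
      using tau_pow_n[OF that] unfolding m by simp
  qed
  then have aut: "\<tau> \<in> auto N" using tau_hom assms by (simp add: auto_def Bij_def)
  interpret A: group "AutoGroup N" by (rule N.AutoGroup)
  have carr: "carrier (AutoGroup N) = auto N" by (simp add: AutoGroup_def)
  have pw: "(\<tau> [^]\<^bsub>AutoGroup N\<^esub> k) u = (\<tau> ^^ k) u" if "u \<in> carrier N" for k :: nat and u
  proof (induction k)
    case 0
    then show ?case using that by (simp add: AutoGroup_def BijGroup_def)
  next
    case (Suc k)
    define q where "q = \<tau> [^]\<^bsub>AutoGroup N\<^esub> k"
    have q: "q \<in> auto N" unfolding q_def using aut carr A.nat_pow_closed by blast
    have "\<tau> [^]\<^bsub>AutoGroup N\<^esub> Suc k = \<tau> \<otimes>\<^bsub>AutoGroup N\<^esub> q"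
      unfolding q_def using aut carr by (intro A.nat_pow_Suc2) simp
    also have "\<dots> = compose (carrier N) \<tau> q"
      using q aut by (simp add: AutoGroup_def BijGroup_def auto_def)
    finally have "(\<tau> [^]\<^bsub>AutoGroup N\<^esub> Suc k) u = \<tau> (q u)" using that by (simp only: compose_eq)
    then show ?case using Suc by (simp only: q_def funpow.simps o_apply)
  qed
  have "\<tau> [^]\<^bsub>AutoGroup N\<^esub> n = inner_aut N v"
  proof (rule extensionalityI[of _ "carrier N"])
    have "\<tau> [^]\<^bsub>AutoGroup N\<^esub> n \<in> auto N" using aut carr A.nat_pow_closed by blast
    then show "\<tau> [^]\<^bsub>AutoGroup N\<^esub> n \<in> extensional (carrier N)"
      by (simp add: auto_def Bij_def)
    show "inner_aut N v \<in> extensional (carrier N)" by (simp add: inner_aut_def)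
    fix u assume u: "u \<in> carrier N"
    have "v \<otimes> u \<otimes> inv v = u" using u v_closed by (simp add: N.m_comm[of v u] N.m_assoc)
    then show "(\<tau> [^]\<^bsub>AutoGroup N\<^esub> n) u = inner_aut N v u"
      using u pw[OF u] tau_pow_n[OF u] by (simp add: inner_aut_def)
  qed
  then show ?thesis
    using n_pos aut v_closed tau_v N.group_axioms by (simp add: extension_type_def)
qed

lemma abelian_ext_type_fam2:
  assumes "prime p" "odd p" "int p dvd \<alpha> * c + \<beta> * d" "int p dvd \<gamma> * c"
  shows "abelian_ext_type (cyclic_prod [p^2, p]) p (tau2 p \<alpha> \<beta> \<gamma>) (col [p^2, p] [c, d])"
proof -
  interpret N: comm_group "cyclic_prod [p^2, p]" by (rule comm_group_cyclic_prod)
  have p: "0 < p" "0 < p^2" using assms by (auto simp: prime_gt_0_nat)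
  have cc: "col [p^2, p] l \<in> carrier (cyclic_prod [p^2, p])" for l
    using p by (intro col_closed) auto
  note cas = col2_cases[OF _ p(2) p(1)]
  show ?thesis
  proof (unfold_locales)
    show "0 < p" by (rule p)
    show "tau2 p \<alpha> \<beta> \<gamma> \<in> hom (cyclic_prod [p^2, p]) (cyclic_prod [p^2, p])"
    proof (rule homI)
      fix u assume u: "u \<in> carrier (cyclic_prod [p^2, p])"
      show "tau2 p \<alpha> \<beta> \<gamma> u \<in> carrier (cyclic_prod [p^2, p])"
        using cas[OF u] tau2_col[OF p(1), of \<alpha> \<beta> \<gamma> "u 0" "u 1"] cc by metis
      fix w assume w: "w \<in> carrier (cyclic_prod [p^2, p])"
      define i j i' j' where ij: "i = u 0" "j = u 1" "i' = w 0" "j' = w 1"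
      have uw: "u = col [p^2, p] [i, j]" "w = col [p^2, p] [i', j']"
        using cas[OF u] cas[OF w] by (simp_all add: ij)
      show "tau2 p \<alpha> \<beta> \<gamma> (u \<otimes>\<^bsub>cyclic_prod [p^2, p]\<^esub> w) =
        tau2 p \<alpha> \<beta> \<gamma> u \<otimes>\<^bsub>cyclic_prod [p^2, p]\<^esub> tau2 p \<alpha> \<beta> \<gamma> w"
        unfolding uw col2_mult tau2_col[OF p(1)] col2_eq_iff by (simp add: algebra_simps)
    qed
    show "col [p^2, p] [c, d] \<in> carrier (cyclic_prod [p^2, p])" by (rule cc)
    show "tau2 p \<alpha> \<beta> \<gamma> (col [p^2, p] [c, d]) = col [p^2, p] [c, d]"
      unfolding tau2_col[OF p(1)] col2_eq_iff using assms by (simp add: power2_eq_square)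
    fix u assume u: "u \<in> carrier (cyclic_prod [p^2, p])"
    have "(tau2 p \<alpha> \<beta> \<gamma> ^^ p) (col [p^2, p] [u 0, u 1]) = col [p^2, p] [u 0, u 1]"
      unfolding tau2_funpow[OF p(1)] col2_eq_iff
      using prime_dvd_choose_2[OF assms(1,2)] by (auto simp: power2_eq_square)
    then show "(tau2 p \<alpha> \<beta> \<gamma> ^^ p) u = u" using cas[OF u] by simp
  qed
qed

lemma abelian_ext_type_fam3:
  assumes "prime p" "odd p"
  shows "abelian_ext_type (cyclic_prod [p, p, p]) p (tau3 p \<gamma>) (col [p, p, p] [c, 0, 0])"
proof -
  interpret N: comm_group "cyclic_prod [p, p, p]" by (rule comm_group_cyclic_prod)
  have p: "0 < p" using assms by (auto simp: prime_gt_0_nat)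
  have cc: "col [p, p, p] l \<in> carrier (cyclic_prod [p, p, p])" for l
    using p by (intro col_closed) auto
  note cas = col3_cases[OF _ p p p]
  show ?thesis
  proof (unfold_locales)
    show "0 < p" by (rule p)
    show "tau3 p \<gamma> \<in> hom (cyclic_prod [p, p, p]) (cyclic_prod [p, p, p])"
    proof (rule homI)
      fix u assume u: "u \<in> carrier (cyclic_prod [p, p, p])"
      show "tau3 p \<gamma> u \<in> carrier (cyclic_prod [p, p, p])"
        using cas[OF u] tau3_col[OF p, of \<gamma> "u 0" "u 1" "u 2"] cc by metis
      fix w assume w: "w \<in> carrier (cyclic_prod [p, p, p])"
      define i j l i' j' l' where ij: "i = u 0" "j = u 1" "l = u 2" "i' = w 0" "j' = w 1" "l' = w 2"
      have uw: "u = col [p, p, p] [i, j, l]" "w = col [p, p, p] [i', j', l']"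
        using cas[OF u] cas[OF w] by (simp_all add: ij)
      show "tau3 p \<gamma> (u \<otimes>\<^bsub>cyclic_prod [p, p, p]\<^esub> w) =
        tau3 p \<gamma> u \<otimes>\<^bsub>cyclic_prod [p, p, p]\<^esub> tau3 p \<gamma> w"
        unfolding uw col3_mult tau3_col[OF p] col3_eq_iff by (simp add: algebra_simps)
    qed
    show "col [p, p, p] [c, 0, 0] \<in> carrier (cyclic_prod [p, p, p])" by (rule cc)
    show "tau3 p \<gamma> (col [p, p, p] [c, 0, 0]) = col [p, p, p] [c, 0, 0]"
      unfolding tau3_col[OF p] col3_eq_iff by simp
    fix u assume u: "u \<in> carrier (cyclic_prod [p, p, p])"
    have "(tau3 p \<gamma> ^^ p) (col [p, p, p] [u 0, u 1, u 2]) = col [p, p, p] [u 0, u 1, u 2]"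
      unfolding tau3_funpow[OF p] col3_eq_iff
      using prime_dvd_choose_2[OF assms(1,2)] by auto
    then show "(tau3 p \<gamma> ^^ p) u = u" using cas[OF u] by simp
  qed
qed

section \<open>Realizations from generators\<close>

text \<open>Independence of the exponents of \<open>x\<close> and \<open>y\<close> makes \<open>(i, j) \<mapsto> x\<^sup>i y\<^sup>j\<close> an embedding. Its image is
  abelian, so an element that does not commute with \<open>x\<close> or \<open>y\<close> lies outside.\<close>

lemma realizes_fam2I:
  fixes G (structure)
  assumes "group G" "order G = p^4" "prime p" "x \<in> carrier G" "y \<in> carrier G" "a \<in> carrier G"
    and xy: "x \<otimes> y = y \<otimes> x" and ordx: "x [^] (int p^2) = \<one>" and ordy: "y [^] int p = \<one>"
    and indep: "\<And>i j::int. x [^] i \<otimes> y [^] j = \<one> \<Longrightarrow> int p^2 dvd i \<and> int p dvd j"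
    and ax: "a \<otimes> x = x [^] (1 + \<alpha> * int p) \<otimes> y [^] \<gamma> \<otimes> a"
    and ay: "a \<otimes> y = x [^] (\<beta> * int p) \<otimes> y \<otimes> a"
    and pw: "a [^] p = x [^] c \<otimes> y [^] d"
    and nc: "a \<otimes> x \<noteq> x \<otimes> a \<or> a \<otimes> y \<noteq> y \<otimes> a"
  shows "realizes G (fam2 p \<alpha> \<beta> \<gamma> c d)"
proof -
  interpret group G by fact
  have p: "0 < p" "0 < p^2" using assms by (auto simp: prime_gt_0_nat)
  let ?N = "cyclic_prod [p^2, p]"
  interpret N: comm_group ?N by (rule comm_group_cyclic_prod)
  note cas = col2_cases[OF _ p(2) p(1)]
  have cc: "col [p^2, p] l \<in> carrier ?N" for l
    using p by (intro col_closed) auto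
  define \<phi> where "\<phi> = (\<lambda>u::nat \<Rightarrow> int. x [^] u 0 \<otimes> y [^] u 1)"
  have \<phi>: "\<phi> (col [p^2, p] [i, j]) = x [^] i \<otimes> y [^] j" for i j
    using int_pow_mod[OF assms(4) ordx, of i] int_pow_mod[OF assms(5) ordy, of j]
    by (simp add: \<phi>_def col_def)
  have cm: "x [^] i \<otimes> y [^] j = y [^] j \<otimes> x [^] i" for i j :: int
    using int_pow_commute assms by blast
  note mul = comm2_pow_mult[OF assms(4,5) xy]
  have hom: "\<phi> \<in> hom ?N G"
  proof (rule homI)
    fix u assume u: "u \<in> carrier ?N"
    show "\<phi> u \<in> carrier G" using assms by (simp add: \<phi>_def)
    fix w assume w: "w \<in> carrier ?N"
    define i j i' j' where ij: "i = u 0" "j = u 1" "i' = w 0" "j' = w 1"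
    have uw: "u = col [p^2, p] [i, j]" "w = col [p^2, p] [i', j']"
      using cas[OF u] cas[OF w] by (simp_all add: ij)
    show "\<phi> (u \<otimes>\<^bsub>?N\<^esub> w) = \<phi> u \<otimes> \<phi> w"
      unfolding uw col2_mult \<phi> mul ..
  qed
  interpret \<phi>: group_hom ?N G \<phi>
    using hom by (simp add: group_hom_def group_hom_axioms_def is_group)
  have inj: "inj_on \<phi> (carrier ?N)"
  proof (rule \<phi>.inj_on_one_iff[THEN iffD2], intro allI impI)
    fix u assume u: "u \<in> carrier ?N" "\<phi> u = \<one>"
    have "\<phi> (col [p^2, p] [u 0, u 1]) = \<one>" using u cas by metis
    then have "col [p^2, p] [u 0, u 1] = \<one>\<^bsub>?N\<^esub>"
      unfolding \<phi> one_cyclic_prod col2_eq_iff using indep by simp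
    then show "u = \<one>\<^bsub>?N\<^esub>" using cas[OF u(1)] by simp
  qed
  have step: "a \<otimes> \<phi> u = \<phi> (tau2 p \<alpha> \<beta> \<gamma> u) \<otimes> a" if u: "u \<in> carrier ?N" for u
  proof -
    define i j where ij: "i = u 0" "j = u 1"
    have ue: "u = col [p^2, p] [i, j]" using cas[OF u] by (simp_all add: ij)
    have 1: "a \<otimes> x [^] i = (x [^] (1 + \<alpha> * int p) \<otimes> y [^] \<gamma>) [^] i \<otimes> a"
      using conj_int_pow[OF _ _ _ ax] assms by simp
    have 2: "(x [^] (1 + \<alpha> * int p) \<otimes> y [^] \<gamma>) [^] i = x [^] ((1 + \<alpha> * int p) * i) \<otimes> y [^] (\<gamma> * i)"
      using int_pow_mult_distrib[OF cm, of "1 + \<alpha> * int p" \<gamma> i] assms by (simp add: int_pow_pow)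
    have 3: "a \<otimes> y [^] j = (x [^] (\<beta> * int p) \<otimes> y) [^] j \<otimes> a"
      using conj_int_pow[OF _ _ _ ay] assms by simp
    have 4: "(x [^] (\<beta> * int p) \<otimes> y) [^] j = x [^] (\<beta> * int p * j) \<otimes> y [^] j"
      using int_pow_mult_distrib[OF cm[of "\<beta> * int p" 1], of j] assms by (simp add: int_pow_pow)
    have "a \<otimes> \<phi> u = (a \<otimes> x [^] i) \<otimes> y [^] j"
      unfolding ue \<phi> using assms by (simp add: m_assoc)
    also have "\<dots> = x [^] ((1 + \<alpha> * int p) * i) \<otimes> y [^] (\<gamma> * i) \<otimes> (a \<otimes> y [^] j)"
      unfolding 1 2 using assms by (simp add: m_assoc)
    also have "\<dots> = x [^] ((1 + \<alpha> * int p) * i) \<otimes> y [^] (\<gamma> * i) \<otimes> (x [^] (\<beta> * int p * j) \<otimes> y [^] j) \<otimes> a"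
      unfolding 3 4 using assms by (simp add: m_assoc)
    also have "\<dots> = \<phi> (tau2 p \<alpha> \<beta> \<gamma> u) \<otimes> a"
      unfolding ue tau2_col[OF p(1)] \<phi> mul by (simp add: algebra_simps)
    finally show ?thesis .
  qed
  have xu: "x = \<phi> (col [p^2, p] [1, 0])" and yu: "y = \<phi> (col [p^2, p] [0, 1])"
    unfolding \<phi> using assms by simp_all
  have out: "a \<notin> \<phi> ` carrier ?N"
  proof
    assume "a \<in> \<phi> ` carrier ?N"
    then obtain u where u: "u \<in> carrier ?N" "a = \<phi> u" by auto
    have "a \<otimes> \<phi> w = \<phi> w \<otimes> a" if "w \<in> carrier ?N" for w
      using u that by (metis \<phi>.hom_mult N.m_comm)
    then show False using nc cc xu yu by metis
  qed
  have tcl: "tau2 p \<alpha> \<beta> \<gamma> \<in> carrier ?N \<rightarrow> carrier ?N"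
    using tau2_col[OF p(1)] cas cc by (metis Pi_I)
  have "presents G (?N, p, tau2 p \<alpha> \<beta> \<gamma>, col [p^2, p] [c, d]) \<phi> a"
  proof (rule presentsI_prime[OF assms(1) N.group_axioms assms(3) hom inj assms(6) _ cc step out])
    show "a [^] p = \<phi> (col [p^2, p] [c, d])" using pw \<phi> by simp
    show "order G = p * order ?N"
      using p assms(2) order_cyclic_prod[of "[p^2, p]"] by (auto simp: power2_eq_square power4_eq_xxxx)
    show "finite (carrier G)" using p assms(2) order_gt_0_iff_finite by simp
  qed
  then show ?thesis
    unfolding fam2_def mat_ext_def
    using presents_imp_realizes[OF assms(1) N.group_axioms p(1) tcl] by simp
qed

lemma realizes_fam3I:
  fixes G (structure)
  assumes "group G" "order G = p^4" "prime p" "x \<in> carrier G" "y \<in> carrier G" "z \<in> carrier G" "a \<in> carrier G"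
    and xy: "x \<otimes> y = y \<otimes> x" and xz: "x \<otimes> z = z \<otimes> x" and yz: "y \<otimes> z = z \<otimes> y"
    and ord: "x [^] int p = \<one>" "y [^] int p = \<one>" "z [^] int p = \<one>"
    and indep: "\<And>i j k::int. x [^] i \<otimes> y [^] j \<otimes> z [^] k = \<one> \<Longrightarrow> int p dvd i \<and> int p dvd j \<and> int p dvd k"
    and ax: "a \<otimes> x = x \<otimes> a"
    and ay: "a \<otimes> y = x \<otimes> y \<otimes> a"
    and az: "a \<otimes> z = y [^] \<gamma> \<otimes> z \<otimes> a"
    and pw: "a [^] p = x [^] c"
    and nc: "a \<otimes> y \<noteq> y \<otimes> a"
  shows "realizes G (fam3 p \<gamma> c)"
proof -
  interpret group G by fact
  have p: "0 < p" using assms by (auto simp: prime_gt_0_nat)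
  let ?N = "cyclic_prod [p, p, p]"
  interpret N: comm_group ?N by (rule comm_group_cyclic_prod)
  note cas = col3_cases[OF _ p p p]
  have cc: "col [p, p, p] l \<in> carrier ?N" for l
    using p by (intro col_closed) auto
  define E where "E = (\<lambda>(i::int) (j::int) (l::int). x [^] i \<otimes> y [^] j \<otimes> z [^] l)"
  define \<phi> where "\<phi> = (\<lambda>u::nat \<Rightarrow> int. E (u 0) (u 1) (u 2))"
  have Ec: "E i j l \<in> carrier G" for i j l using assms by (simp add: E_def)
  have \<phi>: "\<phi> (col [p, p, p] [i, j, l]) = E i j l" for i j l
    using int_pow_mod[OF assms(4) ord(1), of i] int_pow_mod[OF assms(5) ord(2), of j]
      int_pow_mod[OF assms(6) ord(3), of l]
    by (simp add: \<phi>_def E_def col_def)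
  have cm: "x [^] i \<otimes> y [^] j = y [^] j \<otimes> x [^] i" "x [^] i \<otimes> z [^] j = z [^] j \<otimes> x [^] i"
    "y [^] i \<otimes> z [^] j = z [^] j \<otimes> y [^] i" for i j :: int
    using int_pow_commute assms by blast+
  have mul: "E i j l \<otimes> E i' j' l' = E (i + i') (j + j') (l + l')" for i j l i' j' l'
    unfolding E_def by (rule comm3_pow_mult[OF assms(4-6) xy xz yz])
  have hom: "\<phi> \<in> hom ?N G"
  proof (rule homI)
    fix u assume u: "u \<in> carrier ?N"
    show "\<phi> u \<in> carrier G" using Ec by (simp add: \<phi>_def)
    fix w assume w: "w \<in> carrier ?N"
    define i j l i' j' l' where ij: "i = u 0" "j = u 1" "l = u 2" "i' = w 0" "j' = w 1" "l' = w 2"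
    have uw: "u = col [p, p, p] [i, j, l]" "w = col [p, p, p] [i', j', l']"
      using cas[OF u] cas[OF w] by (simp_all add: ij)
    show "\<phi> (u \<otimes>\<^bsub>?N\<^esub> w) = \<phi> u \<otimes> \<phi> w"
      unfolding uw col3_mult \<phi> mul ..
  qed
  interpret \<phi>: group_hom ?N G \<phi>
    using hom by (simp add: group_hom_def group_hom_axioms_def is_group)
  have inj: "inj_on \<phi> (carrier ?N)"
  proof (rule \<phi>.inj_on_one_iff[THEN iffD2], intro allI impI)
    fix u assume u: "u \<in> carrier ?N" "\<phi> u = \<one>"
    have "\<phi> (col [p, p, p] [u 0, u 1, u 2]) = \<one>" using u cas by metis
    then have "col [p, p, p] [u 0, u 1, u 2] = \<one>\<^bsub>?N\<^esub>"
      unfolding \<phi> one_cyclic_prod col3_eq_iff using indep by (simp add: E_def)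
    then show "u = \<one>\<^bsub>?N\<^esub>" using cas[OF u(1)] by simp
  qed
  have step: "a \<otimes> \<phi> u = \<phi> (tau3 p \<gamma> u) \<otimes> a" if u: "u \<in> carrier ?N" for u
  proof -
    define i j l where ij: "i = u 0" "j = u 1" "l = u 2"
    have ue: "u = col [p, p, p] [i, j, l]" using cas[OF u] by (simp_all add: ij)
    have 1: "a \<otimes> x [^] i = x [^] i \<otimes> a"
      using conj_int_pow[OF _ _ _ ax] assms by simp
    have 2: "a \<otimes> y [^] j = (x [^] j \<otimes> y [^] j) \<otimes> a"
      using conj_int_pow[OF _ _ _ ay, of j] int_pow_mult_distrib[OF xy, of j] assms by simp
    have 3: "a \<otimes> z [^] l = (y [^] (\<gamma> * l) \<otimes> z [^] l) \<otimes> a"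
      using conj_int_pow[OF _ _ _ az, of l] int_pow_mult_distrib[OF cm(3)[of \<gamma> 1], of l] assms
      by (simp add: int_pow_pow)
    have "a \<otimes> \<phi> u = (a \<otimes> x [^] i) \<otimes> y [^] j \<otimes> z [^] l"
      unfolding ue \<phi> using assms by (simp add: m_assoc E_def)
    also have "\<dots> = x [^] i \<otimes> (a \<otimes> y [^] j) \<otimes> z [^] l"
      unfolding 1 using assms by (simp add: m_assoc)
    also have "\<dots> = x [^] i \<otimes> (x [^] j \<otimes> y [^] j) \<otimes> (a \<otimes> z [^] l)"
      unfolding 2 using assms by (simp add: m_assoc)
    also have "\<dots> = (E (i + j) j 0 \<otimes> E 0 (\<gamma> * l) l) \<otimes> a"
      unfolding 3 using assms by (simp add: m_assoc E_def int_pow_mult)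
    also have "\<dots> = \<phi> (tau3 p \<gamma> u) \<otimes> a"
      unfolding ue tau3_col[OF p(1)] \<phi> mul by simp
    finally show ?thesis .
  qed
  have yu: "y = \<phi> (col [p, p, p] [0, 1, 0])"
    unfolding \<phi> E_def using assms by simp_all
  have out: "a \<notin> \<phi> ` carrier ?N"
  proof
    assume "a \<in> \<phi> ` carrier ?N"
    then obtain u where u: "u \<in> carrier ?N" "a = \<phi> u" by auto
    have "a \<otimes> \<phi> w = \<phi> w \<otimes> a" if "w \<in> carrier ?N" for w
      using u that by (metis \<phi>.hom_mult N.m_comm)
    then show False using nc cc yu by metis
  qed
  have tcl: "tau3 p \<gamma> \<in> carrier ?N \<rightarrow> carrier ?N"
    using tau3_col[OF p(1)] cas cc by (metis Pi_I)
  have "presents G (?N, p, tau3 p \<gamma>, col [p, p, p] [c, 0, 0]) \<phi> a"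
  proof (rule presentsI_prime[OF assms(1) N.group_axioms assms(3) hom inj assms(7) _ cc step out])
    show "a [^] p = \<phi> (col [p, p, p] [c, 0, 0])" unfolding \<phi> using pw assms by (simp add: E_def)
    show "order G = p * order ?N"
      using p assms(2) order_cyclic_prod[of "[p, p, p]"] by (auto simp: power4_eq_xxxx)
    show "finite (carrier G)" using p assms(2) order_gt_0_iff_finite by simp
  qed
  then show ?thesis
    unfolding fam3_def mat_ext_def
    using presents_imp_realizes[OF assms(1) N.group_axioms p(1) tcl] by simp
qed

section \<open>Counting in groups of prime power order\<close>

context group
begin

definition centralizer :: "'a \<Rightarrow> 'a set" where
  "centralizer x = {g \<in> carrier G. g \<otimes> x = x \<otimes> g}"

definition center :: "'a set" where
  "center = {z \<in> carrier G. \<forall>g\<in>carrier G. g \<otimes> z = z \<otimes> g}"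

lemma commute_inv:
  assumes "g \<in> carrier G" "x \<in> carrier G" "g \<otimes> x = x \<otimes> g"
  shows "inv g \<otimes> x = x \<otimes> inv g"
  using assms by (metis inv_closed inv_solve_left inv_solve_right m_assoc m_closed)

lemma commute_mult:
  assumes "g \<in> carrier G" "h \<in> carrier G" "x \<in> carrier G" "g \<otimes> x = x \<otimes> g" "h \<otimes> x = x \<otimes> h"
  shows "g \<otimes> h \<otimes> x = x \<otimes> (g \<otimes> h)"
  using assms by (metis m_assoc)

lemma subgroup_centralizer: "x \<in> carrier G \<Longrightarrow> subgroup (centralizer x) G"
  by (rule subgroupI) (auto simp: centralizer_def commute_inv commute_mult)

lemma subgroup_center: "subgroup center G"
proof (rule subgroupI)
  show "center \<subseteq> carrier G" "center \<noteq> {}" by (auto simp: center_def)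
  fix a assume a: "a \<in> center"
  then have ac: "a \<in> carrier G" and am: "\<And>g. g \<in> carrier G \<Longrightarrow> a \<otimes> g = g \<otimes> a"
    by (simp_all add: center_def)
  have "g \<otimes> inv a = inv a \<otimes> g" if "g \<in> carrier G" for g
    using commute_inv[OF ac that am[OF that]] by (rule sym)
  then show "inv a \<in> center" using ac unfolding center_def by blast
  fix b assume b: "b \<in> center"
  then have bc: "b \<in> carrier G" and bm: "\<And>g. g \<in> carrier G \<Longrightarrow> b \<otimes> g = g \<otimes> b"
    by (simp_all add: center_def)
  have "g \<otimes> (a \<otimes> b) = a \<otimes> b \<otimes> g" if "g \<in> carrier G" for g
    using commute_mult[OF ac bc that am[OF that] bm[OF that]] by (rule sym)
  then show "a \<otimes> b \<in> center" using ac bc unfolding center_def by blast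
qed

lemma conj_eq_self_iff:
  assumes "g \<in> carrier G" "x \<in> carrier G"
  shows "g \<otimes> x \<otimes> inv g = x \<longleftrightarrow> g \<otimes> x = x \<otimes> g"
  using assms inv_solve_right'[of x "g \<otimes> x" g] by auto

lemma card_conj_class:
  assumes "x \<in> carrier G"
  shows "card {g \<otimes> x \<otimes> inv g |g. g \<in> carrier G} * card (centralizer x) = order G"
proof -
  let ?\<phi> = "\<lambda>g. \<lambda>h\<in>carrier G. g \<otimes> h \<otimes> inv g"
  have "orbit G ?\<phi> x = {g \<otimes> x \<otimes> inv g |g. g \<in> carrier G}"
    using assms by (auto simp: orbit_def)
  moreover have "stabilizer G ?\<phi> x = centralizer x"
    using assms conj_eq_self_iff by (auto simp: stabilizer_def centralizer_def)
  ultimately show ?thesis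
    using group_action.orbit_stabilizer_theorem[OF action_by_conjugation assms] by simp
qed

text \<open>An invariant set is a disjoint union of conjugacy classes.\<close>

lemma dvd_card_conj_invariant:
  assumes "finite (carrier G)" "S \<subseteq> carrier G"
    and inv: "\<And>g x. g \<in> carrier G \<Longrightarrow> x \<in> S \<Longrightarrow> g \<otimes> x \<otimes> inv g \<in> S"
    and dvd: "\<And>x. x \<in> S \<Longrightarrow> m dvd card {g \<otimes> x \<otimes> inv g |g. g \<in> carrier G}"
  shows "m dvd card S"
proof -
  define cl where "cl = (\<lambda>x. {g \<otimes> x \<otimes> inv g |g. g \<in> carrier G})"
  have refl: "x \<in> cl x" if "x \<in> S" for x
    using that assms(2) by (auto simp: cl_def intro!: exI[of _ \<one>])
  have sub: "cl y \<subseteq> cl x" if "y \<in> cl x" "x \<in> S" for x y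
  proof
    fix w assume "w \<in> cl y"
    with that obtain g h where gh: "g \<in> carrier G" "h \<in> carrier G" "y = g \<otimes> x \<otimes> inv g" "w = h \<otimes> y \<otimes> inv h"
      by (auto simp: cl_def)
    then have "w = (h \<otimes> g) \<otimes> x \<otimes> inv (h \<otimes> g)"
      using that assms(2) by (auto simp: inv_mult_group m_assoc)
    then show "w \<in> cl x" using gh by (auto simp: cl_def)
  qed
  have sym: "x \<in> cl y" if "y \<in> cl x" "x \<in> S" for x y
  proof -
    obtain g where g: "g \<in> carrier G" "y = g \<otimes> x \<otimes> inv g" using \<open>y \<in> cl x\<close> by (auto simp: cl_def)
    have xc: "x \<in> carrier G" using that assms(2) by blast
    have "inv g \<otimes> (g \<otimes> x \<otimes> inv g) \<otimes> g = (inv g \<otimes> g) \<otimes> x \<otimes> (inv g \<otimes> g)"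
      using g(1) xc by (simp only: m_assoc inv_closed m_closed)
    then have "x = inv g \<otimes> y \<otimes> inv (inv g)" using g xc by simp
    then show ?thesis using g(1) unfolding cl_def by blast
  qed
  have inS: "cl x \<subseteq> S" if "x \<in> S" for x using inv that by (auto simp: cl_def)
  have U: "\<Union>(cl ` S) = S" using refl inS by blast
  have "m dvd card (\<Union>(cl ` S))"
  proof (rule dvd_partition)
    show "finite (\<Union>(cl ` S))" unfolding U using assms finite_subset by blast
    show "\<forall>c\<in>cl ` S. m dvd card c" using dvd by (auto simp: cl_def)
    have "cl x = cl y" if "x \<in> S" "y \<in> S" "w \<in> cl x" "w \<in> cl y" for x y w
      using that sub sym inS by (metis subset_antisym subsetD)
    then show "\<forall>c1\<in>cl ` S. \<forall>c2\<in>cl ` S. c1 \<noteq> c2 \<longrightarrow> c1 \<inter> c2 = {}" by blast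
  qed
  then show ?thesis unfolding U .
qed

lemma card_subgroup_dvd:
  "subgroup H G \<Longrightarrow> card H dvd order G"
  using lagrange[of H] by (metis dvd_triv_right)

lemma finite_order_pow: "prime p \<Longrightarrow> order G = p ^ n \<Longrightarrow> finite (carrier G)"
  using order_gt_0_iff_finite prime_gt_0_nat by simp

lemma conj_notin_center:
  assumes g: "g \<in> carrier G" and x: "x \<in> carrier G" "x \<notin> center"
  shows "g \<otimes> x \<otimes> inv g \<notin> center"
proof
  assume h: "g \<otimes> x \<otimes> inv g \<in> center"
  then have "g \<otimes> (g \<otimes> x \<otimes> inv g) = (g \<otimes> x \<otimes> inv g) \<otimes> g" using g by (simp add: center_def)
  also have "\<dots> = g \<otimes> x" using g x by (simp add: m_assoc)
  finally have "g \<otimes> x \<otimes> inv g = x" using g x by simp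
  then show False using x h by simp
qed

lemma prime_dvd_noncentral_class:
  assumes "prime p" "order G = p ^ n" "x \<in> carrier G" "x \<notin> center"
  shows "p dvd card {g \<otimes> x \<otimes> inv g |g. g \<in> carrier G}"
proof -
  let ?c = "card {g \<otimes> x \<otimes> inv g |g. g \<in> carrier G}"
  have fin: "finite (carrier G)" by (rule finite_order_pow[OF assms(1,2)])
  have e: "?c * card (centralizer x) = p ^ n" using card_conj_class[OF assms(3)] assms(2) by simp
  have "?c dvd p ^ n" unfolding e[symmetric] by (rule dvd_triv_left)
  then obtain i where i: "?c = p ^ i" using divides_primepow_nat[OF assms(1)] by auto
  show ?thesis
  proof (cases i)
    case 0
    then have "card (centralizer x) = card (carrier G)" using e i assms(2) by (simp add: order_def)
    then have "centralizer x = carrier G"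
      using fin by (intro card_subset_eq) (auto simp: centralizer_def)
    then have "x \<in> center" using assms(3) by (auto simp: centralizer_def center_def)
    then show ?thesis using assms by simp
  qed (simp add: i)
qed

text \<open>The class equation modulo \<open>p\<close>: classes of noncentral elements have sizes divisible by \<open>p\<close>.\<close>

lemma normal_meets_center:
  assumes "prime p" "order G = p ^ n" "subgroup M G" "M \<noteq> {\<one>}"
    and inv: "\<And>g x. g \<in> carrier G \<Longrightarrow> x \<in> M \<Longrightarrow> g \<otimes> x \<otimes> inv g \<in> M"
  shows "p dvd card (M \<inter> center)"
proof -
  have fin: "finite (carrier G)" by (rule finite_order_pow[OF assms(1,2)])
  have MG: "M \<subseteq> carrier G" using assms(3) subgroup.subset by blast
  have finM: "finite M" using MG fin finite_subset by blast
  have "p dvd card (M - center)"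
  proof (rule dvd_card_conj_invariant[OF fin])
    show "M - center \<subseteq> carrier G" using MG by blast
    show "p dvd card {g \<otimes> x \<otimes> inv g |g. g \<in> carrier G}" if "x \<in> M - center" for x
      using prime_dvd_noncentral_class[OF assms(1,2)] that MG by blast
    fix g x assume g: "g \<in> carrier G" and x: "x \<in> M - center"
    show "g \<otimes> x \<otimes> inv g \<in> M - center" using conj_notin_center[OF g] inv g x MG by blast
  qed
  moreover have "p dvd card M"
  proof -
    obtain i where i: "card M = p ^ i"
      using card_subgroup_dvd[OF assms(3)] assms(2) divides_primepow_nat[OF assms(1)] by auto
    have "i \<noteq> 0"
    proof
      assume "i = 0"
      then obtain w where "M = {w}" using i card_1_singletonE by auto
      then show False using assms(3,4) subgroup.one_closed by blast
    qed
    then show ?thesis using i by simp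
  qed
  moreover have "card M = card (M \<inter> center) + card (M - center)"
    using finM by (metis card_Int_Diff)
  ultimately show ?thesis by (simp add: dvd_add_left_iff)
qed

lemma prime_power_card_less:
  assumes "prime p" "order G = p ^ n" "subgroup H G" "subgroup K G" "H \<subset> K"
  shows "p * card H dvd card K"
proof -
  obtain i j where ij: "card H = p ^ i" "card K = p ^ j"
    using card_subgroup_dvd[OF assms(3)] card_subgroup_dvd[OF assms(4)] assms(2)
      divides_primepow_nat[OF assms(1)] by auto
  have "finite K" using finite_order_pow[OF assms(1,2)] assms(4) finite_subset subgroup.subset by blast
  then have "p ^ i < p ^ j" using ij assms(5) by (metis psubset_card_mono)
  then have "i < j" using prime_gt_1_nat[OF assms(1)] power_less_imp_less_exp by blast
  then have "p ^ Suc i dvd p ^ j" by (intro le_imp_power_dvd) simp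
  then show ?thesis using ij by simp
qed

text \<open>If every class outside the center had \<open>p\<^sup>2\<close> elements, the center would have order divisible by
  \<open>p\<^sup>2\<close>, and then the centralizers would be too large for that. So some noncentral \<open>x\<close> has a
  centralizer of order \<open>p\<^sup>3\<close>; the center of this centralizer contains \<open>x\<close> besides the center of
  the group, hence has order at least \<open>p\<^sup>2\<close>, and a group whose center has index at most \<open>p\<close> is
  abelian.\<close>

lemma exists_abelian_subgroup:
  assumes "prime p" "order G = p ^ 4" "\<not> comm_group G"
  obtains N where "subgroup N G" "card N = p ^ 3" "\<And>x y. x \<in> N \<Longrightarrow> y \<in> N \<Longrightarrow> x \<otimes> y = y \<otimes> x"
proof -
  have fin: "finite (carrier G)" by (rule finite_order_pow[OF assms(1,2)])
  have p1: "1 < p" using assms(1) prime_gt_1_nat by blast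
  have "\<not> (\<forall>x\<in>carrier G. \<forall>y\<in>carrier G. x \<otimes> y = y \<otimes> x)"
    using assms(3) group_comm_groupI by blast
  then have ncen: "carrier G - center \<noteq> {}" by (auto simp: center_def)
  have "carrier G \<noteq> {\<one>}"
    using assms(2) one_less_power[OF p1, of 4] by (auto simp: order_def)
  then have "p dvd card (carrier G \<inter> center)"
    using normal_meets_center[OF assms(1,2) subgroup_self] by auto
  moreover have cc: "carrier G \<inter> center = center" using subgroup.subset[OF subgroup_center] by blast
  ultimately have pZ: "p dvd card center" by simp
  have strict: "center \<subset> centralizer x" if "x \<in> carrier G" "x \<notin> center" for x
    using that by (auto simp: center_def centralizer_def)
  have "\<exists>x\<in>carrier G - center. card (centralizer x) = p ^ 3"
  proof (rule ccontr)
    assume no: "\<not> ?thesis"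
    have cl: "p ^ 2 dvd card {g \<otimes> x \<otimes> inv g |g. g \<in> carrier G}"
      and c2: "card (centralizer x) dvd p ^ 2" if x: "x \<in> carrier G - center" for x
    proof -
      have xc: "x \<in> carrier G" "x \<notin> center" using x by auto
      obtain i where i: "i \<le> 4" "card (centralizer x) = p ^ i"
        using card_subgroup_dvd[OF subgroup_centralizer[OF xc(1)]] assms(2)
          divides_primepow_nat[OF assms(1)] by auto
      have e: "card {g \<otimes> x \<otimes> inv g |g. g \<in> carrier G} * p ^ i = p ^ 4"
        using card_conj_class[OF xc(1)] i assms(2) by simp
      have "i \<noteq> 3" using no x i by auto
      moreover have "i \<noteq> 4"
      proof
        assume "i = 4"
        then have "card {g \<otimes> x \<otimes> inv g |g. g \<in> carrier G} = 1" using e p1 by simp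
        then show False using prime_dvd_noncentral_class[OF assms(1,2) xc] p1 by simp
      qed
      ultimately have i2: "i \<le> 2" using i by linarith
      then show "card (centralizer x) dvd p ^ 2" using i by (simp add: le_imp_power_dvd)
      have "card {g \<otimes> x \<otimes> inv g |g. g \<in> carrier G} * p ^ i = p ^ (4 - i) * p ^ i"
        using e i by (simp add: power_add[symmetric])
      then have "card {g \<otimes> x \<otimes> inv g |g. g \<in> carrier G} = p ^ (4 - i)" using p1 by simp
      then show "p ^ 2 dvd card {g \<otimes> x \<otimes> inv g |g. g \<in> carrier G}"
        using i2 by (simp add: le_imp_power_dvd)
    qed
    have "p ^ 2 dvd card (carrier G - center)"
    proof (rule dvd_card_conj_invariant[OF fin])
      fix g x assume g: "g \<in> carrier G" and x: "x \<in> carrier G - center"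
      show "g \<otimes> x \<otimes> inv g \<in> carrier G - center" using conj_notin_center[OF g] g x by simp
    qed (use cl in auto)
    moreover have "card (carrier G) = card center + card (carrier G - center)"
      using fin cc by (metis card_Int_Diff)
    moreover have "p ^ 2 dvd card (carrier G)" using assms(2) by (simp add: order_def le_imp_power_dvd)
    ultimately have Z2: "p ^ 2 dvd card center" by (simp add: dvd_add_left_iff)
    obtain x where x: "x \<in> carrier G" "x \<notin> center" using ncen by auto
    have "p * card center dvd card (centralizer x)"
      using prime_power_card_less[OF assms(1,2) subgroup_center subgroup_centralizer strict] x by blast
    also have "card (centralizer x) dvd p ^ 2" using c2 x by blast
    finally have "p * card center dvd p ^ 2" .
    then have "p * p ^ 2 dvd p ^ 2" using Z2 by (meson dvd_trans mult_dvd_mono dvd_refl)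
    then have "p * p ^ 2 \<le> p ^ 2" using p1 by (intro dvd_imp_le) auto
    then show False using p1 by simp
  qed
  then obtain x where x: "x \<in> carrier G" "x \<notin> center" "card (centralizer x) = p ^ 3" by blast
  define C where "C = centralizer x"
  have sC: "subgroup C G" unfolding C_def by (rule subgroup_centralizer[OF x(1)])
  have CG: "C \<subseteq> carrier G" using sC subgroup.subset by blast
  define ZC where "ZC = {c \<in> C. \<forall>d\<in>C. c \<otimes> d = d \<otimes> c}"
  have sZC: "subgroup ZC G"
  proof (rule subgroupI)
    show "ZC \<subseteq> carrier G" using CG by (auto simp: ZC_def)
    have "\<one> \<in> ZC" using subgroup.one_closed[OF sC] CG by (auto simp: ZC_def)
    then show "ZC \<noteq> {}" by blast
    fix c assume c: "c \<in> ZC"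
    then have c': "c \<in> C" "c \<in> carrier G" "\<And>d. d \<in> C \<Longrightarrow> c \<otimes> d = d \<otimes> c" using CG by (auto simp: ZC_def)
    have "inv c \<otimes> d = d \<otimes> inv c" if "d \<in> C" for d
      using commute_inv[OF c'(2) subsetD[OF CG that] c'(3)[OF that]] .
    then show "inv c \<in> ZC" using subgroup.m_inv_closed[OF sC c'(1)] unfolding ZC_def by blast
    fix e assume e: "e \<in> ZC"
    then have e': "e \<in> C" "e \<in> carrier G" "\<And>d. d \<in> C \<Longrightarrow> e \<otimes> d = d \<otimes> e" using CG by (auto simp: ZC_def)
    have "c \<otimes> e \<otimes> d = d \<otimes> (c \<otimes> e)" if "d \<in> C" for d
      using commute_mult[OF c'(2) e'(2) subsetD[OF CG that] c'(3)[OF that] e'(3)[OF that]] .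
    then show "c \<otimes> e \<in> ZC" using subgroup.m_closed[OF sC c'(1) e'(1)] unfolding ZC_def by blast
  qed
  have "center \<subset> ZC"
  proof -
    have "center \<subseteq> ZC"
    proof
      fix z assume "z \<in> center"
      then have "z \<in> carrier G" "\<And>g. g \<in> carrier G \<Longrightarrow> z \<otimes> g = g \<otimes> z" by (simp_all add: center_def)
      then show "z \<in> ZC" using x(1) CG by (auto simp: ZC_def C_def centralizer_def)
    qed
    moreover have "x \<in> ZC" using x by (auto simp: ZC_def C_def centralizer_def)
    ultimately show ?thesis using x by auto
  qed
  then have "p * card center dvd card ZC"
    by (rule prime_power_card_less[OF assms(1,2) subgroup_center sZC])
  then have ZC2: "p * p dvd card ZC" using pZ by (meson dvd_trans mult_dvd_mono dvd_refl)
  have "u \<otimes> w = w \<otimes> u" if uw: "u \<in> C" "w \<in> C" for u w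
  proof (rule ccontr)
    assume ne: "u \<otimes> w \<noteq> w \<otimes> u"
    have uG: "u \<in> carrier G" using uw CG by blast
    let ?H = "C \<inter> centralizer u"
    have sH: "subgroup ?H G" using sC subgroup_centralizer[OF uG] by (rule subgroups_Inter_pair)
    have "ZC \<subset> ?H"
    proof -
      have "ZC \<subseteq> ?H" using CG uw by (auto simp: ZC_def centralizer_def)
      moreover have "u \<in> ?H" using uw uG by (auto simp: centralizer_def)
      moreover have "u \<notin> ZC" using ne uw by (auto simp: ZC_def)
      ultimately show ?thesis by blast
    qed
    then have "p * card ZC dvd card ?H"
      by (rule prime_power_card_less[OF assms(1,2) sZC sH])
    then have "p * (p * p) dvd card ?H" using ZC2 by (meson dvd_trans mult_dvd_mono dvd_refl)
    moreover have "w \<notin> ?H" using ne by (auto simp: centralizer_def)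
    then have "?H \<subset> C" using uw by blast
    then have "p * card ?H dvd card C" by (rule prime_power_card_less[OF assms(1,2) sH sC])
    ultimately have "p * (p * (p * p)) dvd p ^ 3" using x(3) C_def by (metis dvd_trans mult_dvd_mono dvd_refl)
    then have "p ^ 4 dvd p ^ 3" by (simp add: power4_eq_xxxx mult.assoc)
    then have "p ^ 4 \<le> p ^ 3" using p1 by (intro dvd_imp_le) auto
    then show False using p1 power_increasing_iff[of p 4 3] by simp
  qed
  then show thesis using that sC x(3) by (simp add: C_def)
qed

lemma card_image_kernel:
  assumes "subgroup M G" "\<And>x. x \<in> M \<Longrightarrow> f x \<in> carrier G"
    and "\<And>x y. x \<in> M \<Longrightarrow> y \<in> M \<Longrightarrow> f (x \<otimes> y) = f x \<otimes> f y"
  shows "card (f ` M) * card {x \<in> M. f x = \<one>} = card M" and "subgroup (f ` M) G"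
proof -
  let ?K = "G\<lparr>carrier := M\<rparr>"
  have K: "group ?K" using assms(1) subgroup.subgroup_is_group is_group by blast
  interpret f: group_hom ?K G f
    using K assms by (simp add: group_hom_def group_hom_axioms_def is_group hom_def)
  show im: "subgroup (f ` M) G" using f.img_is_subgroup by simp
  let ?L = "G\<lparr>carrier := f ` M\<rparr>"
  have L: "group ?L" using im subgroup.subgroup_is_group is_group by blast
  interpret g: group_hom ?K ?L f
    using K L assms by (simp add: group_hom_def group_hom_axioms_def hom_def)
  have ker: "kernel ?K ?L f = {x \<in> M. f x = \<one>}" by (simp add: kernel_def)
  have "?K Mod kernel ?K ?L f \<cong> ?L" by (rule g.FactGroup_iso) simp
  then have "card (rcosets\<^bsub>?K\<^esub> kernel ?K ?L f) = card (f ` M)"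
    by (auto dest!: iso_same_card simp: FactGroup_def)
  then show "card (f ` M) * card {x \<in> M. f x = \<one>} = card M"
    using group.lagrange[OF K g.subgroup_kernel] ker by (simp add: order_def)
qed

end

section \<open>Unipotent triples\<close>

context group
begin

definition cmt :: "'a \<Rightarrow> 'a \<Rightarrow> 'a" where
  "cmt g h = g \<otimes> h \<otimes> inv g \<otimes> inv h"

lemma cmt_closed: "g \<in> carrier G \<Longrightarrow> h \<in> carrier G \<Longrightarrow> cmt g h \<in> carrier G"
  by (simp add: cmt_def)

lemma mult_cmt: "g \<in> carrier G \<Longrightarrow> h \<in> carrier G \<Longrightarrow> g \<otimes> h = cmt g h \<otimes> h \<otimes> g"
  by (simp add: cmt_def m_assoc)

lemma cmt_eqI:
  assumes "g \<in> carrier G" "h \<in> carrier G" "w \<in> carrier G" "g \<otimes> h = w \<otimes> h \<otimes> g"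
  shows "cmt g h = w"
proof -
  have "cmt g h \<otimes> (h \<otimes> g) = w \<otimes> (h \<otimes> g)"
    using assms mult_cmt[OF assms(1,2)] cmt_closed[OF assms(1,2)] by (simp add: m_assoc)
  then show ?thesis using assms cmt_closed[OF assms(1,2)] by simp
qed

lemma cmt_eq_one_iff:
  assumes c: "g \<in> carrier G" "h \<in> carrier G"
  shows "cmt g h = \<one> \<longleftrightarrow> g \<otimes> h = h \<otimes> g"
proof
  show "g \<otimes> h = h \<otimes> g" if "cmt g h = \<one>" using mult_cmt[OF c] c that by simp
  show "cmt g h = \<one>" if "g \<otimes> h = h \<otimes> g" using cmt_eqI[of g h \<one>] c that by simp
qed

text \<open>In the abelian group generated by \<open>x\<close>, \<open>y\<close>, \<open>z\<close>, written additively, conjugation by \<open>b\<close> minus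
  the identity maps \<open>x\<close> to \<open>y\<close>, \<open>y\<close> to \<open>z\<close> and \<open>z\<close> to \<open>0\<close>.\<close>

definition unipotent :: "'a \<Rightarrow> 'a \<Rightarrow> 'a \<Rightarrow> 'a \<Rightarrow> bool" where
  "unipotent x y z b \<longleftrightarrow> x \<in> carrier G \<and> y \<in> carrier G \<and> z \<in> carrier G \<and> b \<in> carrier G \<and>
     x \<otimes> y = y \<otimes> x \<and> x \<otimes> z = z \<otimes> x \<and> y \<otimes> z = z \<otimes> y \<and>
     b \<otimes> x = x \<otimes> y \<otimes> b \<and> b \<otimes> y = y \<otimes> z \<otimes> b \<and> b \<otimes> z = z \<otimes> b"

lemma unipotent_shift:
  fixes i j l :: int and m :: nat
  assumes "unipotent x y z b"
  shows "b [^] m \<otimes> (x [^] i \<otimes> y [^] j \<otimes> z [^] l) =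
    x [^] i \<otimes> y [^] (j + int m * i) \<otimes> z [^] (l + int m * j + int (m choose 2) * i) \<otimes> b [^] m"
proof -
  have c: "x \<in> carrier G" "y \<in> carrier G" "z \<in> carrier G" "b \<in> carrier G"
    and cm: "x \<otimes> y = y \<otimes> x" "x \<otimes> z = z \<otimes> x" "y \<otimes> z = z \<otimes> y"
    and bx: "b \<otimes> x = x \<otimes> y \<otimes> b" and by1: "b \<otimes> y = y \<otimes> z \<otimes> b" and bz: "b \<otimes> z = z \<otimes> b"
    using assms by (auto simp: unipotent_def)
  have one: "b \<otimes> (x [^] i \<otimes> y [^] j \<otimes> z [^] l) = x [^] i \<otimes> y [^] (j + i) \<otimes> z [^] (l + j) \<otimes> b"
    for i j l :: int
  proof -
    have 1: "b \<otimes> x [^] i = (x [^] i \<otimes> y [^] i) \<otimes> b"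
      using conj_int_pow[OF _ _ _ bx, of i] int_pow_mult_distrib[OF cm(1), of i] c by simp
    have 2: "b \<otimes> y [^] j = (y [^] j \<otimes> z [^] j) \<otimes> b"
      using conj_int_pow[OF _ _ _ by1, of j] int_pow_mult_distrib[OF cm(3), of j] c by simp
    have 3: "b \<otimes> z [^] l = z [^] l \<otimes> b"
      using conj_int_pow[OF _ _ _ bz, of l] c by simp
    have "b \<otimes> (x [^] i \<otimes> y [^] j \<otimes> z [^] l) = (b \<otimes> x [^] i) \<otimes> y [^] j \<otimes> z [^] l"
      using c by (simp add: m_assoc)
    also have "\<dots> = (x [^] i \<otimes> y [^] i) \<otimes> (b \<otimes> y [^] j) \<otimes> z [^] l"
      unfolding 1 using c by (simp add: m_assoc)
    also have "\<dots> = (x [^] i \<otimes> y [^] i) \<otimes> (y [^] j \<otimes> z [^] j) \<otimes> (b \<otimes> z [^] l)"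
      unfolding 2 using c by (simp add: m_assoc)
    also have "\<dots> = (x [^] i \<otimes> (y [^] i \<otimes> y [^] j)) \<otimes> (z [^] j \<otimes> z [^] l) \<otimes> b"
      unfolding 3 using c by (simp add: m_assoc)
    also have "\<dots> = x [^] i \<otimes> y [^] (j + i) \<otimes> z [^] (l + j) \<otimes> b"
      using c by (simp add: int_pow_mult[symmetric] add.commute)
    finally show ?thesis .
  qed
  show ?thesis
  proof (induction m arbitrary: i j l)
    case (Suc m)
    have s: "b [^] Suc m = b \<otimes> b [^] m" using c by (intro nat_pow_Suc2)
    have "b [^] Suc m \<otimes> (x [^] i \<otimes> y [^] j \<otimes> z [^] l) = b \<otimes> (b [^] m \<otimes> (x [^] i \<otimes> y [^] j \<otimes> z [^] l))"
      unfolding s using c by (simp add: m_assoc)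
    also have "\<dots> = (b \<otimes> (x [^] i \<otimes> y [^] (j + int m * i) \<otimes>
        z [^] (l + int m * j + int (m choose 2) * i))) \<otimes> b [^] m"
      unfolding Suc using c by (simp add: m_assoc)
    also have "\<dots> = x [^] i \<otimes> y [^] (j + int m * i + i) \<otimes>
        z [^] (l + int m * j + int (m choose 2) * i + (j + int m * i)) \<otimes> (b \<otimes> b [^] m)"
      unfolding one using c by (simp add: m_assoc)
    also have "j + int m * i + i = j + int (Suc m) * i" by (simp add: algebra_simps)
    also have "l + int m * j + int (m choose 2) * i + (j + int m * i) =
        l + int (Suc m) * j + int (Suc m choose 2) * i" by (simp add: algebra_simps numeral_2_eq_2)
    finally show ?case unfolding s .
  qed (use c in \<open>simp add: binomial_eq_0\<close>)
qed

text \<open>Collecting powers to the left sums the binomial coefficients of \<open>unipotent_shift\<close> along a column of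
  Pascal's triangle, which raises the lower index by one.\<close>

lemma unipotent_mult_pow:
  fixes m :: nat
  assumes "unipotent x y z b"
  shows "(x \<otimes> b) [^] m = x [^] int m \<otimes> y [^] int (m choose 2) \<otimes> z [^] int (m choose 3) \<otimes> b [^] m"
proof -
  have c: "x \<in> carrier G" "y \<in> carrier G" "z \<in> carrier G" "b \<in> carrier G"
    and cm: "x \<otimes> y = y \<otimes> x" "x \<otimes> z = z \<otimes> x" "y \<otimes> z = z \<otimes> y"
    using assms by (auto simp: unipotent_def)
  show ?thesis
  proof (induction m)
    case (Suc m)
    have sh: "b [^] m \<otimes> x = x [^] (1::int) \<otimes> y [^] int m \<otimes> z [^] int (m choose 2) \<otimes> b [^] m"
      using unipotent_shift[OF assms, of m 1 0 0] c by simp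
    have "(x \<otimes> b) [^] Suc m = (x [^] int m \<otimes> y [^] int (m choose 2) \<otimes> z [^] int (m choose 3)) \<otimes> (b [^] m \<otimes> x) \<otimes> b"
      using Suc c by (simp add: m_assoc)
    also have "\<dots> = ((x [^] int m \<otimes> y [^] int (m choose 2) \<otimes> z [^] int (m choose 3)) \<otimes>
        (x [^] (1::int) \<otimes> y [^] int m \<otimes> z [^] int (m choose 2))) \<otimes> b [^] Suc m"
      unfolding sh using c by (simp add: m_assoc)
    also have "\<dots> = x [^] (int m + 1) \<otimes> y [^] (int (m choose 2) + int m) \<otimes>
        z [^] (int (m choose 3) + int (m choose 2)) \<otimes> b [^] Suc m"
      unfolding comm3_pow_mult[OF c(1-3) cm] ..
    also have "int m + 1 = int (Suc m)" by simp
    also have "int (m choose 2) + int m = int (Suc m choose 2)" by (simp add: numeral_2_eq_2)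
    also have "int (m choose 3) + int (m choose 2) = int (Suc m choose 3)"
      by (simp add: numeral_2_eq_2 numeral_3_eq_3)
    finally show ?case .
  qed (use c in \<open>simp add: binomial_eq_0\<close>)
qed

lemma unipotent_pow:
  assumes "unipotent x y z b"
  shows "unipotent x (y [^] int k \<otimes> z [^] int (k choose 2)) (z [^] (int k ^ 2)) (b [^] k)"
proof -
  have c: "x \<in> carrier G" "y \<in> carrier G" "z \<in> carrier G" "b \<in> carrier G"
    and cm: "x \<otimes> y = y \<otimes> x" "x \<otimes> z = z \<otimes> x" "y \<otimes> z = z \<otimes> y"
    using assms by (auto simp: unipotent_def)
  note mul = comm3_pow_mult[OF c(1-3) cm]
  have 1: "x = x [^] (1::int) \<otimes> y [^] (0::int) \<otimes> z [^] (0::int)"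
    "y [^] int k \<otimes> z [^] int (k choose 2) = x [^] (0::int) \<otimes> y [^] int k \<otimes> z [^] int (k choose 2)"
    "z [^] (int k ^ 2) = x [^] (0::int) \<otimes> y [^] (0::int) \<otimes> z [^] (int k ^ 2)"
    using c by simp_all
  show ?thesis
    unfolding unipotent_def
  proof (intro conjI)
    let ?y = "y [^] int k \<otimes> z [^] int (k choose 2)" and ?z = "z [^] (int k ^ 2)"
    show "x \<otimes> ?y = ?y \<otimes> x" by (subst (1 2) 1(1), subst (1 2) 1(2)) (simp only: mul add.commute)
    show "x \<otimes> ?z = ?z \<otimes> x" by (subst (1 2) 1(1), subst (1 2) 1(3)) (simp only: mul add.commute)
    show "?y \<otimes> ?z = ?z \<otimes> ?y" by (subst (1 2) 1(2), subst (1 2) 1(3)) (simp only: mul add.commute)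
    show "b [^] k \<otimes> x = x \<otimes> ?y \<otimes> b [^] k"
      using unipotent_shift[OF assms, of k 1 0 0] c by (simp add: m_assoc)
    have "b [^] k \<otimes> ?y = (x [^] (0::int) \<otimes> y [^] int k \<otimes> z [^] (int (k choose 2) + int k * int k)) \<otimes> b [^] k"
      using unipotent_shift[OF assms, of k 0 "int k" "int (k choose 2)"] c by simp
    also have "x [^] (0::int) \<otimes> y [^] int k \<otimes> z [^] (int (k choose 2) + int k * int k) = ?y \<otimes> ?z"
      using c by (simp add: int_pow_mult power2_eq_square m_assoc)
    finally show "b [^] k \<otimes> ?y = ?y \<otimes> ?z \<otimes> b [^] k" .
    show "b [^] k \<otimes> ?z = ?z \<otimes> b [^] k"
      using unipotent_shift[OF assms, of k 0 0 "int k ^ 2"] c by simp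
  qed (use c in auto)
qed

end

section \<open>An abelian normal subgroup of prime index\<close>

locale abelian_prime_index = group G for G (structure) +
  fixes N :: "'a set" and a :: 'a and p :: nat
  assumes sub: "subgroup N G"
    and comm: "x \<in> N \<Longrightarrow> y \<in> N \<Longrightarrow> x \<otimes> y = y \<otimes> x"
    and prime_p: "prime p" and odd_p: "odd p"
    and a_closed: "a \<in> carrier G" and a_notin: "a \<notin> N"
    and conj_closed: "x \<in> N \<Longrightarrow> a \<otimes> x \<otimes> inv a \<in> N"
    and pow_mem: "a [^] p \<in> N"
    and decomp: "g \<in> carrier G \<Longrightarrow> \<exists>x\<in>N. \<exists>k::nat. g = x \<otimes> a [^] k"
begin

abbreviation D :: "'a \<Rightarrow> 'a" where "D \<equiv> cmt a"

lemma N_closed: "x \<in> N \<Longrightarrow> x \<in> carrier G"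
  using subgroup.subset[OF sub] by blast

lemma N_mult: "x \<in> N \<Longrightarrow> y \<in> N \<Longrightarrow> x \<otimes> y \<in> N"
  using subgroup.m_closed[OF sub] by blast

lemma N_inv: "x \<in> N \<Longrightarrow> inv x \<in> N"
  using subgroup.m_inv_closed[OF sub] by blast

lemma N_one: "\<one> \<in> N"
  using subgroup.one_closed[OF sub] .

lemma N_nat_pow: "x \<in> N \<Longrightarrow> x [^] (k::nat) \<in> N"
  by (induction k) (auto simp: N_one N_mult)

lemma N_int_pow: "x \<in> N \<Longrightarrow> x [^] (k::int) \<in> N"
  using subgroup_int_pow[OF sub] .

lemma D_closed: "x \<in> N \<Longrightarrow> D x \<in> N"
  unfolding cmt_def by (intro N_mult conj_closed N_inv)

lemma a_mult: "x \<in> N \<Longrightarrow> a \<otimes> x = x \<otimes> D x \<otimes> a"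
proof -
  assume x: "x \<in> N"
  have "x \<otimes> D x = D x \<otimes> x" using x D_closed comm by blast
  also have "\<dots> = a \<otimes> x \<otimes> inv a"
    unfolding cmt_def using x N_closed a_closed by (simp add: m_assoc)
  finally show ?thesis using x N_closed a_closed by (simp add: m_assoc)
qed

lemma D_eqI: "x \<in> N \<Longrightarrow> w \<in> N \<Longrightarrow> a \<otimes> x = x \<otimes> w \<otimes> a \<Longrightarrow> D x = w"
  using a_mult[of x] N_closed[of x] N_closed[of w] N_closed[OF D_closed[of x]] a_closed by simp

lemma D_mult: "x \<in> N \<Longrightarrow> y \<in> N \<Longrightarrow> D (x \<otimes> y) = D x \<otimes> D y"
proof -
  assume xy: "x \<in> N" "y \<in> N"
  note c = N_closed[OF xy(1)] N_closed[OF xy(2)] N_closed[OF D_closed[OF xy(1)]] N_closed[OF D_closed[OF xy(2)]] a_closed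
  show ?thesis
  proof (rule D_eqI)
    have "a \<otimes> (x \<otimes> y) = (a \<otimes> x) \<otimes> y" using c by (simp add: m_assoc)
    also have "\<dots> = x \<otimes> D x \<otimes> (a \<otimes> y)" unfolding a_mult[OF xy(1)] using c by (simp add: m_assoc)
    also have "\<dots> = x \<otimes> (D x \<otimes> y) \<otimes> D y \<otimes> a" unfolding a_mult[OF xy(2)] using c by (simp add: m_assoc)
    also have "D x \<otimes> y = y \<otimes> D x" using xy D_closed comm by blast
    also have "x \<otimes> (y \<otimes> D x) \<otimes> D y \<otimes> a = x \<otimes> y \<otimes> (D x \<otimes> D y) \<otimes> a" using c by (simp add: m_assoc)
    finally show "a \<otimes> (x \<otimes> y) = x \<otimes> y \<otimes> (D x \<otimes> D y) \<otimes> a" .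
  qed (use xy N_mult D_closed in auto)
qed

lemma D_one: "D \<one> = \<one>"
  unfolding cmt_def using a_closed by simp

lemma D_int_pow: "x \<in> N \<Longrightarrow> D (x [^] (k::int)) = D x [^] k"
proof -
  assume x: "x \<in> N"
  let ?K = "G\<lparr>carrier := N\<rparr>"
  have K: "group ?K" using sub subgroup.subgroup_is_group is_group by blast
  interpret f: group_hom ?K G D
    using K N_closed D_closed D_mult by (simp add: group_hom_def group_hom_axioms_def is_group hom_def)
  have "D (x [^]\<^bsub>?K\<^esub> k) = D x [^] k" using f.hom_int_pow[of x k] x by simp
  then show ?thesis using int_pow_consistent[OF sub x] by simp
qed

lemma D_nat_pow: "x \<in> N \<Longrightarrow> D (x [^] (k::nat)) = D x [^] k"
  using D_int_pow[of x "int k"] by (simp add: int_pow_int)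

lemma pow_mult_N: "x \<in> N \<Longrightarrow> y \<in> N \<Longrightarrow> (x \<otimes> y) [^] (k::int) = x [^] k \<otimes> y [^] k"
  using int_pow_mult_distrib comm N_closed by blast

lemma D_one_commutes: "x \<in> N \<Longrightarrow> D x = \<one> \<longleftrightarrow> a \<otimes> x = x \<otimes> a"
proof -
  assume x: "x \<in> N"
  note c = N_closed[OF x] a_closed
  show ?thesis
  proof
    assume "D x = \<one>"
    then show "a \<otimes> x = x \<otimes> a" using a_mult[OF x] c by simp
  next
    assume "a \<otimes> x = x \<otimes> a"
    then show "D x = \<one>" using D_eqI[OF x N_one] c by simp
  qed
qed

lemma D_one_central:
  assumes "x \<in> N" "D x = \<one>" "g \<in> carrier G"
  shows "g \<otimes> x = x \<otimes> g"
proof -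
  obtain y k where g: "y \<in> N" "g = y \<otimes> a [^] (k::nat)" using decomp[OF assms(3)] by blast
  have "a [^] k \<otimes> x = x \<otimes> a [^] k"
    using group_commutes_pow[of a x k] assms D_one_commutes a_closed N_closed by blast
  then show ?thesis
    unfolding g(2) using commute_mult[of y "a [^] k" x] g(1) assms(1) comm N_closed a_closed by blast
qed

text \<open>Otherwise \<open>a\<close> would be a product of powers of \<open>a\<^sup>k\<close> and \<open>a\<^sup>p\<close>, by Bezout.\<close>

lemma a_pow_in_N: "a [^] (k::nat) \<in> N \<longleftrightarrow> p dvd k"
proof
  assume "p dvd k"
  then obtain q where "k = p * q" by blast
  then have "a [^] k = (a [^] p) [^] q" using a_closed by (simp add: nat_pow_pow)
  then show "a [^] k \<in> N" using pow_mem N_nat_pow by simp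
next
  assume k: "a [^] k \<in> N"
  show "p dvd k"
  proof (rule ccontr)
    assume "\<not> p dvd k"
    then have "coprime p k" using prime_p prime_imp_coprime by blast
    then show False using pow_coprime_mem[OF sub a_closed pow_mem k] a_notin by blast
  qed
qed

text \<open>An element outside \<open>N\<close> generates the quotient, so it moves whatever \<open>a\<close> moves.\<close>

lemma commutes_outside:
  assumes "x \<in> N" "g \<in> carrier G" "g \<notin> N" "g \<otimes> x = x \<otimes> g"
  shows "D x = \<one>"
proof -
  obtain y k where g: "y \<in> N" "g = y \<otimes> a [^] (k::nat)" using decomp[OF assms(2)] by blast
  have k: "\<not> p dvd k" using g assms(3) a_pow_in_N N_mult by blast
  note c = a_closed N_closed[OF assms(1)] N_closed[OF g(1)]
  have "a [^] k = inv y \<otimes> g" using g c by (simp add: m_assoc[symmetric])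
  moreover have "inv y \<otimes> x = x \<otimes> inv y" using comm N_inv g(1) assms(1) by blast
  ultimately have kx: "a [^] k \<otimes> x = x \<otimes> a [^] k"
    using commute_mult[of "inv y" g x] assms c by simp
  have px: "a [^] p \<otimes> x = x \<otimes> a [^] p" using comm pow_mem assms(1) by blast
  have "a [^] p \<in> centralizer x" "a [^] k \<in> centralizer x" using px kx c by (auto simp: centralizer_def)
  moreover have "coprime p k" using k prime_p prime_imp_coprime by blast
  ultimately have "a \<in> centralizer x"
    using pow_coprime_mem[OF subgroup_centralizer[OF c(2)] c(1)] by blast
  then have "a \<otimes> x = x \<otimes> a" by (simp add: centralizer_def)
  then show ?thesis using D_one_commutes assms(1) by blast
qed

lemma center_eq:
  assumes "x \<in> N" "D x \<noteq> \<one>"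
  shows "center = {z \<in> N. D z = \<one>}"
proof
  show "{z \<in> N. D z = \<one>} \<subseteq> center"
    using D_one_central N_closed by (auto simp: center_def)
  show "center \<subseteq> {z \<in> N. D z = \<one>}"
  proof
    fix z assume "z \<in> center"
    then have z: "z \<in> carrier G" "\<And>g. g \<in> carrier G \<Longrightarrow> g \<otimes> z = z \<otimes> g" by (auto simp: center_def)
    have "z \<in> N" using commutes_outside[OF assms(1) z(1)] z(2)[OF N_closed[OF assms(1)]] assms(2) by auto
    moreover have "a \<otimes> z = z \<otimes> a" using z(2) a_closed by blast
    ultimately show "z \<in> {z \<in> N. D z = \<one>}" using D_one_commutes by blast
  qed
qed

lemma image_subgroup: "subgroup (D ` N) G"
  by (rule card_image_kernel(2)[OF sub]) (auto simp: D_closed N_closed D_mult)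

lemma card_image_times_kernel: "card (D ` N) * card {x \<in> N. D x = \<one>} = card N"
  by (rule card_image_kernel(1)[OF sub]) (auto simp: D_closed N_closed D_mult)

lemma a_pow_mult: "x \<in> N \<Longrightarrow> \<exists>w\<in>D ` N. a [^] (k::nat) \<otimes> x = x \<otimes> w \<otimes> a [^] k"
proof (induction k arbitrary: x)
  case 0
  then show ?case
    using subgroup.one_closed[OF image_subgroup] N_closed by (intro bexI[of _ \<one>]) auto
next
  case (Suc k)
  obtain y where y: "y \<in> N" "a [^] k \<otimes> x = x \<otimes> D y \<otimes> a [^] k" using Suc by blast
  note c = N_closed[OF Suc.prems] N_closed[OF y(1)] N_closed[OF D_closed[OF y(1)]] a_closed
  have xy: "x \<otimes> D y \<in> N" using Suc.prems y D_closed N_mult by blast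
  have s: "a [^] Suc k = a \<otimes> a [^] k" using a_closed by (rule nat_pow_Suc2)
  have "a [^] Suc k \<otimes> x = a \<otimes> (a [^] k \<otimes> x)" unfolding s using c by (simp add: m_assoc)
  also have "\<dots> = (a \<otimes> (x \<otimes> D y)) \<otimes> a [^] k" unfolding y(2) using c by (simp add: m_assoc)
  also have "\<dots> = x \<otimes> (D y \<otimes> D (x \<otimes> D y)) \<otimes> a [^] Suc k"
    unfolding a_mult[OF xy] s using c N_closed[OF D_closed[OF xy]] by (simp add: m_assoc)
  also have "D y \<otimes> D (x \<otimes> D y) = D (y \<otimes> (x \<otimes> D y))" using D_mult[OF y(1) xy] by simp
  finally show ?case using N_mult[OF y(1) xy] by blast
qed

text \<open>Moving a power of \<open>a\<close> past an element of \<open>N\<close> costs a factor from the image of \<open>D\<close>; apply this to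
  both products \<open>g h\<close> and \<open>h g\<close>.\<close>

lemma commutator_in_image:
  assumes "g \<in> carrier G" "h \<in> carrier G"
  shows "cmt g h \<in> D ` N"
proof -
  obtain x k where g: "x \<in> N" "g = x \<otimes> a [^] (k::nat)" using decomp[OF assms(1)] by blast
  obtain y l where h: "y \<in> N" "h = y \<otimes> a [^] (l::nat)" using decomp[OF assms(2)] by blast
  obtain u where u: "u \<in> D ` N" "a [^] k \<otimes> y = y \<otimes> u \<otimes> a [^] k" using a_pow_mult[OF h(1)] by blast
  obtain w where w: "w \<in> D ` N" "a [^] l \<otimes> x = x \<otimes> w \<otimes> a [^] l" using a_pow_mult[OF g(1)] by blast
  have uw: "u \<in> N" "w \<in> N" using u w D_closed by auto
  note c = N_closed[OF g(1)] N_closed[OF h(1)] N_closed[OF uw(1)] N_closed[OF uw(2)] a_closed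
  have "g \<otimes> h = x \<otimes> (a [^] k \<otimes> y) \<otimes> a [^] l" unfolding g(2) h(2) using c by (simp add: m_assoc)
  also have "\<dots> = (x \<otimes> y) \<otimes> u \<otimes> a [^] (k + l)" unfolding u(2) using c by (simp add: m_assoc nat_pow_mult[symmetric])
  also have "(x \<otimes> y) \<otimes> u = u \<otimes> (x \<otimes> y)" using comm g h uw N_mult by blast
  finally have 1: "g \<otimes> h = u \<otimes> (x \<otimes> y \<otimes> a [^] (k + l))" using c by (simp add: m_assoc)
  have "h \<otimes> g = y \<otimes> (a [^] l \<otimes> x) \<otimes> a [^] k" unfolding g(2) h(2) using c by (simp add: m_assoc)
  also have "\<dots> = (y \<otimes> x) \<otimes> w \<otimes> a [^] (l + k)" unfolding w(2) using c by (simp add: m_assoc nat_pow_mult[symmetric])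
  also have "(y \<otimes> x) \<otimes> w = w \<otimes> (x \<otimes> y)" using comm g h uw N_mult by metis
  finally have 2: "h \<otimes> g = w \<otimes> (x \<otimes> y \<otimes> a [^] (k + l))" using c by (simp add: m_assoc add.commute)
  define e where "e = x \<otimes> y \<otimes> a [^] (k + l)"
  have ec: "e \<in> carrier G" using c by (simp add: e_def)
  have "cmt g h = (g \<otimes> h) \<otimes> inv (h \<otimes> g)"
    using assms by (simp add: cmt_def inv_mult_group m_assoc)
  also have "\<dots> = u \<otimes> e \<otimes> (inv e \<otimes> inv w)"
    unfolding 1 2 e_def[symmetric] using c ec by (simp add: inv_mult_group)
  also have "\<dots> = u \<otimes> (e \<otimes> inv e) \<otimes> inv w" using c ec by (simp only: m_assoc inv_closed m_closed)
  also have "\<dots> = u \<otimes> inv w" using c ec by simp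
  also have "\<dots> \<in> D ` N"
    using u w image_subgroup by (intro subgroup.m_closed subgroup.m_inv_closed) auto
  finally show ?thesis .
qed

text \<open>From here on \<open>D\<^sup>3\<close> vanishes on the elements considered, so that conjugation by \<open>a\<close> is
  unipotent and the binomial formulas apply.\<close>

lemma unipotent_D:
  assumes "x \<in> N" "D (D (D x)) = \<one>"
  shows "unipotent x (D x) (D (D x)) a"
  unfolding unipotent_def
  using assms D_closed N_closed a_closed comm a_mult[OF assms(1)] a_mult[OF D_closed[OF assms(1)]]
    D_one_commutes[of "D (D x)"] by auto

text \<open>As \<open>a\<^sup>p\<close> lies in the abelian group \<open>N\<close>, conjugation by it is trivial; compare this with the
  binomial formula for \<open>a\<^sup>p\<close>, first at \<open>D x\<close> and then at \<open>x\<close>.\<close>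

lemma D_pow_p:
  assumes "x \<in> N" "D (D (D x)) = \<one>"
  shows "D x [^] p = \<one>" and "D (D x) [^] p = \<one>"
proof -
  have key: "D y [^] p \<otimes> D (D y) [^] (p choose 2) = \<one>" if y: "y \<in> N" "D (D (D y)) = \<one>" for y
  proof -
    note c = N_closed[OF y(1)] N_closed[OF D_closed[OF y(1)]] N_closed[OF D_closed[OF D_closed[OF y(1)]]] a_closed
    have "a [^] p \<otimes> y = y \<otimes> (D y [^] p \<otimes> D (D y) [^] (p choose 2)) \<otimes> a [^] p"
      using unipotent_shift[OF unipotent_D[OF y], of p 1 0 0] c by (simp add: m_assoc int_pow_int)
    moreover have "a [^] p \<otimes> y = y \<otimes> a [^] p" using comm pow_mem y by blast
    ultimately show ?thesis using c by simp
  qed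
  have z: "D (D (D (D x))) = \<one>" using assms D_one by simp
  note c = N_closed[OF D_closed[OF assms(1)]] N_closed[OF D_closed[OF D_closed[OF assms(1)]]]
  show 2: "D (D x) [^] p = \<one>"
    using key[OF D_closed[OF assms(1)] z] assms(2) c by simp
  obtain q where "p choose 2 = p * q" using prime_dvd_choose_2[OF prime_p odd_p] by auto
  then have "D (D x) [^] (p choose 2) = \<one>" using 2 c by (simp add: nat_pow_pow[symmetric])
  then show "D x [^] p = \<one>" using key[OF assms] c by simp
qed

text \<open>The factor with exponent \<open>p choose 2\<close> is trivial because \<open>D x\<close> and \<open>D (D x)\<close> have exponent \<open>p\<close>.\<close>

lemma pow_p_formula:
  assumes "x \<in> N" "D (D (D x)) = \<one>"
  shows "(x \<otimes> a [^] k) [^] p = x [^] p \<otimes> D (D x) [^] (int k ^ 2 * int (p choose 3)) \<otimes> (a [^] p) [^] k"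
proof -
  note c = N_closed[OF assms(1)] N_closed[OF D_closed[OF assms(1)]] N_closed[OF D_closed[OF D_closed[OF assms(1)]]] a_closed
  define y z where "y = D x [^] int k \<otimes> D (D x) [^] int (k choose 2)" and "z = D (D x) [^] (int k ^ 2)"
  have yN: "y \<in> N" unfolding y_def using assms D_closed N_int_pow N_mult by simp
  have "y [^] int p = (D x [^] int k) [^] int p \<otimes> (D (D x) [^] int (k choose 2)) [^] int p"
    unfolding y_def using assms D_closed N_int_pow by (intro pow_mult_N) auto
  also have "\<dots> = (D x [^] int p) [^] int k \<otimes> (D (D x) [^] int p) [^] int (k choose 2)"
    using c by (simp add: int_pow_pow mult.commute)
  also have "\<dots> = \<one>" using D_pow_p[OF assms] c by (simp add: int_pow_int)
  finally have yp: "y [^] int p = \<one>" .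
  obtain q where q: "p choose 2 = p * q" using prime_dvd_choose_2[OF prime_p odd_p] by auto
  have "y [^] int (p choose 2) = (y [^] int p) [^] int q"
    using yN N_closed by (simp add: int_pow_pow q)
  then have y2: "y [^] int (p choose 2) = \<one>" using yp by simp
  have "(x \<otimes> a [^] k) [^] p = x [^] int p \<otimes> y [^] int (p choose 2) \<otimes> z [^] int (p choose 3) \<otimes> (a [^] k) [^] p"
    unfolding y_def z_def by (rule unipotent_mult_pow[OF unipotent_pow[OF unipotent_D[OF assms]]])
  moreover have "z [^] int (p choose 3) = D (D x) [^] (int k ^ 2 * int (p choose 3))"
    unfolding z_def using c by (simp only: int_pow_pow)
  ultimately show ?thesis
    unfolding y2 using c by (simp add: int_pow_int nat_pow_pow mult.commute)
qed

lemma commutator_pow: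
  assumes "x \<in> N" "y \<in> N" "D (D (D x)) = \<one>" "g = y \<otimes> a [^] (k::nat)"
  shows "cmt g x = D x [^] int k \<otimes> D (D x) [^] int (k choose 2)"
proof -
  note c = N_closed[OF assms(1)] N_closed[OF assms(2)] N_closed[OF D_closed[OF assms(1)]]
    N_closed[OF D_closed[OF D_closed[OF assms(1)]]] a_closed
  define w where "w = D x [^] int k \<otimes> D (D x) [^] int (k choose 2)"
  have w: "w \<in> N" unfolding w_def using assms D_closed N_int_pow N_mult by simp
  have gc: "g \<in> carrier G" using c assms(4) by simp
  have "a [^] k \<otimes> x = x \<otimes> w \<otimes> a [^] k"
    using unipotent_shift[OF unipotent_D[OF assms(1,3)], of k 1 0 0] c by (simp add: w_def m_assoc)
  then have "g \<otimes> x = (y \<otimes> (x \<otimes> w)) \<otimes> a [^] k" unfolding assms(4) using c N_closed[OF w] by (simp add: m_assoc)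
  also have "y \<otimes> (x \<otimes> w) = (w \<otimes> x) \<otimes> y" using comm N_mult w assms by metis
  finally have "g \<otimes> x = w \<otimes> (x \<otimes> g)" unfolding assms(4) using c N_closed[OF w] by (simp add: m_assoc)
  then show ?thesis
    unfolding w_def[symmetric] using c gc N_closed[OF w] by (intro cmt_eqI) (simp_all add: m_assoc)
qed

lemma double_commutator_pow:
  assumes "x \<in> N" "y \<in> N" "D (D (D x)) = \<one>" "g = y \<otimes> a [^] (k::nat)"
  shows "cmt g (cmt g x) = D (D x) [^] (int k ^ 2)"
proof -
  note c = N_closed[OF assms(1)] N_closed[OF assms(2)] N_closed[OF D_closed[OF assms(1)]]
    N_closed[OF D_closed[OF D_closed[OF assms(1)]]] a_closed
  note d = D_closed[OF assms(1)] D_closed[OF D_closed[OF assms(1)]]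
  define w where "w = cmt g x"
  have w: "w = D x [^] int k \<otimes> D (D x) [^] int (k choose 2)"
    unfolding w_def by (rule commutator_pow[OF assms(1-4)])
  have wN: "w \<in> N" unfolding w using d N_int_pow N_mult by simp
  have Dw: "D w = D (D x) [^] int k"
    unfolding w using d N_int_pow assms(3) c by (simp add: D_mult D_int_pow)
  have DDw: "D (D w) = \<one>"
    unfolding Dw using d assms(3) by (simp add: D_int_pow)
  have "cmt g w = D w [^] int k \<otimes> D (D w) [^] int (k choose 2)"
    by (rule commutator_pow[OF wN assms(2) _ assms(4)]) (simp add: DDw D_one)
  also have "\<dots> = D (D x) [^] (int k ^ 2)"
    unfolding DDw unfolding Dw using c by (simp add: int_pow_pow power2_eq_square)
  finally show ?thesis unfolding w_def .
qed

end

section \<open>Elements of prime power order\<close>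

lemma prime_inverse_mod:
  assumes "prime p" "\<not> int p dvd k"
  obtains m :: nat where "int p dvd k * int m - 1"
proof -
  have "coprime k (int p)"
    using assms prime_imp_coprime[of "int p" k] by (simp add: coprime_commute)
  then obtain r where r: "[k * r = 1] (mod int p)" using cong_solve_coprime_int by blast
  define m where "m = nat (r mod int p)"
  have "int m = r mod int p" using assms prime_gt_0_nat by (simp add: m_def)
  then have "[k * int m = 1] (mod int p)" using r by (metis cong_mod_right cong_refl cong_scalar_left cong_sym cong_trans)
  then show thesis using that by (simp add: cong_iff_dvd_diff)
qed

context group
begin

lemma int_pow_prime_eq_one:
  assumes "x \<in> carrier G" "prime p" "x [^] p = \<one>" "x \<noteq> \<one>"
  shows "x [^] (i::int) = \<one> \<longleftrightarrow> int p dvd i"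
proof -
  have "ord x dvd p" using assms pow_eq_id by blast
  moreover have "ord x \<noteq> 1" using assms ord_eq_1 by blast
  ultimately have "ord x = p" using assms(2) prime_nat_iff by blast
  then show ?thesis using int_pow_eq_id[OF assms(1)] by simp
qed

lemma int_pow_prime_sq_eq_one:
  assumes "x \<in> carrier G" "prime p" "(x [^] p) [^] p = \<one>" "x [^] p \<noteq> \<one>"
  shows "x [^] (i::int) = \<one> \<longleftrightarrow> int p ^ 2 dvd i"
proof -
  have xp: "(x [^] p) [^] j = x [^] (int p * j)" for j :: int
    using int_pow_pow[OF assms(1), of "int p" j] by (simp add: int_pow_int)
  note pr = int_pow_prime_eq_one[OF _ assms(2,3,4)]
  show ?thesis
  proof
    assume i: "x [^] i = \<one>"
    have "(x [^] p) [^] i = (x [^] i) [^] int p" using assms(1) by (simp add: xp int_pow_pow mult.commute)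
    then have "int p dvd i" using pr assms(1) i by simp
    then obtain j where j: "i = int p * j" by blast
    then have "int p dvd j" using i pr assms(1) xp by simp
    then show "int p ^ 2 dvd i" using j by (simp add: power2_eq_square)
  next
    assume "int p ^ 2 dvd i"
    then obtain j where "i = int p ^ 2 * j" by blast
    then have "i = int p * (int p * j)" by (simp add: power2_eq_square)
    then show "x [^] i = \<one>" using xp[of "int p * j"] pr[of "int p * j"] assms(1) by simp
  qed
qed

lemma subgroup_pow_card:
  assumes "subgroup M G" "w \<in> M" shows "w [^] card M = \<one>"
proof -
  have "w [^]\<^bsub>G\<lparr>carrier := M\<rparr>\<^esub> card M = \<one>"
    using group.pow_order_eq_1[OF subgroup.subgroup_is_group[OF assms(1) is_group], of w] assms(2)
    by (simp add: order_def)
  then show ?thesis by (simp add: nat_pow_consistent[symmetric])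
qed

lemma subgroup_eq_powers:
  assumes "subgroup M G" "finite M" "w \<in> M" "\<And>i::int. w [^] i = \<one> \<longleftrightarrow> int (card M) dvd i"
    and "u \<in> M"
  obtains k :: int where "u = w [^] k"
proof -
  have wc: "w \<in> carrier G" using assms(1,3) subgroup.subset by blast
  have "w [^] (i::nat) = \<one> \<longleftrightarrow> card M dvd i" for i
    using assms(4)[of "int i"] by (simp add: int_pow_int)
  then have "ord w = card M" using ord_unique[OF wc] by blast
  then have "card (generate G {w}) = card M" using generate_pow_card[OF wc] by simp
  moreover have "generate G {w} \<subseteq> M" using assms by (intro generate_subgroup_incl) auto
  ultimately have "generate G {w} = M" using assms(2) card_subset_eq by blast
  then show thesis using that assms(5) generate_pow[OF wc] by auto
qed

end

section \<open>Nonabelian groups of order \<open>p\<^sup>4\<close>\<close>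

locale nonabelian_p4 = group G for G (structure) +
  fixes N :: "'a set" and p :: nat
  assumes prime_p: "prime p" and odd_p: "odd p" and ord: "order G = p ^ 4"
    and nonab: "\<not> comm_group G"
    and sub: "subgroup N G" and cardN: "card N = p ^ 3"
    and comm: "x \<in> N \<Longrightarrow> y \<in> N \<Longrightarrow> x \<otimes> y = y \<otimes> x"
begin

lemma fin: "finite (carrier G)" by (rule finite_order_pow[OF prime_p ord])

lemma fin_sub: "subgroup M G \<Longrightarrow> finite M"
  using fin finite_subset subgroup.subset by blast

lemma p_gt: "1 < p" using prime_p prime_gt_1_nat by blast

lemma pow_in_N:
  assumes "g \<in> carrier G" "g [^] (k::nat) \<in> N" "\<not> p dvd k" shows "g \<in> N"
proof -
  have "coprime p k" using assms(3) prime_p prime_imp_coprime by blast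
  then have "coprime k (p ^ 4)" by (simp add: coprime_commute)
  moreover have "g [^] (p ^ 4) \<in> N"
    using pow_order_eq_1[OF assms(1)] ord subgroup.one_closed[OF sub] by simp
  ultimately show ?thesis using pow_coprime_mem[OF sub assms(1,2)] by blast
qed

lemma cover:
  assumes "g \<in> carrier G" "g \<notin> N" "h \<in> carrier G"
  shows "\<exists>x\<in>N. \<exists>k<p. h = x \<otimes> g [^] k"
proof (rule coset_powers_cover[OF sub fin _ assms(1) _ assms(3)])
  show "order G = p * card N" by (simp add: ord cardN power_eq_if)
  show "g [^] k \<notin> N" if "0 < k" "k < p" for k
    using pow_in_N[OF assms(1), of k] assms(2) that by (meson nat_dvd_not_less)
qed

text \<open>If a conjugate of \<open>n \<in> N\<close> by \<open>a\<close> were outside \<open>N\<close>, its powers would represent all cosets,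
  so the inverse of \<open>a\<close> would be \<open>x (a n\<^sup>k a\<^sup>-\<^sup>1)\<close> for some \<open>x \<in> N\<close>, which puts \<open>a\<close> into \<open>N\<close>.\<close>

lemma abelian_prime_index_outside:
  assumes a: "a \<in> carrier G" "a \<notin> N" shows "abelian_prime_index G N a p"
proof (intro abelian_prime_index.intro abelian_prime_index_axioms.intro)
  note subD = subgroup.mem_carrier[OF sub]
  show "a \<otimes> n \<otimes> inv a \<in> N" if n: "n \<in> N" for n
  proof (rule ccontr)
    define c where "c = a \<otimes> n \<otimes> inv a"
    assume "a \<otimes> n \<otimes> inv a \<notin> N"
    then have c: "c \<in> carrier G" "c \<notin> N" using a subD[OF n] by (auto simp: c_def)
    then obtain x k where x: "x \<in> N" "inv a = x \<otimes> c [^] (k::nat)" using cover[of c "inv a"] a by blast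
    have "a \<otimes> n = c \<otimes> a" using a subD[OF n] by (simp add: c_def m_assoc)
    then have "a \<otimes> n [^] k = c [^] k \<otimes> a"
      using conj_int_pow[OF a(1) subD[OF n] c(1), of "int k"] by (simp add: int_pow_int)
    then have ck: "c [^] k = a \<otimes> n [^] k \<otimes> inv a"
      using inv_solve_right[of "c [^] k" "a \<otimes> n [^] k" a] a subD[OF n] c by simp
    have "inv a = x \<otimes> (a \<otimes> n [^] k \<otimes> inv a)" by (subst ck[symmetric]) (rule x(2))
    also have "\<dots> = (x \<otimes> a \<otimes> n [^] k) \<otimes> inv a"
      using a subD[OF n] subD[OF x(1)] by (simp add: m_assoc)
    finally have "x \<otimes> a \<otimes> n [^] k = \<one>" using a subD[OF n] subD[OF x(1)] by simp
    moreover have "a = inv x \<otimes> (x \<otimes> a \<otimes> n [^] k) \<otimes> inv (n [^] k)"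
      using a subD[OF n] subD[OF x(1)] by (simp add: m_assoc) (simp add: m_assoc[symmetric])
    ultimately have "a = inv x \<otimes> inv (n [^] k)" using subD[OF n] subD[OF x(1)] by simp
    moreover have "n [^] k \<in> N" using subgroup_int_pow[OF sub n, of "int k"] by (simp add: int_pow_int)
    ultimately show False using a(2) subgroup.m_closed[OF sub subgroup.m_inv_closed[OF sub x(1)] subgroup.m_inv_closed[OF sub]] by simp
  qed
  show "\<exists>x\<in>N. \<exists>k::nat. g = x \<otimes> a [^] k" if "g \<in> carrier G" for g
    using cover[OF a that] by blast
  show "a [^] p \<in> N"
  proof -
    obtain x k where x: "x \<in> N" "k < p" "a [^] p = x \<otimes> a [^] k" using cover[OF a, of "a [^] p"] a by blast
    have "a [^] p = a [^] (p - k) \<otimes> a [^] k" using x a by (simp add: nat_pow_mult)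
    then have "a [^] (p - k) \<in> N" using x a subD[OF x(1)] by simp
    then have "p dvd p - k" using pow_in_N[OF a(1)] a(2) by blast
    then have "p \<le> p - k" using x by (intro dvd_imp_le) auto
    then have "k = 0" using x by simp
    then show ?thesis using x subD[OF x(1)] by simp
  qed
qed (fact is_group sub comm prime_p odd_p a)+

lemma exists_outside: "\<exists>a\<in>carrier G. a \<notin> N"
proof -
  have "card N < card (carrier G)" using cardN ord p_gt by (simp add: order_def)
  then show ?thesis using subgroup.subset[OF sub] by (metis less_irrefl subset_antisym subsetI)
qed

lemma exists_moved:
  assumes a: "a \<in> carrier G" "a \<notin> N" shows "\<exists>x\<in>N. cmt a x \<noteq> \<one>"
proof (rule ccontr)
  assume no: "\<not> ?thesis"
  interpret abelian_prime_index G N a p by (rule abelian_prime_index_outside[OF a])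
  have NZ: "g \<otimes> x = x \<otimes> g" if "x \<in> N" "g \<in> carrier G" for x g
    using D_one_central that no by blast
  have "g \<otimes> h = h \<otimes> g" if gh: "g \<in> carrier G" "h \<in> carrier G" for g h
  proof -
    obtain x k where h: "x \<in> N" "h = x \<otimes> a [^] (k::nat)" using decomp[OF gh(2)] by blast
    obtain y l where g: "y \<in> N" "g = y \<otimes> a [^] (l::nat)" using decomp[OF gh(1)] by blast
    have "a [^] l \<otimes> a [^] k = a [^] k \<otimes> a [^] l" using a by (simp add: nat_pow_mult add.commute)
    moreover have "y \<otimes> a [^] k = a [^] k \<otimes> y" using NZ[OF g(1)] a by simp
    ultimately have "g \<otimes> a [^] k = a [^] k \<otimes> g"
      unfolding g(2) using a N_closed[OF g(1)] by (intro commute_mult) auto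
    then show ?thesis unfolding h(2)
      using commute_mult[of x "a [^] k" g] NZ[OF h(1) gh(1)] N_closed[OF h(1)] gh a by simp
  qed
  then show False using nonab group_comm_groupI by blast
qed

lemma p_dvd_center: "p dvd card center"
proof -
  have "carrier G \<noteq> {\<one>}"
    using ord one_less_power[OF p_gt, of 4] by (auto simp: order_def)
  then have "p dvd card (carrier G \<inter> center)"
    using normal_meets_center[OF prime_p ord subgroup_self] by auto
  moreover have "carrier G \<inter> center = center" using subgroup.subset[OF subgroup_center] by blast
  ultimately show ?thesis by simp
qed

lemma invariant_subgroup:
  assumes a: "a \<in> carrier G" "a \<notin> N" and M: "subgroup M G" "M \<subseteq> N" "\<And>x. x \<in> M \<Longrightarrow> cmt a x \<in> M"
    and g: "g \<in> carrier G" and x: "x \<in> M"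
  shows "g \<otimes> x \<otimes> inv g \<in> M"
proof -
  interpret abelian_prime_index G N a p by (rule abelian_prime_index_outside[OF a])
  note Mc = subgroup.mem_carrier[OF M(1)]
  have step: "\<exists>w\<in>M. a [^] k \<otimes> x = w \<otimes> a [^] k" for k :: nat
  proof (induction k)
    case 0 then show ?case using x Mc by auto
  next
    case (Suc k)
    then obtain w where w: "w \<in> M" "a [^] k \<otimes> x = w \<otimes> a [^] k" by blast
    have s: "a [^] Suc k = a \<otimes> a [^] k" using a(1) by (rule nat_pow_Suc2)
    have wN: "w \<in> N" using w M by blast
    have wD: "w \<otimes> cmt a w \<in> M" using w M subgroup.m_closed by metis
    have "a [^] Suc k \<otimes> x = a \<otimes> (a [^] k \<otimes> x)" unfolding s using a Mc[OF x] by (simp add: m_assoc)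
    also have "\<dots> = (a \<otimes> w) \<otimes> a [^] k" unfolding w(2) using a Mc[OF w(1)] by (simp add: m_assoc)
    also have "\<dots> = (w \<otimes> cmt a w) \<otimes> a [^] Suc k"
      unfolding a_mult[OF wN] s using a Mc[OF w(1)] Mc[OF M(3)[OF w(1)]] by (simp add: m_assoc)
    finally show ?case using wD by blast
  qed
  obtain y k where gy: "y \<in> N" "g = y \<otimes> a [^] (k::nat)" using decomp[OF g] by blast
  obtain w where w: "w \<in> M" "a [^] k \<otimes> x = w \<otimes> a [^] k" using step by blast
  have yw: "y \<otimes> w = w \<otimes> y" using comm gy w M by blast
  have "g \<otimes> x = y \<otimes> w \<otimes> a [^] k"
    unfolding gy(2) using w(2) a Mc[OF x] Mc[OF w(1)] N_closed[OF gy(1)] by (simp add: m_assoc)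
  also have "\<dots> = w \<otimes> g" unfolding yw gy(2) using a Mc[OF w(1)] N_closed[OF gy(1)] by (simp add: m_assoc)
  finally have "g \<otimes> x \<otimes> inv g = w" using g Mc[OF w(1)] by (simp add: m_assoc)
  then show ?thesis using w by simp
qed

text \<open>Commutation with \<open>a\<close> is nilpotent on \<open>N\<close>, because nontrivial normal subgroups meet the
  center. Its kernel is the center, so orders of image and kernel leave only two shapes.\<close>

lemma class_cases:
  assumes a: "a \<in> carrier G" "a \<notin> N"
  obtains (two) "card center = p ^ 2" "card (cmt a ` N) = p" "\<And>x. x \<in> N \<Longrightarrow> cmt a (cmt a x) = \<one>"
  | (three) "card center = p" "\<And>x. x \<in> N \<Longrightarrow> cmt a (cmt a (cmt a x)) = \<one>"
      "\<exists>x\<in>N. cmt a (cmt a x) \<noteq> \<one>"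
proof -
  interpret abelian_prime_index G N a p by (rule abelian_prime_index_outside[OF a])
  obtain x0 where x0: "x0 \<in> N" "cmt a x0 \<noteq> \<one>" using exists_moved[OF a] by blast
  have Z: "center = {z \<in> N. cmt a z = \<one>}" by (rule center_eq[OF x0])
  define I where "I = cmt a ` N"
  have I: "subgroup I G" "I \<subseteq> N" using image_subgroup D_closed by (auto simp: I_def)
  have Iinv: "cmt a x \<in> I" if "x \<in> I" for x using that I by (auto simp: I_def)
  have meets: "p dvd card (M \<inter> center)" if "subgroup M G" "M \<subseteq> N" "\<And>x. x \<in> M \<Longrightarrow> cmt a x \<in> M" "M \<noteq> {\<one>}" for M
    using normal_meets_center[OF prime_p ord that(1,4)] invariant_subgroup[OF a that(1-3)] by blast
  have prod: "card I * card center = p ^ 3"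
    using card_image_times_kernel cardN Z by (simp add: I_def)
  have I1: "I \<noteq> {\<one>}" using x0 by (auto simp: I_def)
  have Imeet: "p dvd card (I \<inter> center)" by (rule meets[OF I Iinv I1])
  have cdvd: "card center dvd p ^ 3" using prod by (metis dvd_triv_right)
  then obtain i where i: "i \<le> 3" "card center = p ^ i" using divides_primepow_nat[OF prime_p] by blast
  have "i \<noteq> 0" using p_dvd_center i p_gt by (cases "i = 0") auto
  have Ipow: "card I = p ^ (3 - i)"
  proof -
    have "card I * p ^ i = p ^ (3 - i) * p ^ i" using prod i by (simp add: power_add[symmetric])
    then show ?thesis using p_gt by simp
  qed
  have finI: "finite I" by (rule fin_sub[OF I(1)])
  have "i \<noteq> 3"
  proof
    assume "i = 3"
    then have "card I = 1" using Ipow by simp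
    then have "I = {\<one>}" using subgroup.one_closed[OF I(1)] by (metis card_1_singletonE singletonD)
    then show False using I1 by simp
  qed
  then consider "i = 1" | "i = 2" using i \<open>i \<noteq> 0\<close> by linarith
  then show thesis
  proof cases
    case 2
    then have cI: "card I = p" using Ipow by simp
    have "p \<le> card (I \<inter> center)"
      using Imeet finI \<open>I \<noteq> {\<one>}\<close> subgroup.one_closed[OF I(1)] subgroup.one_closed[OF subgroup_center]
      by (intro dvd_imp_le) (auto simp: card_gt_0_iff)
    then have "I \<inter> center = I" using cI finI by (intro card_seteq) auto
    then have "cmt a (cmt a x) = \<one>" if "x \<in> N" for x using that Z by (auto simp: I_def)
    then show thesis using two i 2 cI by (simp add: I_def)
  next
    case 1
    then have cI: "card I = p ^ 2" and cZ: "card center = p" using Ipow i by (simp_all add: numeral_eq_Suc)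
    have finZ: "finite center" by (rule fin_sub[OF subgroup_center])
    have "p \<le> card (I \<inter> center)"
      using Imeet finI subgroup.one_closed[OF I(1)] subgroup.one_closed[OF subgroup_center]
      by (intro dvd_imp_le) (auto simp: card_gt_0_iff)
    then have IZ: "I \<inter> center = center" using cZ finZ by (intro card_seteq) auto
    define J where "J = cmt a ` I"
    have J: "subgroup J G" "card J * card {x \<in> I. cmt a x = \<one>} = card I"
      using card_image_kernel[OF I(1), of "cmt a"] I D_closed D_mult N_closed by (auto simp: J_def subset_iff)
    have "{x \<in> I. cmt a x = \<one>} = I \<inter> center" using I Z by auto
    then have cJ: "card J = p" using J(2) IZ cZ cI p_gt by (simp add: power2_eq_square)
    have JI: "J \<subseteq> I" using Iinv by (auto simp: J_def)
    have finJ: "finite J" by (rule fin_sub[OF J(1)])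
    have "J \<noteq> {\<one>}" using cJ p_gt by auto
    then have "p dvd card (J \<inter> center)" using meets[OF J(1)] JI I Iinv by (auto simp: J_def)
    then have "p \<le> card (J \<inter> center)"
      using finJ subgroup.one_closed[OF J(1)] subgroup.one_closed[OF subgroup_center]
      by (intro dvd_imp_le) (auto simp: card_gt_0_iff)
    then have "J \<inter> center = J" using cJ finJ by (intro card_seteq) auto
    then have "cmt a (cmt a (cmt a x)) = \<one>" if "x \<in> N" for x using that Z by (auto simp: I_def J_def)
    moreover have "\<exists>x\<in>N. cmt a (cmt a x) \<noteq> \<one>"
    proof (rule ccontr)
      assume "\<not> ?thesis"
      then have "J \<subseteq> {\<one>}" by (auto simp: I_def J_def)
      then show False using \<open>J \<noteq> {\<one>}\<close> subgroup.one_closed[OF J(1)] by blast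
    qed
    ultimately show thesis using three cZ by blast
  qed
qed

end

section \<open>Realizations by groups of maximal class\<close>

text \<open>The unit \<open>k\<close> is a residue, or \<open>k \<epsilon>\<close> is one by Euler's criterion, being a product of two
  nonresidues.\<close>

lemma square_class_scaling:
  assumes "prime p" "odd p" "\<not> QuadRes (int p) \<epsilon>" "\<not> int p dvd k"
  obtains m :: nat and e where "e = 1 \<or> e = \<epsilon>" "int p dvd k * int m ^ 2 - e"
proof -
  have p0: "0 < int p" using assms(1) prime_gt_0_nat by simp
  have red: "\<exists>m::nat. [int m = r] (mod int p)" for r
    using p0 by (intro exI[of _ "nat (r mod int p)"]) (simp add: cong_def)
  show thesis
  proof (cases "QuadRes (int p) k")
    case True
    then obtain s where s: "[s ^ 2 = k] (mod int p)" by (auto simp: QuadRes_def)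
    have "\<not> int p dvd s"
    proof
      assume "int p dvd s"
      then have "[s ^ 2 = 0] (mod int p)" by (simp add: cong_0_iff power2_eq_square)
      then show False using s assms(4) by (metis cong_0_iff cong_sym cong_trans)
    qed
    then obtain m where m: "int p dvd s * int m - 1" using prime_inverse_mod[OF assms(1)] by blast
    then have sm: "[s * int m = 1] (mod int p)" by (simp add: cong_iff_dvd_diff)
    have "[k * int m ^ 2 = s ^ 2 * int m ^ 2] (mod int p)" using s by (simp add: cong_mult cong_sym)
    also have "s ^ 2 * int m ^ 2 = (s * int m) ^ 2" by (simp add: power_mult_distrib)
    also have "[(s * int m) ^ 2 = 1 ^ 2] (mod int p)" using sm by (rule cong_pow)
    finally show thesis using that[of 1 m] by (simp add: cong_iff_dvd_diff)
  next
    case False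
    have p2: "2 < p" using prime_ge_2_nat[OF assms(1)] assms(2) by (cases "p = 2") auto
    have nz: "\<not> [\<epsilon> = 0] (mod int p)"
    proof
      assume "[\<epsilon> = 0] (mod int p)"
      then have "[0 ^ 2 = \<epsilon>] (mod int p)" by (simp add: cong_sym)
      then show False using assms(3) unfolding QuadRes_def by blast
    qed
    let ?h = "(p - 1) div 2"
    have "[k ^ ?h = - 1] (mod int p)" "[\<epsilon> ^ ?h = - 1] (mod int p)"
      using euler_criterion[OF assms(1) p2, of k] euler_criterion[OF assms(1) p2, of \<epsilon>] False assms(3,4) nz
      by (auto simp: Legendre_def cong_0_iff cong_sym)
    from cong_mult[OF this] have "[(k * \<epsilon>) ^ ?h = 1] (mod int p)" by (simp add: power_mult_distrib)
    then have L: "[Legendre (k * \<epsilon>) (int p) = 1] (mod int p)"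
      using euler_criterion[OF assms(1) p2, of "k * \<epsilon>"] by (meson cong_trans)
    have "QuadRes (int p) (k * \<epsilon>)"
    proof (rule ccontr)
      assume "\<not> ?thesis"
      then have "Legendre (k * \<epsilon>) (int p) = 0 \<or> Legendre (k * \<epsilon>) (int p) = - 1" by (simp add: Legendre_def)
      then have "int p dvd 1 \<or> int p dvd 2" using L by (auto simp: cong_iff_dvd_diff)
      then show False using p2 by (auto dest!: zdvd_imp_le)
    qed
    then obtain s where s: "[s ^ 2 = k * \<epsilon>] (mod int p)" by (auto simp: QuadRes_def)
    obtain r where r: "int p dvd k * int r - 1" using prime_inverse_mod[OF assms(1,4)] by blast
    then have kr: "[k * int r = 1] (mod int p)" by (simp add: cong_iff_dvd_diff)
    obtain m where m: "[int m = s * int r] (mod int p)" using red by blast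
    have "[k * int m ^ 2 = k * (s * int r) ^ 2] (mod int p)" using m by (intro cong_mult cong_pow) auto
    also have "k * (s * int r) ^ 2 = s ^ 2 * (k * int r ^ 2)" by (simp add: power_mult_distrib)
    also have "[s ^ 2 * (k * int r ^ 2) = (k * \<epsilon>) * (k * int r ^ 2)] (mod int p)" using s by (intro cong_mult) auto
    also have "(k * \<epsilon>) * (k * int r ^ 2) = \<epsilon> * (k * int r) ^ 2" by (simp add: power2_eq_square)
    also have "[\<epsilon> * (k * int r) ^ 2 = \<epsilon> * 1 ^ 2] (mod int p)" using kr by (intro cong_mult cong_pow) auto
    finally show thesis using that[of \<epsilon> m] by (simp add: cong_iff_dvd_diff)
  qed
qed

lemma (in group) pow_dvd_one:
  assumes "x \<in> carrier G" "x [^] (p::nat) = \<one>" "int p dvd i" shows "x [^] i = \<one>"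
proof -
  obtain j where "i = int p * j" using assms(3) by blast
  then have "x [^] i = (x [^] int p) [^] j" using assms(1) by (simp add: int_pow_pow)
  then show ?thesis using assms by (simp add: int_pow_int)
qed

lemma (in abelian_prime_index) cmt_shift:
  assumes "y \<in> N" "x \<in> N" shows "cmt (y \<otimes> a) x = D x"
proof (rule cmt_eqI)
  note c = N_closed[OF assms(1)] N_closed[OF assms(2)] N_closed[OF D_closed[OF assms(2)]] a_closed
  show "y \<otimes> a \<in> carrier G" "x \<in> carrier G" "D x \<in> carrier G" using c by auto
  have "y \<otimes> a \<otimes> x = y \<otimes> (x \<otimes> D x) \<otimes> a"
    using a_mult[OF assms(2)] c by (simp add: m_assoc)
  also have "y \<otimes> (x \<otimes> D x) = (D x \<otimes> x) \<otimes> y" using comm N_mult D_closed assms by metis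
  finally show "y \<otimes> a \<otimes> x = D x \<otimes> x \<otimes> (y \<otimes> a)" using c by (simp add: m_assoc)
qed

context nonabelian_p4
begin

text \<open>The elements \<open>D (D x)\<close>, \<open>D x\<close>, \<open>x\<close> are independent: applying \<open>D\<close> twice and then once to a
  relation isolates the exponents of \<open>x\<close> and of \<open>D x\<close>.\<close>

lemma realizes_fam3_max:
  fixes c :: int
  assumes a: "a \<in> carrier G" "a \<notin> N" and x: "x \<in> N" "cmt a (cmt a (cmt a x)) = \<one>"
    and z: "cmt a (cmt a x) \<noteq> \<one>" and xp: "x [^] p = \<one>" and ap: "a [^] p = cmt a (cmt a x) [^] c"
  shows "realizes G (fam3 p 1 c)"
proof -
  interpret abelian_prime_index G N a p by (rule abelian_prime_index_outside[OF a])
  define y z where "y = cmt a x" and "z = cmt a y"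
  have yz: "y \<in> N" "z \<in> N" "cmt a z = \<one>" "z \<noteq> \<one>" using D_closed x z by (auto simp: y_def z_def)
  have pp: "y [^] p = \<one>" "z [^] p = \<one>" using D_pow_p[OF x] by (simp_all add: y_def z_def)
  note c = N_closed[OF x(1)] N_closed[OF yz(1)] N_closed[OF yz(2)] a_closed
  note zo = int_pow_prime_eq_one[OF c(3) prime_p pp(2) yz(4)]
  show ?thesis
  proof (rule realizes_fam3I[OF is_group ord prime_p c(3,2,1,4)])
    show "z \<otimes> y = y \<otimes> z" "z \<otimes> x = x \<otimes> z" "y \<otimes> x = x \<otimes> y" using comm yz x by auto
    show "z [^] int p = \<one>" "y [^] int p = \<one>" "x [^] int p = \<one>" using pp xp by (simp_all add: int_pow_int)
    show "int p dvd i \<and> int p dvd j \<and> int p dvd k" if e: "z [^] i \<otimes> y [^] j \<otimes> x [^] k = \<one>" for i j k :: int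
    proof -
      have D1: "z [^] j \<otimes> y [^] k = \<one>"
      proof -
        have "D (z [^] i \<otimes> y [^] j \<otimes> x [^] k) = D z [^] i \<otimes> D y [^] j \<otimes> D x [^] k"
          using yz x by (simp add: D_mult D_int_pow N_int_pow N_mult)
        then show ?thesis using e D_one yz c by (simp add: y_def[symmetric] z_def[symmetric])
      qed
      have "D (z [^] j \<otimes> y [^] k) = D z [^] j \<otimes> D y [^] k"
        using yz by (simp add: D_mult D_int_pow N_int_pow)
      then have "z [^] k = \<one>" using D1 D_one yz c by (simp add: z_def[symmetric])
      then have k: "int p dvd k" using zo by simp
      then have "y [^] k = \<one>" "x [^] k = \<one>" using pow_dvd_one c pp xp by blast+
      then have "z [^] j = \<one>" using D1 c by simp
      then have j: "int p dvd j" using zo by simp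
      then have "y [^] j = \<one>" using pow_dvd_one c pp by blast
      then have "z [^] i = \<one>" using e \<open>x [^] k = \<one>\<close> c by simp
      then show ?thesis using zo k j by simp
    qed
    show "a \<otimes> z = z \<otimes> a" using D_one_commutes yz by blast
    have "a \<otimes> y = y \<otimes> z \<otimes> a" using a_mult[OF yz(1)] by (simp add: z_def)
    then show "a \<otimes> y = z \<otimes> y \<otimes> a" using comm[OF yz(1,2)] by simp
    have "a \<otimes> x = x \<otimes> y \<otimes> a" using a_mult[OF x(1)] by (simp add: y_def)
    then show "a \<otimes> x = y [^] (1::int) \<otimes> x \<otimes> a" using comm[OF x(1) yz(1)] c by simp
    show "a [^] p = z [^] c" using ap by (simp add: y_def z_def)
    show "a \<otimes> y \<noteq> y \<otimes> a" using D_one_commutes[OF yz(1)] yz(4) by (simp add: z_def)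
  qed
qed

text \<open>The element \<open>D (D x)\<close> is a nontrivial multiple of \<open>p x\<close>, so applying \<open>D\<close> to a relation between
  \<open>x\<close> and \<open>D x\<close> again isolates the exponents.\<close>

lemma realizes_fam2_max:
  fixes c k :: int
  assumes a: "a \<in> carrier G" "a \<notin> N" and x: "x \<in> N"
    and z: "cmt a (cmt a x) = (x [^] p) [^] k" "\<not> int p dvd k"
    and xp: "x [^] p \<noteq> \<one>" "(x [^] p) [^] p = \<one>" and xZ: "cmt a (x [^] p) = \<one>"
    and ap: "a [^] p = (x [^] p) [^] c"
  shows "realizes G (fam2 p 0 k 1 (int p * c) 0)"
proof -
  interpret abelian_prime_index G N a p by (rule abelian_prime_index_outside[OF a])
  define y z where "y = cmt a x" and "z = cmt a y"
  have xpN: "x [^] p \<in> N" using x by (rule N_nat_pow)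
  have x3: "cmt a (cmt a (cmt a x)) = \<one>" unfolding z(1) using xpN xZ by (simp add: D_int_pow)
  have zx: "z = (x [^] p) [^] k" using z(1) by (simp add: y_def z_def)
  have yz: "y \<in> N" "z \<in> N" "cmt a z = \<one>" using D_closed x x3 by (auto simp: y_def z_def)
  have pp: "y [^] p = \<one>" "z [^] p = \<one>" using D_pow_p[OF x x3] by (simp_all add: y_def z_def)
  have z1: "z \<noteq> \<one>" using int_pow_prime_eq_one[OF N_closed[OF xpN] prime_p xp(2,1)] z(2) zx by simp
  note c = N_closed[OF x] N_closed[OF yz(1)] N_closed[OF yz(2)] a_closed
  note zo = int_pow_prime_eq_one[OF c(3) prime_p pp(2) z1]
  note xo = int_pow_prime_sq_eq_one[OF c(1) prime_p xp(2,1)]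
  have px: "(x [^] p) [^] i = x [^] (int p * i)" for i :: int
    using int_pow_pow[OF c(1), of "int p" i] by (simp add: int_pow_int)
  show ?thesis
  proof (rule realizes_fam2I[OF is_group ord prime_p c(1,2,4)])
    show "x \<otimes> y = y \<otimes> x" using comm yz x by auto
    show "x [^] (int p ^ 2) = \<one>" using xo by simp
    show "y [^] int p = \<one>" using pp by (simp_all add: int_pow_int)
    show "int p ^ 2 dvd i \<and> int p dvd j" if e: "x [^] i \<otimes> y [^] j = \<one>" for i j :: int
    proof -
      have D1: "y [^] i \<otimes> z [^] j = \<one>"
      proof -
        have "D (x [^] i \<otimes> y [^] j) = D x [^] i \<otimes> D y [^] j"
          using yz x by (simp add: D_mult D_int_pow N_int_pow)
        then show ?thesis using e D_one by (simp add: y_def[symmetric] z_def[symmetric])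
      qed
      have "D (y [^] i \<otimes> z [^] j) = D y [^] i \<otimes> D z [^] j"
        using yz by (simp add: D_mult D_int_pow N_int_pow)
      then have "z [^] i = \<one>" using D1 D_one yz c by (simp add: z_def[symmetric])
      then have "y [^] i = \<one>" using zo pow_dvd_one c pp by blast
      then have "z [^] j = \<one>" using D1 c by simp
      then have j: "int p dvd j" using zo by simp
      then have "y [^] j = \<one>" using pow_dvd_one c pp by blast
      then have "x [^] i = \<one>" using e c by simp
      then show ?thesis using xo j by simp
    qed
    have "a \<otimes> x = x \<otimes> y \<otimes> a" using a_mult[OF x] by (simp add: y_def)
    then show "a \<otimes> x = x [^] (1 + 0 * int p) \<otimes> y [^] (1::int) \<otimes> a" using c by simp
    have "a \<otimes> y = y \<otimes> z \<otimes> a" using a_mult[OF yz(1)] by (simp add: z_def)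
    then show "a \<otimes> y = x [^] (k * int p) \<otimes> y \<otimes> a"
      using comm[OF yz(1,2)] zx px by (simp add: mult.commute)
    show "a [^] p = x [^] (int p * c) \<otimes> y [^] (0::int)" using ap px c by simp
    show "a \<otimes> x \<noteq> x \<otimes> a \<or> a \<otimes> y \<noteq> y \<otimes> a" using D_one_commutes[OF yz(1)] z1 by (simp add: z_def)
  qed
qed

lemma center_powers:
  assumes "card center = p" "z \<in> center" "z \<noteq> \<one>" "u \<in> center"
  obtains k :: int where "u = z [^] k"
proof -
  have "z [^] p = \<one>" using subgroup_pow_card[OF subgroup_center assms(2)] assms(1) by simp
  moreover have "z \<in> carrier G" using assms(2) by (simp add: center_def)
  ultimately have "z [^] i = \<one> \<longleftrightarrow> int (card center) dvd i" for i :: int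
    using int_pow_prime_eq_one[OF _ prime_p] assms by simp
  then show thesis
    using subgroup_eq_powers[OF subgroup_center fin_sub[OF subgroup_center] assms(2) _ assms(4)] that by blast
qed

lemma in_center_iff:
  assumes "a \<in> carrier G" "a \<notin> N" "u \<in> N" shows "u \<in> center \<longleftrightarrow> cmt a u = \<one>"
proof -
  interpret abelian_prime_index G N a p by (rule abelian_prime_index_outside[OF assms(1,2)])
  obtain x where "x \<in> N" "cmt a x \<noteq> \<one>" using exists_moved[OF assms(1,2)] by blast
  then show ?thesis using center_eq assms(3) by blast
qed

lemma pow_p_in_center:
  assumes "a \<in> carrier G" "a \<notin> N" shows "a [^] p \<in> center"
proof -
  interpret abelian_prime_index G N a p by (rule abelian_prime_index_outside[OF assms])
  have "a \<otimes> a [^] p = a [^] p \<otimes> a" using a_closed nat_pow_Suc2[of a p] by simp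
  then show ?thesis using in_center_iff[OF assms pow_mem] D_one_commutes[OF pow_mem] by blast
qed

text \<open>Multiplying \<open>a\<close> by an element of \<open>N\<close> does not change conjugation on \<open>N\<close>, only \<open>a\<^sup>p\<close>.\<close>

lemma shift_pow_p:
  fixes i :: int
  assumes a: "a \<in> carrier G" "a \<notin> N" and x: "x \<in> N" "cmt a (cmt a (cmt a x)) = \<one>"
  shows "x [^] i \<otimes> a \<in> carrier G" "x [^] i \<otimes> a \<notin> N"
    and "(x [^] i \<otimes> a) [^] p = (x [^] p) [^] i \<otimes> cmt a (cmt a x) [^] (i * int (p choose 3)) \<otimes> a [^] p"
    and "w \<in> N \<Longrightarrow> cmt (x [^] i \<otimes> a) w = cmt a w"
proof -
  interpret abelian_prime_index G N a p by (rule abelian_prime_index_outside[OF a])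
  note c = N_closed[OF x(1)] a_closed
  have xi: "x [^] i \<in> N" using x N_int_pow by blast
  show "x [^] i \<otimes> a \<in> carrier G" using c by simp
  show "x [^] i \<otimes> a \<notin> N"
  proof
    assume "x [^] i \<otimes> a \<in> N"
    then have "inv (x [^] i) \<otimes> (x [^] i \<otimes> a) \<in> N" using xi N_inv N_mult by blast
    then show False using c a by (simp add: m_assoc[symmetric])
  qed
  show "cmt (x [^] i \<otimes> a) w = cmt a w" if "w \<in> N" using cmt_shift[OF xi that] .
  have DD: "D (D (x [^] i)) = D (D x) [^] i" "D (D (D (x [^] i))) = \<one>"
    using x D_closed by (simp_all add: D_int_pow)
  have "(x [^] i) [^] p = (x [^] p) [^] i"
    using c int_pow_pow[of x i "int p"] int_pow_pow[of x "int p" i] by (simp add: int_pow_int mult.commute)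
  moreover have "D (D x) [^] (i * int (p choose 3)) = (D (D x) [^] i) [^] (int (p choose 3))"
    using N_closed[OF D_closed[OF D_closed[OF x(1)]]] by (simp add: int_pow_pow)
  ultimately show "(x [^] i \<otimes> a) [^] p = (x [^] p) [^] i \<otimes> cmt a (cmt a x) [^] (i * int (p choose 3)) \<otimes> a [^] p"
    using pow_p_formula[OF xi DD(2), of 1] DD(1) c by simp
qed

text \<open>Multiplying \<open>a\<close> by a power of \<open>x\<close> moves \<open>a\<^sup>p\<close> through the norms, which fill the center unless
  \<open>p = 3\<close> and \<open>k = -1\<close> modulo \<open>3\<close>; in that case \<open>a\<^sup>p\<close> can be scaled with \<open>x\<close>.\<close>

lemma realizes_max_noncyclic:
  fixes c k :: int
  assumes a: "a \<in> carrier G" "a \<notin> N" and x: "x \<in> N"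
    and z: "cmt a (cmt a x) = (x [^] p) [^] k" "\<not> int p dvd k"
    and xp: "x [^] p \<noteq> \<one>" "(x [^] p) [^] p = \<one>" and xZ: "x [^] p \<in> center"
    and ap: "a [^] p = (x [^] p) [^] c"
    and k: "k = 1 \<or> k = \<epsilon>" and e: "\<not> QuadRes (int p) \<epsilon>"
  shows "\<exists>T\<in>set (ext_list p \<epsilon>). realizes G T"
proof -
  interpret abelian_prime_index G N a p by (rule abelian_prime_index_outside[OF a])
  have xpN: "x [^] p \<in> N" using x by (rule N_nat_pow)
  have x3: "cmt a (cmt a (cmt a x)) = \<one>"
    unfolding z(1) using xpN xZ in_center_iff[OF a xpN] by (simp add: D_int_pow)
  have xD: "cmt a (x [^] p) = \<one>" using in_center_iff[OF a xpN] xZ by blast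
  note xc = N_closed[OF xpN]
  note xo = int_pow_prime_eq_one[OF xc prime_p xp(2,1)]
  have shift: "realizes G (fam2 p 0 k 1 0 0)" if i: "int p dvd i + k * (i * int (p choose 3)) + c" for i
  proof -
    note s = shift_pow_p[OF a x x3, where i = i]
    have "(x [^] i \<otimes> a) [^] p = (x [^] p) [^] (i + k * (i * int (p choose 3)) + c)"
      unfolding s(3) z(1) ap using xc by (simp add: int_pow_pow int_pow_mult)
    then have "(x [^] i \<otimes> a) [^] p = (x [^] p) [^] (0::int)" using i xo by simp
    then show ?thesis
      using realizes_fam2_max[OF s(1,2) x, of k 0] s(4) x xpN D_closed z xp xD by simp
  qed
  have in67: "fam2 p 0 k 1 0 0 \<in> set (ext_list p \<epsilon>)"
    using k by (auto simp: fam2_def ext_list_def)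
  show ?thesis
  proof (cases "p = 3")
    case False
    then have "int p dvd int (p choose 3)" by (rule prime_dvd_choose_3[OF prime_p odd_p])
    \<comment> \<open>the norm of \<open>x\<close> is \<open>x\<^sup>p\<close>, so \<open>i = -c\<close> cancels \<open>a\<^sup>p\<close>\<close>
    then have "int p dvd - c + k * (- c * int (p choose 3)) + c" by simp
    then show ?thesis using shift in67 by blast
  next
    case p3: True
    show ?thesis
    proof (cases "k = 1")
      case True
      \<comment> \<open>the norm of \<open>x\<close> is \<open>x\<^sup>2\<^sup>p\<close>, so \<open>i = c\<close> cancels \<open>a\<^sup>p\<close>, as \<open>3 c = 0\<close>\<close>
      then have "int p dvd c + k * (c * int (p choose 3)) + c" using p3 by simp
      then show ?thesis using shift in67 by blast
    next
      case False
      then have k: "k = \<epsilon>" using k by simp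
      show ?thesis
      proof (cases "int p dvd c")
        case True
        then show ?thesis using shift[of 0] in67 by auto
      next
        case c: False
        \<comment> \<open>the norms vanish; \<open>x\<^sup>c\<close> satisfies the same relations as \<open>x\<close>, and its \<open>p\<close>-th power is \<open>a\<^sup>p\<close>\<close>
        define x' where "x' = x [^] c"
        have x'N: "x' \<in> N" unfolding x'_def using x N_int_pow by blast
        have x'p: "x' [^] p = (x [^] p) [^] c"
          unfolding x'_def using N_closed[OF x] int_pow_pow[of x c "int p"] int_pow_pow[of x "int p" c]
          by (simp add: int_pow_int mult.commute)
        have "cmt a (cmt a x') = (x' [^] p) [^] k"
          unfolding x'p unfolding x'_def using x D_closed z(1) xc by (simp add: D_int_pow int_pow_pow mult.commute)
        moreover have "x' [^] p \<noteq> \<one>" unfolding x'p using xo c by simp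
        moreover have "(x' [^] p) [^] p = \<one>"
          unfolding x'p using pow_dvd_one[OF xc xp(2), of "c * int p"] xc int_pow_pow[of "x [^] p" c "int p"]
          by (simp add: int_pow_int)
        moreover have "cmt a (x' [^] p) = \<one>" unfolding x'p using xpN xD by (simp add: D_int_pow)
        moreover have "a [^] p = (x' [^] p) [^] (1::int)" unfolding x'p using ap xc by simp
        ultimately have "realizes G (fam2 p 0 k 1 (int p * 1) 0)"
          using realizes_fam2_max[OF a x'N _ z(2)] by blast
        moreover have "fam2 p 0 k 1 (int p * 1) 0 \<in> set (ext_list p \<epsilon>)"
          using k p3 by (auto simp: fam2_def ext_list_def)
        ultimately show ?thesis by blast
      qed
    qed
  qed
qed

text \<open>The center has order \<open>p\<close> and contains \<open>D (D x)\<close>, \<open>x\<^sup>p\<close> and \<open>a\<^sup>p\<close>, which are therefore powers of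
  any nontrivial one among them.\<close>

lemma realizes_max:
  assumes a: "a \<in> carrier G" "a \<notin> N" and Z: "card center = p"
    and n3: "\<And>x. x \<in> N \<Longrightarrow> cmt a (cmt a (cmt a x)) = \<one>"
    and x: "x \<in> N" "cmt a (cmt a x) \<noteq> \<one>" and e: "\<not> QuadRes (int p) \<epsilon>"
  shows "\<exists>T\<in>set (ext_list p \<epsilon>). realizes G T"
proof -
  interpret abelian_prime_index G N a p by (rule abelian_prime_index_outside[OF a])
  define z where "z = cmt a (cmt a x)"
  have zN: "z \<in> N" and z1: "z \<noteq> \<one>" using x D_closed by (auto simp: z_def)
  have zZ: "z \<in> center" using in_center_iff[OF a zN] n3[OF x(1)] by (simp add: z_def)
  have zp: "z [^] p = \<one>" using D_pow_p(2)[OF x(1) n3[OF x(1)]] by (simp add: z_def)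
  note zo = int_pow_prime_eq_one[OF N_closed[OF zN] prime_p zp z1]
  have xpN: "x [^] p \<in> N" using x N_nat_pow by blast
  have xD: "cmt a (x [^] p) = \<one>" using D_pow_p(1)[OF x(1) n3[OF x(1)]] x by (simp add: D_nat_pow)
  then have xZ: "x [^] p \<in> center" using in_center_iff[OF a xpN] by blast
  show ?thesis
  proof (cases "x [^] p = \<one>")
    case True
    obtain j where j: "a [^] p = z [^] (j::int)"
      using center_powers[OF Z zZ z1 pow_p_in_center[OF a]] by blast
    have in10: "fam3 p 1 0 \<in> set (ext_list p \<epsilon>)" by (auto simp: fam3_def ext_list_def)
    consider "int p dvd j" | "\<not> int p dvd j" "p = 3" | "\<not> int p dvd j" "3 < p"
      using prime_ge_2_nat[OF prime_p] odd_p by (cases "p = 2"; cases "p = 3") auto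
    then show ?thesis
    proof cases
      case 1
      then have "a [^] p = z [^] (0::int)" using j zo by simp
      then show ?thesis
        using realizes_fam3_max[OF a x(1) n3[OF x(1)] x(2) True, of 0] in10 by (auto simp: z_def)
    next
      case 2
      \<comment> \<open>for \<open>p = 3\<close> the norm of \<open>x\<close> is \<open>D (D x)\<close>\<close>
      note s = shift_pow_p[OF a x(1) n3[OF x(1)], where i = "- j"]
      have "(x [^] (- j) \<otimes> a) [^] p = z [^] (- j) \<otimes> z [^] j"
        unfolding s(3) j True using 2 N_closed[OF zN] by (simp add: z_def[symmetric])
      then have "(x [^] (- j) \<otimes> a) [^] p = z [^] (0::int)"
        using N_closed[OF zN] by (simp add: int_pow_mult[symmetric])
      then show ?thesis
        using realizes_fam3_max[OF s(1,2) x(1) _ _ True, of 0] in10 s(4) x n3[OF x(1)] D_closed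
        by (auto simp: z_def)
    next
      case 3
      \<comment> \<open>the norms vanish for \<open>p > 3\<close>; rescaling \<open>x\<close> makes \<open>D (D x)\<close> equal to \<open>a\<^sup>p\<close>\<close>
      define x' where "x' = x [^] j"
      have x'N: "x' \<in> N" unfolding x'_def using x N_int_pow by blast
      have zz: "cmt a (cmt a x') = z [^] j"
        unfolding x'_def z_def using x D_closed by (simp add: D_int_pow)
      have "x' [^] p = \<one>"
        unfolding x'_def using N_closed[OF x(1)] int_pow_pow[of x j "int p"]
          pow_dvd_one[OF N_closed[OF x(1)] True, of "j * int p"]
        by (simp add: int_pow_int)
      moreover have "cmt a (cmt a x') \<noteq> \<one>" unfolding zz using zo 3 by simp
      moreover have "a [^] p = cmt a (cmt a x') [^] (1::int)" unfolding zz using j N_closed[OF zN] by simp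
      ultimately have "realizes G (fam3 p 1 1)"
        using realizes_fam3_max[OF a x'N n3[OF x'N]] by blast
      moreover have "fam3 p 1 1 \<in> set (ext_list p \<epsilon>)" using 3 by (auto simp: fam3_def ext_list_def)
      ultimately show ?thesis by blast
    qed
  next
    case False
    note xc = N_closed[OF xpN]
    have xpp: "(x [^] p) [^] p = \<one>" using subgroup_pow_card[OF subgroup_center xZ] Z by simp
    note xo = int_pow_prime_eq_one[OF xc prime_p xpp False]
    obtain k0 where k0: "z = (x [^] p) [^] (k0::int)" using center_powers[OF Z xZ False zZ] by blast
    have pk0: "\<not> int p dvd k0" using xo z1 k0 by blast
    obtain m k where m: "k = 1 \<or> k = \<epsilon>" "int p dvd k0 * int m ^ 2 - k"
      using square_class_scaling[OF prime_p odd_p e pk0] by blast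
    have pk: "\<not> int p dvd k"
    proof
      assume "int p dvd k"
      then have "[0 ^ 2 = k] (mod int p)" by (simp add: cong_iff_dvd_diff)
      then have "\<epsilon> \<noteq> k" using e unfolding QuadRes_def by blast
      then show False using m \<open>int p dvd k\<close> p_gt by auto
    qed
    have "\<not> p dvd m"
    proof
      assume "p dvd m"
      then have "int p dvd k0 * int m ^ 2" by (simp add: power2_eq_square)
      then have "int p dvd k" using m(2) by (metis dvd_diff_commute dvd_diff_right_iff)
      then show False using pk by blast
    qed
    then have b: "a [^] m \<in> carrier G" "a [^] m \<notin> N" using a a_pow_in_N by auto
    have "cmt (a [^] m) (cmt (a [^] m) x) = z [^] (int m ^ 2)"
      using double_commutator_pow[OF x(1) N_one n3[OF x(1)], of "a [^] m" m] a by (simp add: z_def)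
    also have "\<dots> = (x [^] p) [^] (k0 * int m ^ 2 - k + k)" unfolding k0 using xc by (simp add: int_pow_pow)
    also have "\<dots> = (x [^] p) [^] k" unfolding int_pow_mult[OF xc] using m(2) xo xc by simp
    finally have "cmt (a [^] m) (cmt (a [^] m) x) = (x [^] p) [^] k" .
    moreover obtain c where "(a [^] m) [^] p = (x [^] p) [^] (c::int)"
      using center_powers[OF Z xZ False pow_p_in_center[OF b]] by blast
    ultimately show ?thesis
      using realizes_max_noncyclic[OF b x(1) _ pk False xpp xZ _ m(1) e] by blast
  qed
qed

end

section \<open>Realizations by groups of class two\<close>

context group
begin

text \<open>Inverting \<open>k\<close> modulo \<open>p\<close> recovers \<open>z\<close> from its \<open>k\<close>-th power.\<close>

lemma pow_coprime_root:
  assumes "prime p" "z \<in> carrier G" "z [^] p = \<one>" "\<not> int p dvd k"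
  obtains m :: int where "z = (z [^] k) [^] m"
proof -
  obtain m where m: "int p dvd k * int m - 1" using prime_inverse_mod[OF assms(1,4)] by blast
  have "(z [^] k) [^] int m = z [^] (k * int m - 1 + 1)" using assms(2) by (simp add: int_pow_pow)
  also have "\<dots> = z"
    unfolding int_pow_mult[OF assms(2)] using pow_dvd_one[OF assms(2,3) m] assms(2) by simp
  finally show thesis using that by metis
qed

lemma centerD: "z \<in> center \<Longrightarrow> g \<in> carrier G \<Longrightarrow> g \<otimes> z = z \<otimes> g"
  by (simp add: center_def)

lemma center_closed: "z \<in> center \<Longrightarrow> z \<in> carrier G"
  by (simp add: center_def)

lemma cmt_inv:
  assumes "g \<in> carrier G" "h \<in> carrier G" shows "cmt h g = inv (cmt g h)"
  using assms by (simp add: cmt_def inv_mult_group m_assoc)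

lemma cmt_central_right:
  assumes "g \<in> carrier G" "z \<in> center" shows "cmt g z = \<one>"
  using assms centerD center_closed cmt_eq_one_iff by simp

lemma cmt_mult_right:
  assumes "g \<in> carrier G" "h \<in> carrier G" "k \<in> carrier G" "cmt g k \<in> center"
  shows "cmt g (h \<otimes> k) = cmt g h \<otimes> cmt g k"
proof (rule cmt_eqI)
  note c = assms(1-3) cmt_closed[OF assms(1,2)] cmt_closed[OF assms(1,3)]
  show "g \<in> carrier G" "h \<otimes> k \<in> carrier G" "cmt g h \<otimes> cmt g k \<in> carrier G" using c by auto
  have "g \<otimes> (h \<otimes> k) = cmt g h \<otimes> h \<otimes> (g \<otimes> k)"
    using mult_cmt[OF assms(1,2)] c by (simp add: m_assoc[symmetric])
  also have "\<dots> = cmt g h \<otimes> (h \<otimes> cmt g k) \<otimes> k \<otimes> g"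
    using mult_cmt[OF assms(1,3)] c by (simp add: m_assoc)
  also have "h \<otimes> cmt g k = cmt g k \<otimes> h" using centerD[OF assms(4,2)] .
  finally show "g \<otimes> (h \<otimes> k) = cmt g h \<otimes> cmt g k \<otimes> (h \<otimes> k) \<otimes> g" using c by (simp add: m_assoc)
qed

lemma cmt_int_pow_right:
  assumes "g \<in> carrier G" "h \<in> carrier G" "cmt g h \<in> center"
  shows "cmt g (h [^] (i::int)) = cmt g h [^] i"
proof (rule cmt_eqI)
  note c = assms(1,2) cmt_closed[OF assms(1,2)]
  show "g \<in> carrier G" "h [^] i \<in> carrier G" "cmt g h [^] i \<in> carrier G" using c by auto
  have "g \<otimes> h [^] i = (cmt g h \<otimes> h) [^] i \<otimes> g"
    using c by (intro conj_int_pow mult_cmt) auto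
  also have "(cmt g h \<otimes> h) [^] i = cmt g h [^] i \<otimes> h [^] i"
    using centerD[OF assms(3,2)] c by (intro int_pow_mult_distrib) auto
  finally show "g \<otimes> h [^] i = cmt g h [^] i \<otimes> h [^] i \<otimes> g" .
qed

lemma cmt_int_pow_left:
  assumes "g \<in> carrier G" "h \<in> carrier G" "cmt g h \<in> center"
  shows "cmt (g [^] (i::int)) h = cmt g h [^] i"
proof -
  have "cmt h g \<in> center"
    using cmt_inv[OF assms(1,2)] assms(3) subgroup.m_inv_closed[OF subgroup_center] by simp
  then have "cmt h (g [^] i) = cmt h g [^] i" using assms by (intro cmt_int_pow_right) auto
  then have "cmt (g [^] i) h = inv (inv (cmt g h) [^] i)"
    using cmt_inv[of h "g [^] i"] cmt_inv[of g h] assms by simp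
  then show ?thesis using assms cmt_closed by (simp add: int_pow_inv)
qed

text \<open>The commutator enters with exponent \<open>p choose 2\<close>, which \<open>p\<close> divides as it is odd.\<close>

lemma class2_mult_pow:
  fixes p :: nat
  assumes "prime p" "odd p" "g \<in> carrier G" "h \<in> carrier G" "cmt h g \<in> center" "cmt h g [^] p = \<one>"
  shows "(g \<otimes> h) [^] p = g [^] p \<otimes> h [^] p"
proof -
  define w where "w = cmt h g"
  have w: "w \<in> carrier G" "\<And>k. k \<in> carrier G \<Longrightarrow> k \<otimes> w = w \<otimes> k" "w [^] p = \<one>"
    using assms centerD center_closed by (simp_all add: w_def)
  have "h \<otimes> g = w \<otimes> g \<otimes> h" using mult_cmt[of h g] assms by (simp add: w_def)
  then have "unipotent g w \<one> h" unfolding unipotent_def using w assms by auto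
  then have "(g \<otimes> h) [^] p = g [^] int p \<otimes> w [^] int (p choose 2) \<otimes> \<one> [^] int (p choose 3) \<otimes> h [^] p"
    by (rule unipotent_mult_pow)
  moreover have "w [^] int (p choose 2) = \<one>"
    using pow_dvd_one[OF w(1,3)] prime_dvd_choose_2[OF assms(1,2)] by blast
  ultimately show ?thesis using assms by (simp add: int_pow_int)
qed

end

context nonabelian_p4
begin

lemma realizes_cyclic_center:
  fixes c :: int
  assumes "x \<in> center" "x [^] p \<noteq> \<one>" "(x [^] p) [^] p = \<one>" and y: "y \<in> carrier G" "y [^] p = \<one>"
    and a: "a \<in> carrier G" "cmt a y = x [^] p" "a [^] p = x [^] c"
  shows "realizes G (fam2 p 0 1 0 c 0)"
proof -
  have x: "x \<in> carrier G" using assms(1) by (rule center_closed)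
  note xo = int_pow_prime_sq_eq_one[OF x prime_p assms(3,2)]
  note xpo = int_pow_prime_eq_one[OF _ prime_p assms(3,2)]
  have xp: "x [^] p \<in> center" using subgroup_int_pow[OF subgroup_center assms(1), of "int p"] by (simp add: int_pow_int)
  show ?thesis
  proof (rule realizes_fam2I[OF is_group ord prime_p x y(1) a(1)])
    show "x \<otimes> y = y \<otimes> x" using centerD[OF assms(1) y(1)] by simp
    show "x [^] (int p ^ 2) = \<one>" using xo by simp
    show "y [^] int p = \<one>" using y by (simp add: int_pow_int)
    show "int p ^ 2 dvd i \<and> int p dvd j" if e: "x [^] i \<otimes> y [^] j = \<one>" for i j :: int
    proof -
      have yj: "cmt a (y [^] j) = (x [^] p) [^] j"
        using cmt_int_pow_right[of a y j] a y xp by simp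
      have xi: "x [^] i \<in> center" using subgroup_int_pow[OF subgroup_center assms(1)] .
      have "inv (y [^] j) = x [^] i" using inv_equality[OF e] x y by simp
      then have "y [^] j = inv (x [^] i)" using inv_inv[of "y [^] j"] y by simp
      then have "y [^] j \<in> center" using subgroup.m_inv_closed[OF subgroup_center xi] by simp
      then have "(x [^] p) [^] j = \<one>" using cmt_central_right[OF a(1)] yj by simp
      then have j: "int p dvd j" using xpo x by simp
      then have "y [^] j = \<one>" using pow_dvd_one y by blast
      then show ?thesis using j e x xo by simp
    qed
    show "a \<otimes> x = x [^] (1 + 0 * int p) \<otimes> y [^] (0::int) \<otimes> a"
      using centerD[OF assms(1) a(1)] x by simp
    show "a \<otimes> y = x [^] (1 * int p) \<otimes> y \<otimes> a" using mult_cmt[OF a(1) y(1)] a(2) by (simp add: int_pow_int)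
    show "a [^] p = x [^] c \<otimes> y [^] (0::int)" using a x by simp
    show "a \<otimes> x \<noteq> x \<otimes> a \<or> a \<otimes> y \<noteq> y \<otimes> a" using cmt_eq_one_iff[OF a(1) y(1)] a(2) assms(2) by simp
  qed
qed

text \<open>Commutation with \<open>a\<close> kills \<open>y\<close>, so the exponent of \<open>x\<close> in a relation is divisible by \<open>p\<close>; the
  exponent of \<open>y\<close> is then, too, because otherwise \<open>y\<close> would be a power of \<open>x\<^sup>p\<close>.\<close>

lemma realizes_fam2_class2:
  assumes x: "x \<in> carrier G" "x [^] p \<noteq> \<one>" "(x [^] p) [^] p = \<one>"
    and y: "y \<in> center" "y [^] p = \<one>" and ind: "\<And>k::int. y \<noteq> (x [^] p) [^] k"
    and a: "a \<in> carrier G" "cmt a x \<in> center" "cmt a x \<noteq> \<one>" "cmt a x [^] p = \<one>"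
      "cmt a x = x [^] (\<alpha> * int p) \<otimes> y [^] \<gamma>" "a [^] p = y [^] d"
  shows "realizes G (fam2 p \<alpha> 0 \<gamma> 0 d)"
proof -
  have yc: "y \<in> carrier G" using y(1) by (rule center_closed)
  have y1: "y \<noteq> \<one>" using ind[of 0] by simp
  note xo = int_pow_prime_sq_eq_one[OF x(1) prime_p x(3,2)]
  note yo = int_pow_prime_eq_one[OF yc prime_p y(2) y1]
  note wo = int_pow_prime_eq_one[OF cmt_closed[OF a(1) x(1)] prime_p a(4,3)]
  have px: "(x [^] p) [^] i = x [^] (int p * i)" for i :: int
    using int_pow_pow[OF x(1), of "int p" i] by (simp add: int_pow_int)
  have cm: "x [^] i \<otimes> y [^] j = y [^] j \<otimes> x [^] i" for i j :: int
    using int_pow_commute[OF x(1) yc] centerD[OF y(1) x(1)] by simp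
  show ?thesis
  proof (rule realizes_fam2I[OF is_group ord prime_p x(1) yc a(1)])
    show "x \<otimes> y = y \<otimes> x" using centerD[OF y(1) x(1)] .
    show "x [^] (int p ^ 2) = \<one>" using xo by simp
    show "y [^] int p = \<one>" using y by (simp add: int_pow_int)
    show "int p ^ 2 dvd i \<and> int p dvd j" if e: "x [^] i \<otimes> y [^] j = \<one>" for i j :: int
    proof -
      have yj: "y [^] j \<in> center" using subgroup_int_pow[OF subgroup_center y(1)] .
      have "x [^] i = inv (y [^] j)" using inv_equality[OF e] x yc by simp
      then have "x [^] i \<in> center" using subgroup.m_inv_closed[OF subgroup_center yj] by simp
      then have "cmt a x [^] i = \<one>"
        using cmt_central_right[OF a(1)] cmt_int_pow_right[OF a(1) x(1) a(2), of i] by simp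
      then have "int p dvd i" using wo by simp
      then obtain i' where i: "i = int p * i'" by blast
      have j: "int p dvd j"
      proof (rule ccontr)
        assume "\<not> int p dvd j"
        then obtain m where m: "y = (y [^] j) [^] (m::int)" using pow_coprime_root[OF prime_p yc y(2)] by blast
        have "y [^] j = inv (x [^] i) \<otimes> (x [^] i \<otimes> y [^] j)" using x yc by (simp add: m_assoc[symmetric])
        then have "y [^] j = x [^] (- i)" unfolding e using x by (simp add: int_pow_neg)
        then have yjx: "y [^] j = (x [^] p) [^] (- i')" unfolding px i by simp
        have "(y [^] j) [^] m = (x [^] p) [^] (- i' * m)" unfolding yjx using x by (simp add: int_pow_pow)
        then show False using m ind by metis
      qed
      then have "y [^] j = \<one>" using yo by simp
      then show ?thesis using j e x xo by simp
    qed
    have "a \<otimes> x = x \<otimes> cmt a x \<otimes> a" using mult_cmt[OF a(1) x(1)] centerD[OF a(2) x(1)] by simp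
    then show "a \<otimes> x = x [^] (1 + \<alpha> * int p) \<otimes> y [^] \<gamma> \<otimes> a"
      unfolding a(5) using x yc a by (simp add: int_pow_mult m_assoc)
    show "a \<otimes> y = x [^] (0 * int p) \<otimes> y \<otimes> a" using centerD[OF y(1) a(1)] yc by simp
    show "a [^] p = x [^] (0::int) \<otimes> y [^] d" using a yc by simp
    show "a \<otimes> x \<noteq> x \<otimes> a \<or> a \<otimes> y \<noteq> y \<otimes> a" using cmt_eq_one_iff[OF a(1) x(1)] a(3) by simp
  qed
qed

lemma realizes_exponent_p:
  assumes g: "g \<in> carrier G" "g [^] p = \<one>" and h: "h \<in> carrier G" "h [^] p = \<one>"
    and w: "cmt h g \<in> center" "cmt h g \<noteq> \<one>" "cmt h g [^] p = \<one>"
    and t: "t \<in> center" "t [^] p = \<one>" "\<And>k::int. t \<noteq> cmt h g [^] k"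
  shows "realizes G (fam3 p 0 0)"
proof -
  define w where "w = cmt h g"
  have wc: "w \<in> carrier G" "w \<in> center" "w [^] p = \<one>" "w \<noteq> \<one>" using w center_closed by (auto simp: w_def)
  have tc: "t \<in> carrier G" using t(1) by (rule center_closed)
  have t1: "t \<noteq> \<one>" using t(3)[of 0] by simp
  note wo = int_pow_prime_eq_one[OF wc(1) prime_p wc(3,4)]
  note to = int_pow_prime_eq_one[OF tc prime_p t(2) t1]
  show ?thesis
  proof (rule realizes_fam3I[OF is_group ord prime_p wc(1) g(1) tc h(1)])
    show "w \<otimes> g = g \<otimes> w" "w \<otimes> t = t \<otimes> w" "g \<otimes> t = t \<otimes> g"
      using centerD[OF wc(2) g(1)] centerD[OF wc(2) tc] centerD[OF t(1) g(1)] by simp_all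
    show "w [^] int p = \<one>" "g [^] int p = \<one>" "t [^] int p = \<one>" using wc g t by (simp_all add: int_pow_int)
    show "int p dvd i \<and> int p dvd j \<and> int p dvd k" if e: "w [^] i \<otimes> g [^] j \<otimes> t [^] k = \<one>" for i j k :: int
    proof -
      have wi: "w [^] i \<in> center" and tk: "t [^] k \<in> center"
        using subgroup_int_pow[OF subgroup_center] wc t by auto
      have "g [^] j = inv (w [^] i) \<otimes> (w [^] i \<otimes> g [^] j \<otimes> t [^] k) \<otimes> inv (t [^] k)"
        using wc g tc by (simp add: m_assoc) (simp add: m_assoc[symmetric])
      then have "g [^] j = inv (w [^] i) \<otimes> inv (t [^] k)" unfolding e using wc tc by simp
      then have "g [^] j \<in> center"
        using wi tk subgroup.m_inv_closed[OF subgroup_center] subgroup.m_closed[OF subgroup_center] by simp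
      then have "w [^] j = \<one>"
        using cmt_central_right[OF h(1)] cmt_int_pow_right[OF h(1) g(1), of j] w by (simp add: w_def)
      then have j: "int p dvd j" using wo by simp
      then have "g [^] j = \<one>" using pow_dvd_one g by blast
      then have wt: "w [^] i \<otimes> t [^] k = \<one>" using e wc by simp
      have k: "int p dvd k"
      proof (rule ccontr)
        assume "\<not> int p dvd k"
        then obtain m where m: "t = (t [^] k) [^] (m::int)" using pow_coprime_root[OF prime_p tc t(2)] by blast
        have "inv (w [^] i) \<otimes> (w [^] i \<otimes> t [^] k) = t [^] k" using wc tc by (simp add: m_assoc[symmetric])
        then have tkx: "t [^] k = w [^] (- i)" unfolding wt using wc by (simp add: int_pow_neg)
        have "(t [^] k) [^] m = w [^] (- i * m)" unfolding tkx using wc by (simp add: int_pow_pow)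
        then show False using m t(3) by (simp add: w_def)
      qed
      then have "t [^] k = \<one>" using to by simp
      then show ?thesis using j k wt wc wo by simp
    qed
    show "h \<otimes> w = w \<otimes> h" using centerD[OF wc(2) h(1)] .
    show "h \<otimes> g = w \<otimes> g \<otimes> h" using mult_cmt[OF h(1) g(1)] by (simp add: w_def)
    show "h \<otimes> t = g [^] (0::int) \<otimes> t \<otimes> h" using centerD[OF t(1) h(1)] tc by simp
    show "h [^] p = w [^] (0::int)" using h by simp
    show "h \<otimes> g \<noteq> g \<otimes> h" using cmt_eq_one_iff[OF h(1) g(1)] w by simp
  qed
qed

end

text \<open>In class two the commutators form a group \<open>W\<close> of order \<open>p\<close> inside the center, commutation is
  bilinear, and, as \<open>p\<close> is odd, taking \<open>p\<close>-th powers is a homomorphism into the center. The type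
  is decided by how its image lies relative to \<open>W\<close>.\<close>

locale class2_p4 = nonabelian_p4 +
  fixes W :: "'a set"
  assumes subW: "subgroup W G" and cardW: "card W = p" and cardZ: "card center = p ^ 2"
    and W_central: "W \<subseteq> center"
    and cmt_in_W: "g \<in> carrier G \<Longrightarrow> h \<in> carrier G \<Longrightarrow> cmt g h \<in> W"
begin

lemma W_pow_p: "w \<in> W \<Longrightarrow> w [^] p = \<one>"
  using subgroup_pow_card[OF subW] cardW by simp

lemma cmt_central: "g \<in> carrier G \<Longrightarrow> h \<in> carrier G \<Longrightarrow> cmt g h \<in> center"
  using cmt_in_W W_central by blast

lemma cmt_pow_p: "g \<in> carrier G \<Longrightarrow> h \<in> carrier G \<Longrightarrow> cmt g h [^] p = \<one>"
  using cmt_in_W W_pow_p by blast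

lemma W_powers:
  assumes "w \<in> W" "w \<noteq> \<one>" "u \<in> W" shows "\<exists>k::int. u = w [^] k"
proof -
  have "w [^] i = \<one> \<longleftrightarrow> int (card W) dvd i" for i :: int
    using int_pow_prime_eq_one[OF _ prime_p W_pow_p[OF assms(1)] assms(2)] subgroup.mem_carrier[OF subW assms(1)]
      cardW by simp
  then show ?thesis using subgroup_eq_powers[OF subW fin_sub[OF subW] assms(1) _ assms(3)] by blast
qed

lemma scale:
  assumes "g \<in> carrier G" "h \<in> carrier G" "cmt g h \<noteq> \<one>" "w \<in> W"
  shows "\<exists>m::int. cmt (g [^] m) h = w" and "\<exists>m::int. cmt g (h [^] m) = w"
  using W_powers[OF cmt_in_W[OF assms(1,2)] assms(3,4)] cmt_int_pow_left[OF assms(1,2) cmt_central[OF assms(1,2)]]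
    cmt_int_pow_right[OF assms(1,2) cmt_central[OF assms(1,2)]] by metis+

lemma pow_p_central:
  assumes g: "g \<in> carrier G" shows "g [^] p \<in> center"
proof -
  have "h \<otimes> g [^] p = g [^] p \<otimes> h" if h: "h \<in> carrier G" for h
  proof -
    have "cmt h (g [^] p) = \<one>"
      using cmt_int_pow_right[OF h g cmt_central[OF h g], of "int p"] cmt_pow_p[OF h g] by (simp add: int_pow_int)
    then show ?thesis using cmt_eq_one_iff h g by simp
  qed
  then show ?thesis using g by (auto simp: center_def)
qed

lemma mult_pow_p: "g \<in> carrier G \<Longrightarrow> h \<in> carrier G \<Longrightarrow> (g \<otimes> h) [^] p = g [^] p \<otimes> h [^] p"
  using class2_mult_pow[OF prime_p odd_p] cmt_central cmt_pow_p by blast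

lemma int_pow_pow_p: "g \<in> carrier G \<Longrightarrow> (g [^] k) [^] p = (g [^] p) [^] (k::int)"
  using int_pow_pow[of g k "int p"] int_pow_pow[of g "int p" k] by (simp add: int_pow_int mult.commute)

lemma exists_noncommuting_with: "g \<in> carrier G \<Longrightarrow> g \<notin> center \<Longrightarrow> \<exists>h\<in>carrier G. cmt h g \<noteq> \<one>"
  using cmt_eq_one_iff by (auto simp: center_def)

lemma center_pow_p: "z \<in> center \<Longrightarrow> (z [^] p) [^] p = \<one>"
  using subgroup_pow_card[OF subgroup_center, of z] cardZ center_closed[of z]
  by (simp add: nat_pow_pow power2_eq_square)

lemma exists_noncommuting: "\<exists>g\<in>carrier G. \<exists>h\<in>carrier G. cmt h g \<noteq> \<one>"
  using exists_outside exists_moved subgroup.mem_carrier[OF sub] by blast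

text \<open>As taking \<open>p\<close>-th powers is a homomorphism, \<open>h\<close> times a power of \<open>g\<close> does it.\<close>

lemma adjust:
  assumes g: "g \<in> carrier G" and h: "h \<in> carrier G" and w: "w \<in> carrier G"
    and hp: "h [^] p = w \<otimes> (g [^] p) [^] (k::int)"
  obtains b where "b \<in> carrier G" "b [^] p = w" "cmt b g = cmt h g" "cmt g b = cmt g h"
proof -
  define b where "b = h \<otimes> g [^] (- k)"
  have b: "b \<in> carrier G" using h g by (simp add: b_def)
  have "b [^] p = w \<otimes> ((g [^] p) [^] k \<otimes> (g [^] p) [^] (- k))"
    unfolding b_def using mult_pow_p[OF h, of "g [^] (- k)"] int_pow_pow_p[OF g, of "- k"] hp g w by (simp add: m_assoc)
  then have bp: "b [^] p = w" using g w by (simp add: int_pow_mult[symmetric])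
  have "cmt g (g [^] (- k)) = \<one>"
    using cmt_eq_one_iff[of g "g [^] (- k)"] g int_pow_commute[of g g 1 "- k"] by simp
  then have gb: "cmt g b = cmt g h"
    unfolding b_def using cmt_mult_right[OF g h _ cmt_central] g cmt_closed[OF g h] by simp
  then have "cmt b g = cmt h g" using cmt_inv[OF g h] cmt_inv[OF g b] by simp
  then show thesis using that b bp gb by blast
qed

lemma adjust_central:
  assumes g: "g \<in> carrier G" and z: "z \<in> center" and gp: "g [^] p = (z [^] p) [^] (k::int)"
  obtains b where "b \<in> carrier G" "b [^] p = \<one>" "\<And>h. h \<in> carrier G \<Longrightarrow> cmt h b = cmt h g"
    "\<And>h. h \<in> carrier G \<Longrightarrow> cmt b h = cmt g h"
proof -
  have zc: "z \<in> carrier G" using z by (rule center_closed)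
  have zk: "z [^] (- k) \<in> center" using subgroup_int_pow[OF subgroup_center z] .
  define b where "b = g \<otimes> z [^] (- k)"
  have b: "b \<in> carrier G" using g zc by (simp add: b_def)
  have "b [^] p = (z [^] p) [^] k \<otimes> (z [^] p) [^] (- k)"
    unfolding b_def using mult_pow_p[OF g, of "z [^] (- k)"] int_pow_pow_p[OF zc, of "- k"] gp zc by simp
  then have bp: "b [^] p = \<one>" using zc by (simp add: int_pow_mult[symmetric])
  have hb: "cmt h b = cmt h g" if h: "h \<in> carrier G" for h
    unfolding b_def using cmt_mult_right[OF h g _ cmt_central] h zc cmt_central_right[OF h zk] cmt_closed[OF h g] by simp
  have "cmt b h = cmt g h" if h: "h \<in> carrier G" for h
    using hb[OF h] cmt_inv[OF h g] cmt_inv[OF h b] by simp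
  then show thesis using that b bp hb by blast
qed

text \<open>A cyclic center of order \<open>p\<^sup>2\<close> has only one subgroup of order \<open>p\<close>, so \<open>W\<close> consists of the
  \<open>p\<close>-th powers in it. The two cases are exponent \<open>p\<^sup>2\<close> and exponent \<open>p\<^sup>3\<close>.\<close>

lemma realizes_center_cyclic:
  assumes "\<exists>z\<in>center. z [^] p \<noteq> \<one>"
  shows "\<exists>T\<in>set (ext_list p \<epsilon>). realizes G T"
proof -
  have Zpow: "\<exists>k::int. u = z [^] k" if "z \<in> center" "z [^] p \<noteq> \<one>" "u \<in> center" for z u
  proof -
    have "z [^] i = \<one> \<longleftrightarrow> int (card center) dvd i" for i :: int
      using int_pow_prime_sq_eq_one[OF center_closed[OF that(1)] prime_p center_pow_p[OF that(1)] that(2)] cardZ by simp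
    then show ?thesis using subgroup_eq_powers[OF subgroup_center fin_sub[OF subgroup_center] that(1) _ that(3)] by blast
  qed
  have tors: "\<exists>k::int. u = (z [^] p) [^] k" if z: "z \<in> center" "z [^] p \<noteq> \<one>" and u: "u \<in> center" "u [^] p = \<one>" for z u
  proof -
    obtain k :: int where k: "u = z [^] k" using Zpow[OF z u(1)] by blast
    have "(z [^] p) [^] k = \<one>" using u(2) int_pow_pow_p[OF center_closed[OF z(1)], of k] k by simp
    then have "int p dvd k"
      using int_pow_prime_eq_one[OF _ prime_p center_pow_p[OF z(1)] z(2)] center_closed[OF z(1)] by simp
    then obtain l where "k = int p * l" by blast
    then have "u = (z [^] p) [^] l"
      using k int_pow_pow[OF center_closed[OF z(1)], of "int p" l] by (simp add: int_pow_int)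
    then show ?thesis by blast
  qed
  obtain g0 h0 where g0: "g0 \<in> carrier G" and h0: "h0 \<in> carrier G" and gh0: "cmt h0 g0 \<noteq> \<one>"
    using exists_noncommuting by blast
  have zpW: "z [^] p \<in> W" if z: "z \<in> center" "z [^] p \<noteq> \<one>" for z
  proof -
    define w where "w = cmt h0 g0"
    have w: "w \<in> W" "w \<in> center" "w \<noteq> \<one>" using cmt_in_W[OF h0 g0] W_central gh0 by (auto simp: w_def)
    obtain k where k: "w = (z [^] p) [^] (k::int)" using tors[OF z w(2) W_pow_p[OF w(1)]] by blast
    have zc: "z [^] p \<in> carrier G" using center_closed[OF z(1)] by simp
    have "\<not> int p dvd k" using int_pow_prime_eq_one[OF zc prime_p center_pow_p[OF z(1)] z(2)] k w(3) by simp
    then obtain m where "z [^] p = w [^] (m::int)"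
      using pow_coprime_root[OF prime_p zc center_pow_p[OF z(1)]] k by blast
    then show ?thesis using subgroup_int_pow[OF subW w(1)] by simp
  qed
  show ?thesis
  proof (cases "\<forall>g\<in>carrier G. (g [^] p) [^] p = \<one>")
    case all: True
    obtain z where z: "z \<in> center" "z [^] p \<noteq> \<one>" using assms by blast
    obtain m where m: "cmt (h0 [^] (m::int)) g0 = z [^] p" using scale(1)[OF h0 g0 gh0 zpW[OF z]] by blast
    have h: "h0 [^] m \<in> carrier G" using h0 by simp
    obtain k where "g0 [^] p = (z [^] p) [^] (k::int)" using tors[OF z pow_p_central[OF g0]] all g0 by blast
    then obtain y where y: "y \<in> carrier G" "y [^] p = \<one>" "\<And>h. h \<in> carrier G \<Longrightarrow> cmt h y = cmt h g0"
      by (rule adjust_central[OF g0 z(1)]) blast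
    obtain l where "(h0 [^] m) [^] p = (z [^] p) [^] (l::int)" using tors[OF z pow_p_central[OF h]] all h by blast
    then obtain b where b: "b \<in> carrier G" "b [^] p = \<one>" "\<And>g. g \<in> carrier G \<Longrightarrow> cmt b g = cmt (h0 [^] m) g"
      by (rule adjust_central[OF h z(1)]) blast
    have "cmt b y = z [^] p" using b(3)[OF y(1)] y(3)[OF h] m by simp
    moreover have "b [^] p = z [^] (0::int)" using b by simp
    ultimately have "realizes G (fam2 p 0 1 0 0 0)"
      using realizes_cyclic_center[OF z center_pow_p[OF z(1)] y(1,2) b(1)] by blast
    moreover have "fam2 p 0 1 0 0 0 \<in> set (ext_list p \<epsilon>)" by (auto simp: fam2_def ext_list_def)
    ultimately show ?thesis by blast
  next
    case False
    then obtain g where g: "g \<in> carrier G" "(g [^] p) [^] p \<noteq> \<one>" by blast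
    define x where "x = g [^] p"
    have x: "x \<in> center" "x [^] p \<noteq> \<one>" using pow_p_central[OF g(1)] g(2) by (auto simp: x_def)
    have "g \<notin> center" using center_pow_p[of g] g by blast
    then obtain h where h: "h \<in> carrier G" "cmt h g \<noteq> \<one>" using exists_noncommuting_with[OF g(1)] by blast
    have "cmt g h \<noteq> \<one>" using h g cmt_inv[OF g(1) h(1)] by auto
    then obtain m where m: "cmt g (h [^] (m::int)) = x [^] p" using scale(2)[OF g(1) h(1) _ zpW[OF x]] by blast
    have hm: "h [^] m \<in> carrier G" using h by simp
    obtain k where "(h [^] m) [^] p = \<one> \<otimes> (g [^] p) [^] (k::int)"
      using Zpow[OF x pow_p_central[OF hm]] g by (auto simp: x_def)
    then obtain y where y: "y \<in> carrier G" "y [^] p = \<one>" "cmt g y = cmt g (h [^] m)"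
      by (rule adjust[OF g(1) hm one_closed]) blast
    have "g [^] p = x [^] (1::int)" using center_closed[OF x(1)] x_def by simp
    then have "realizes G (fam2 p 0 1 0 1 0)"
      using realizes_cyclic_center[OF x center_pow_p[OF x(1)] y(1,2) g(1)] y(3) m by simp
    moreover have "fam2 p 0 1 0 1 0 \<in> set (ext_list p \<epsilon>)" by (auto simp: fam2_def ext_list_def)
    ultimately show ?thesis by blast
  qed
qed

lemma center_not_W: "\<exists>t\<in>center. t \<notin> W"
proof -
  have "card W < card center" using cardW cardZ p_gt by (simp add: power2_eq_square)
  then show ?thesis using card_mono[OF fin_sub[OF subW], of center] by (meson linorder_not_le subsetI)
qed

text \<open>Some \<open>p\<close>-th power is a nontrivial commutator; \<open>h\<^sup>p\<close> lies in \<open>W\<close> or completes it to the center.\<close>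

lemma realizes_power_in_W:
  assumes Zp: "\<And>z. z \<in> center \<Longrightarrow> z [^] p = \<one>"
    and x: "x \<in> carrier G" "x [^] p \<noteq> \<one>" "x [^] p \<in> W"
  shows "\<exists>T\<in>set (ext_list p \<epsilon>). realizes G T"
proof -
  have xpp: "(x [^] p) [^] p = \<one>" using W_pow_p[OF x(3)] .
  have core: "realizes G (fam2 p 1 0 0 0 d)"
    if y: "y \<in> center" "\<And>k::int. y \<noteq> (x [^] p) [^] k"
      and b: "b \<in> carrier G" "cmt b x = x [^] p" "b [^] p = y [^] d" for y b and d :: int
    using realizes_fam2_class2[OF x(1,2) xpp y(1) Zp[OF y(1)] y(2) b(1), of 1 0 d]
      b x pow_p_central[OF x(1)] xpp center_closed[OF y(1)] by (simp add: int_pow_int)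
  have "x \<notin> center" using Zp x(2) by blast
  then obtain h1 where h1: "h1 \<in> carrier G" "cmt h1 x \<noteq> \<one>" using exists_noncommuting_with[OF x(1)] by blast
  obtain m where m: "cmt (h1 [^] (m::int)) x = x [^] p" using scale(1)[OF h1(1) x(1) h1(2) x(3)] by blast
  define h where "h = h1 [^] m"
  have h: "h \<in> carrier G" "cmt h x = x [^] p" using m h1 by (simp_all add: h_def)
  show ?thesis
  proof (cases "\<exists>k::int. h [^] p = (x [^] p) [^] k")
    case True
    then obtain k where "h [^] p = \<one> \<otimes> (x [^] p) [^] (k::int)" using x by auto
    then obtain b where b: "b \<in> carrier G" "b [^] p = \<one>" "cmt b x = cmt h x"
      by (rule adjust[OF x(1) h(1) one_closed]) blast
    obtain t where t: "t \<in> center" "t \<notin> W" using center_not_W by blast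
    have "t \<noteq> (x [^] p) [^] k" for k :: int using t(2) subgroup_int_pow[OF subW x(3)] by metis
    then have "realizes G (fam2 p 1 0 0 0 0)" using core[OF t(1) _ b(1), of 0] b h by simp
    moreover have "fam2 p 1 0 0 0 0 \<in> set (ext_list p \<epsilon>)" by (auto simp: fam2_def ext_list_def)
    ultimately show ?thesis by blast
  next
    case False
    then have "realizes G (fam2 p 1 0 0 0 1)" using core[OF pow_p_central[OF h(1)] _ h, of 1] h by simp
    moreover have "fam2 p 1 0 0 0 1 \<in> set (ext_list p \<epsilon>)" by (auto simp: fam2_def ext_list_def)
    ultimately show ?thesis by blast
  qed
qed

text \<open>Here the \<open>p\<close>-th power of \<open>x\<close> and \<open>W\<close> span the center, and multiplying \<open>h\<close> by a power of
  \<open>x\<close> brings its \<open>p\<close>-th power into \<open>W\<close>, where it must be trivial.\<close>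

lemma realizes_power_outside_W:
  assumes Zp: "\<And>z. z \<in> center \<Longrightarrow> z [^] p = \<one>" and x: "x \<in> carrier G" "x [^] p \<noteq> \<one>"
    and noW: "\<And>g. g \<in> carrier G \<Longrightarrow> g [^] p \<in> W \<Longrightarrow> g [^] p = \<one>"
  shows "\<exists>T\<in>set (ext_list p \<epsilon>). realizes G T"
proof -
  have xW: "x [^] p \<notin> W" using noW x by blast
  have xc: "x [^] p \<in> carrier G" and xpp: "(x [^] p) [^] p = \<one>" using x Zp pow_p_central[OF x(1)] by auto
  have "x \<notin> center" using Zp x(2) by blast
  then obtain h where h: "h \<in> carrier G" "cmt h x \<noteq> \<one>" using exists_noncommuting_with[OF x(1)] by blast
  define y where "y = cmt h x"
  have y: "y \<in> W" "y \<in> center" "y \<noteq> \<one>" "y \<in> carrier G"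
    using cmt_in_W[OF h(1) x(1)] cmt_central[OF h(1) x(1)] h center_closed by (auto simp: y_def)
  have notpow: "(x [^] p) [^] (k::nat) \<notin> W" if "0 < k" "k < p" for k
  proof
    assume k: "(x [^] p) [^] k \<in> W"
    have "\<not> int p dvd int k" using that by (simp add: nat_dvd_not_less)
    then obtain m where "x [^] p = ((x [^] p) [^] int k) [^] (m::int)"
      using pow_coprime_root[OF prime_p xc xpp] by blast
    then show False using subgroup_int_pow[OF subW k, of m] xW by (simp add: int_pow_int)
  qed
  let ?C = "G\<lparr>carrier := center\<rparr>"
  have C: "group ?C" using subgroup.subgroup_is_group[OF subgroup_center is_group] .
  have hpC: "h [^] p \<in> carrier ?C" and xpC: "x [^] p \<in> carrier ?C" using pow_p_central h x by simp_all
  have "\<exists>w\<in>W. \<exists>k<p. h [^] p = w \<otimes>\<^bsub>?C\<^esub> (x [^] p) [^]\<^bsub>?C\<^esub> k"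
  proof (rule group.coset_powers_cover[OF C _ _ _ xpC _ hpC])
    show "subgroup W ?C" by (rule subgroup_incl[OF subW subgroup_center W_central])
    show "finite (carrier ?C)" using fin_sub[OF subgroup_center] by simp
    show "order ?C = p * card W" using cardZ cardW by (simp add: order_def power2_eq_square)
    show "(x [^] p) [^]\<^bsub>?C\<^esub> k \<notin> W" if "0 < k" "k < p" for k
      using notpow[OF that] by (simp add: nat_pow_consistent[symmetric])
  qed
  then obtain w k where w: "w \<in> W" and "h [^] p = w \<otimes> (x [^] p) [^] (k::nat)"
    by (auto simp: nat_pow_consistent[symmetric])
  then have "h [^] p = w \<otimes> (x [^] p) [^] int k" by (simp add: int_pow_int)
  then obtain b where b: "b \<in> carrier G" "b [^] p = w" "cmt b x = cmt h x"
    by (rule adjust[OF x(1) h(1) subgroup.mem_carrier[OF subW w]]) blast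
  have bp: "b [^] p = \<one>" using noW[OF b(1)] b(2) w by simp
  have ynot: "y \<noteq> (x [^] p) [^] k" for k :: int
  proof
    assume k: "y = (x [^] p) [^] k"
    have "\<not> int p dvd k" using int_pow_prime_eq_one[OF xc prime_p xpp x(2)] y(3) k by simp
    then obtain m where "x [^] p = y [^] (m::int)"
      using pow_coprime_root[OF prime_p xc xpp] k by blast
    then show False using subgroup_int_pow[OF subW y(1), of m] xW by simp
  qed
  have "realizes G (fam2 p 0 0 1 0 0)"
    using realizes_fam2_class2[OF x xpp y(2) Zp[OF y(2)] ynot b(1), of 0 1 0]
      b(3) bp y Zp[OF y(2)] by (simp add: y_def)
  moreover have "fam2 p 0 0 1 0 0 \<in> set (ext_list p \<epsilon>)" by (auto simp: fam2_def ext_list_def)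
  ultimately show ?thesis by blast
qed

lemma realizes_class2: "\<exists>T\<in>set (ext_list p \<epsilon>). realizes G T"
proof (cases "\<exists>z\<in>center. z [^] p \<noteq> \<one>")
  case True
  then show ?thesis by (rule realizes_center_cyclic)
next
  case False
  then have Zp: "\<And>z. z \<in> center \<Longrightarrow> z [^] p = \<one>" by blast
  consider "\<forall>g\<in>carrier G. g [^] p = \<one>"
    | x where "x \<in> carrier G" "x [^] p \<noteq> \<one>" "x [^] p \<in> W"
    | x where "x \<in> carrier G" "x [^] p \<noteq> \<one>" "\<And>g. g \<in> carrier G \<Longrightarrow> g [^] p \<in> W \<Longrightarrow> g [^] p = \<one>"
    by blast
  then show ?thesis
  proof cases
    case 1
    obtain g h where g: "g \<in> carrier G" and h: "h \<in> carrier G" and gh: "cmt h g \<noteq> \<one>"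
      using exists_noncommuting by blast
    obtain t where t: "t \<in> center" "t \<notin> W" using center_not_W by blast
    have "t \<noteq> cmt h g [^] k" for k :: int using t(2) subgroup_int_pow[OF subW cmt_in_W[OF h g]] by metis
    then have "realizes G (fam3 p 0 0)"
      using realizes_exponent_p[OF g _ h _ cmt_central[OF h g] gh cmt_pow_p[OF h g] t(1)] 1 t g h center_closed by simp
    moreover have "fam3 p 0 0 \<in> set (ext_list p \<epsilon>)" by (auto simp: fam3_def ext_list_def)
    ultimately show ?thesis by blast
  next
    case 2
    show ?thesis by (rule realizes_power_in_W[OF Zp 2])
  next
    case 3
    show ?thesis by (rule realizes_power_outside_W[OF Zp 3])
  qed
qed

end

theorem realizes_some_type:
  fixes G (structure)
  assumes "nonabelian_group_of_order (p ^ 4) G" "prime p" "odd p" "\<not> QuadRes (int p) \<epsilon>"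
  shows "\<exists>T\<in>set (ext_list p \<epsilon>). realizes G T"
proof -
  interpret group G using assms(1) by (simp add: nonabelian_group_of_order_def)
  have G: "order G = p ^ 4" "\<not> comm_group G"
    using assms(1) by (simp_all add: nonabelian_group_of_order_def)
  obtain N where N: "subgroup N G" "card N = p ^ 3" "\<And>x y. x \<in> N \<Longrightarrow> y \<in> N \<Longrightarrow> x \<otimes> y = y \<otimes> x"
    using exists_abelian_subgroup[OF assms(2) G] by blast
  interpret nonabelian_p4 G N p
    by (intro nonabelian_p4.intro nonabelian_p4_axioms.intro) (fact is_group assms(2,3) G N)+
  obtain a where a: "a \<in> carrier G" "a \<notin> N" using exists_outside by blast
  show ?thesis
  proof (cases rule: class_cases[OF a])
    case 1
    interpret A: abelian_prime_index G N a p by (rule abelian_prime_index_outside[OF a])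
    interpret class2_p4 G N p "cmt a ` N"
    proof (intro class2_p4.intro class2_p4_axioms.intro)
      show "nonabelian_p4 G N p" by unfold_locales
      show "subgroup (cmt a ` N) G" by (rule A.image_subgroup)
      show "cmt a ` N \<subseteq> center" using 1(3) A.D_closed in_center_iff[OF a] by auto
      show "cmt g h \<in> cmt a ` N" if "g \<in> carrier G" "h \<in> carrier G" for g h
        by (rule A.commutator_in_image[OF that])
    qed (fact 1(1,2))+
    show ?thesis by (rule realizes_class2)
  next
    case 2
    then obtain x where "x \<in> N" "cmt a (cmt a x) \<noteq> \<one>" by blast
    then show ?thesis using realizes_max[OF a 2(1,2)] assms(4) by blast
  qed
qed

section \<open>Invariants\<close>

context group
begin

text \<open>In class three this is the abelian subgroup \<open>N\<close> of every realization, which is thereby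
  determined by the group.\<close>

definition commutators_centralizer :: "'a set" where
  "commutators_centralizer =
     {g \<in> carrier G. \<forall>h\<in>carrier G. \<forall>k\<in>carrier G. g \<otimes> cmt h k = cmt h k \<otimes> g}"

text \<open>The tests mention only the group, and each is decided by computing in one realization. The first
  separates class two from class three. Then the \<open>p\<close>-th powers are compared with the commutators in
  class two; in class three the exponents of \<open>N\<close> and of its complement are examined, and type 6 is
  singled out by the square class of the factor relating the double commutator to the \<open>p\<close>-th power.
  The values are positions in the list of types, where 8 is reserved for \<open>p = 3\<close>.\<close>

definition type_index :: "nat \<Rightarrow> nat" where
  "type_index p =
    (if \<forall>g\<in>carrier G. \<forall>h\<in>carrier G. cmt g (cmt g h) = \<one> then
       if \<exists>z\<in>center. z [^] p \<noteq> \<one> then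
         if \<forall>g\<in>carrier G. (g [^] p) [^] p = \<one> then 1 else 2
       else if \<forall>g\<in>carrier G. g [^] p = \<one> then 9
       else if \<forall>g\<in>carrier G. \<forall>h\<in>carrier G. \<forall>k\<in>carrier G. g [^] p = cmt h k \<longrightarrow> g [^] p = \<one> then 5
       else if \<forall>g\<in>carrier G. \<exists>h\<in>carrier G. \<exists>k\<in>carrier G. g [^] p = cmt h k then 3 else 4
     else if \<forall>g\<in>commutators_centralizer. g [^] p = \<one> then
       if p = 3 \<or> (\<forall>g\<in>carrier G. g [^] p = \<one>) then 10 else 11
     else if \<exists>g\<in>carrier G. \<exists>x\<in>commutators_centralizer. cmt g (cmt g x) = x [^] p \<and> x [^] p \<noteq> \<one> then 6
     else if p = 3 \<and> (\<exists>g\<in>carrier G. g \<notin> commutators_centralizer \<and> g [^] p \<noteq> \<one>) then 8 else 7)"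

end

lemma presents_imp_abelian_prime_index:
  assumes "group G" "comm_group M" "prime p" "odd p" "presents G (M, p, \<tau>, v) \<phi> a"
    and "\<tau> \<in> carrier M \<rightarrow> carrier M" "v \<in> carrier M"
  shows "abelian_prime_index G (\<phi> ` carrier M) a p"
proof -
  interpret group G by fact
  interpret M: comm_group M by fact
  from assms(5) have hom: "\<phi> \<in> hom M G" and inj: "inj_on \<phi> (carrier M)" and a: "a \<in> carrier G"
    and pw: "a [^]\<^bsub>G\<^esub> p = \<phi> v"
    and step: "\<And>u. u \<in> carrier M \<Longrightarrow> a \<otimes>\<^bsub>G\<^esub> \<phi> u = \<phi> (\<tau> u) \<otimes>\<^bsub>G\<^esub> a"
    and dec: "\<And>g. g \<in> carrier G \<Longrightarrow> \<exists>u\<in>carrier M. \<exists>k<p. g = \<phi> u \<otimes>\<^bsub>G\<^esub> a [^]\<^bsub>G\<^esub> k"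
    and zero: "\<And>k. k < p \<Longrightarrow> a [^]\<^bsub>G\<^esub> k \<in> \<phi> ` carrier M \<Longrightarrow> k = 0"
    by (auto simp: presents_def)
  interpret \<phi>: group_hom M G \<phi>
    using hom by (simp add: group_hom_def group_hom_axioms_def M.is_group is_group)
  show ?thesis
  proof (intro abelian_prime_index.intro abelian_prime_index_axioms.intro)
    show "group G" by (rule is_group)
    show "subgroup (\<phi> ` carrier M) G" by (rule \<phi>.img_is_subgroup)
    show "x \<otimes>\<^bsub>G\<^esub> y = y \<otimes>\<^bsub>G\<^esub> x" if xy: "x \<in> \<phi> ` carrier M" "y \<in> \<phi> ` carrier M" for x y
    proof -
      obtain u w where "u \<in> carrier M" "x = \<phi> u" "w \<in> carrier M" "y = \<phi> w" using xy by blast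
      then show ?thesis using M.m_comm[of u w] \<phi>.hom_mult[of u w] \<phi>.hom_mult[of w u] by simp
    qed
    show "prime p" "odd p" "a \<in> carrier G" by (fact assms a)+
    show "a \<notin> \<phi> ` carrier M" using zero[of 1] a prime_gt_1_nat[OF assms(3)] by auto
    show "a \<otimes>\<^bsub>G\<^esub> x \<otimes>\<^bsub>G\<^esub> inv\<^bsub>G\<^esub> a \<in> \<phi> ` carrier M" if x: "x \<in> \<phi> ` carrier M" for x
    proof -
      obtain u where u: "u \<in> carrier M" "x = \<phi> u" using x by blast
      then have \<tau>: "\<tau> u \<in> carrier M" using assms(6) by blast
      have "a \<otimes>\<^bsub>G\<^esub> x \<otimes>\<^bsub>G\<^esub> inv\<^bsub>G\<^esub> a = \<phi> (\<tau> u)"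
        unfolding u(2) step[OF u(1)] using a \<tau> by (simp add: m_assoc)
      then show ?thesis using \<tau> by simp
    qed
    show "a [^]\<^bsub>G\<^esub> p \<in> \<phi> ` carrier M" using pw assms(7) by simp
    show "\<exists>x\<in>\<phi> ` carrier M. \<exists>k. g = x \<otimes>\<^bsub>G\<^esub> a [^]\<^bsub>G\<^esub> (k::nat)" if "g \<in> carrier G" for g
      using dec[OF that] by blast
  qed
qed

lemma (in abelian_prime_index) commutators_centralizer_eq:
  assumes "x \<in> N" "D (D x) \<noteq> \<one>"
  shows "commutators_centralizer = N"
proof
  show "N \<subseteq> commutators_centralizer"
  proof
    fix y assume y: "y \<in> N"
    have "y \<otimes> cmt h k = cmt h k \<otimes> y" if "h \<in> carrier G" "k \<in> carrier G" for h k
    proof -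
      have "cmt h k \<in> N" using commutator_in_image[OF that] D_closed by auto
      then show ?thesis using comm y by blast
    qed
    then show "y \<in> commutators_centralizer" using N_closed[OF y] by (simp add: commutators_centralizer_def)
  qed
  show "commutators_centralizer \<subseteq> N"
  proof
    fix g assume "g \<in> commutators_centralizer"
    then have "g \<in> carrier G" "g \<otimes> D x = D x \<otimes> g"
      using a_closed N_closed[OF assms(1)] by (simp_all add: commutators_centralizer_def)
    then show "g \<in> N" using commutes_outside[OF D_closed[OF assms(1)]] assms(2) by blast
  qed
qed

lemma (in abelian_prime_index) two_engel:
  assumes "\<And>x. x \<in> N \<Longrightarrow> D (D x) = \<one>" "g \<in> carrier G" "h \<in> carrier G"
  shows "cmt g (cmt g h) = \<one>"
proof -
  obtain x where x: "x \<in> N" "cmt g h = D x" using commutator_in_image[OF assms(2,3)] by blast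
  have "g \<otimes> D x = D x \<otimes> g" using D_one_central[OF D_closed[OF x(1)] assms(1)[OF x(1)] assms(2)] .
  then show ?thesis using x cmt_eq_one_iff[of g "D x"] assms(2) N_closed[OF D_closed[OF x(1)]] by simp
qed

subsection \<open>Realizations over \<open>C\<^bsub>p\<^sup>2\<^esub> \<times> C\<^sub>p\<close>\<close>

text \<open>The element \<open>E i j\<close> corresponds to the column with entries \<open>i\<close>, \<open>j\<close>. Taking arbitrary integers
  as arguments turns computations in \<open>N\<close> into divisibility of integer polynomials.\<close>

locale realization2 = abelian_prime_index +
  fixes E :: "int \<Rightarrow> int \<Rightarrow> 'a" and \<alpha> \<beta> \<gamma> c d :: int
  assumes E_mult: "E i j \<otimes> E i' j' = E (i + i') (j + j')"
    and E_one_iff: "E i j = \<one> \<longleftrightarrow> int p ^ 2 dvd i \<and> int p dvd j"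
    and N_eq: "N = {E i j |i j. True}"
    and D_E: "cmt a (E i j) = E (int p * (\<alpha> * i + \<beta> * j)) (\<gamma> * i)"
    and a_pow: "a [^] p = E c d"
begin

lemma E_in: "E i j \<in> N" using N_eq by blast

lemma E_closed: "E i j \<in> carrier G" using N_closed[OF E_in] .

lemma E_0: "E 0 0 = \<one>" by (simp add: E_one_iff)

lemma E_eq_iff: "E i j = E i' j' \<longleftrightarrow> int p ^ 2 dvd i - i' \<and> int p dvd j - j'"
proof -
  have "E i j = E (i - i') (j - j') \<otimes> E i' j'" by (simp add: E_mult)
  then show ?thesis using E_one_iff[of "i - i'" "j - j'"] E_closed by auto
qed

lemma E_nat_pow: "E i j [^] (k::nat) = E (int k * i) (int k * j)"
  by (induction k) (auto simp: E_0 E_mult algebra_simps)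

lemma E_int_pow: "E i j [^] (k::int) = E (k * i) (k * j)"
proof (cases k rule: int_cases2)
  case (nonneg n)
  then show ?thesis by (simp add: int_pow_int E_nat_pow)
next
  case (nonpos n)
  have "inv (E (int n * i) (int n * j)) = E (- (int n * i)) (- (int n * j))"
    by (rule inv_equality) (simp_all add: E_mult E_0 E_closed)
  then show ?thesis using nonpos by (simp add: int_pow_neg_int E_closed E_nat_pow)
qed

lemma E_pow_p: "E i j [^] p = E (int p * i) 0"
  unfolding E_nat_pow E_eq_iff by simp

lemma DD_E: "cmt a (cmt a (E i j)) = E (int p * (\<beta> * \<gamma> * i)) 0"
  unfolding D_E E_eq_iff by (simp add: algebra_simps power2_eq_square)

lemma DDD_E: "cmt a (cmt a (cmt a (E i j))) = \<one>"
  unfolding DD_E unfolding D_E E_one_iff by (simp add: power2_eq_square)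

lemma pow_p: "(E i j \<otimes> a [^] k) [^] p =
    E (int p * (i + \<beta> * \<gamma> * i * (int k ^ 2 * int (p choose 3))) + int k * c) (int k * d)"
  unfolding pow_p_formula[OF E_in DDD_E] DD_E a_pow E_int_pow E_nat_pow E_mult E_eq_iff
  by (simp add: algebra_simps)

lemma normal_form: "g \<in> carrier G \<Longrightarrow> \<exists>i j k. g = E i j \<otimes> a [^] (k::nat)"
  using decomp[of g] N_eq by blast

lemma cmt_elements: "g \<in> carrier G \<Longrightarrow> h \<in> carrier G \<Longrightarrow>
    \<exists>i j. cmt g h = E (int p * (\<alpha> * i + \<beta> * j)) (\<gamma> * i)"
  using commutator_in_image[of g h] N_eq D_E by fastforce

lemma p_gt: "1 < int p" using prime_gt_1_nat[OF prime_p] by simp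

lemma not_sq_dvd_p: "\<not> int p ^ 2 dvd int p"
proof
  assume "int p ^ 2 dvd int p"
  then have "int p ^ 2 \<le> int p" using p_gt by (intro zdvd_imp_le) auto
  then show False using p_gt by (simp add: power2_eq_square)
qed

lemma sq_dvd_mult_p: "int p ^ 2 dvd int p * i \<longleftrightarrow> int p dvd i"
  using p_gt by (simp add: power2_eq_square)

lemma center_eq_E:
  assumes "E i j \<in> N" "cmt a (E i j) \<noteq> \<one>"
  shows "center = {E i j |i j. int p dvd \<alpha> * i + \<beta> * j \<and> int p dvd \<gamma> * i}"
  unfolding center_eq[OF assms] using N_eq by (auto simp: D_E E_one_iff sq_dvd_mult_p) blast

lemma not_p_dvd_1: "\<not> int p dvd 1" using p_gt by (auto dest: zdvd_imp_le)

lemma all_class2: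
  assumes "\<beta> * \<gamma> = 0"
  shows "\<forall>g\<in>carrier G. \<forall>h\<in>carrier G. cmt g (cmt g h) = \<one>"
proof -
  have "cmt a (cmt a x) = \<one>" if "x \<in> N" for x
    using that N_eq DD_E assms by (auto simp: E_0)
  then show ?thesis using two_engel by blast
qed

lemma index_1:
  assumes "\<alpha> = 0" "\<beta> = 1" "\<gamma> = 0" "c = 0" "d = 0" shows "type_index p = 1"
proof -
  have "center = {E i j |i j. int p dvd j}"
    using center_eq_E[OF E_in, of 0 1] assms by (simp add: D_E E_one_iff not_sq_dvd_p)
  then have "\<exists>z\<in>center. z [^] p \<noteq> \<one>"
    by (intro bexI[of _ "E 1 0"]) (auto simp: E_pow_p E_one_iff not_sq_dvd_p)
  moreover have "(g [^] p) [^] p = \<one>" if "g \<in> carrier G" for g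
    using normal_form[OF that] assms by (auto simp: pow_p E_pow_p E_one_iff power2_eq_square)
  ultimately show ?thesis using all_class2 assms by (simp add: type_index_def)
qed

lemma index_2:
  assumes "\<alpha> = 0" "\<beta> = 1" "\<gamma> = 0" "c = 1" "d = 0" shows "type_index p = 2"
proof -
  have "center = {E i j |i j. int p dvd j}"
    using center_eq_E[OF E_in, of 0 1] assms by (simp add: D_E E_one_iff not_sq_dvd_p)
  then have "\<exists>z\<in>center. z [^] p \<noteq> \<one>"
    by (intro bexI[of _ "E 1 0"]) (auto simp: E_pow_p E_one_iff not_sq_dvd_p)
  moreover have "(a [^] p) [^] p \<noteq> \<one>" using assms by (simp add: a_pow E_pow_p E_one_iff not_sq_dvd_p)
  ultimately show ?thesis using all_class2 assms a_closed by (auto simp: type_index_def)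
qed

lemma elementary_center:
  assumes "\<beta> = 0" "int p dvd \<gamma> - 1 \<or> int p dvd \<alpha> - 1"
  shows "\<not> (\<exists>z\<in>center. z [^] p \<noteq> \<one>)" and "\<not> (\<forall>g\<in>carrier G. g [^] p = \<one>)"
proof -
  have nd: "\<not> (int p dvd \<alpha> \<and> int p dvd \<gamma>)"
    using assms(2) not_p_dvd_1 dvd_diff_right_iff by (metis dvd_diff_commute)
  then have "cmt a (E 1 0) \<noteq> \<one>" using assms by (simp add: D_E E_one_iff sq_dvd_mult_p)
  note Z = center_eq_E[OF E_in this]
  have "z [^] p = \<one>" if z: "z \<in> center" for z
  proof -
    obtain i j where ij: "z = E i j" "int p dvd \<alpha> * i" "int p dvd \<gamma> * i" using z assms Z by auto
    have "prime (int p)" using prime_p by simp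
    then have "int p dvd i" using ij nd by (auto simp: prime_dvd_mult_iff)
    then show ?thesis by (simp add: ij E_pow_p E_one_iff sq_dvd_mult_p)
  qed
  then show "\<not> (\<exists>z\<in>center. z [^] p \<noteq> \<one>)" by blast
  have "E 1 0 [^] p \<noteq> \<one>" by (simp add: E_pow_p E_one_iff not_sq_dvd_p)
  then show "\<not> (\<forall>g\<in>carrier G. g [^] p = \<one>)" using E_closed by blast
qed

lemma index_3_4:
  assumes "\<alpha> = 1" "\<beta> = 0" "\<gamma> = 0" "c = 0"
  shows "d = 0 \<Longrightarrow> type_index p = 3" and "d = 1 \<Longrightarrow> type_index p = 4"
proof -
  have D: "cmt a (E i j) = E (int p * i) 0" for i j using assms D_E by simp
  have "E 1 0 [^] p = cmt a (E 1 0)" "E 1 0 [^] p \<noteq> \<one>"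
    using D by (simp_all add: E_pow_p E_one_iff not_sq_dvd_p)
  then have n5: "\<not> (\<forall>g\<in>carrier G. \<forall>h\<in>carrier G. \<forall>k\<in>carrier G. g [^] p = cmt h k \<longrightarrow> g [^] p = \<one>)"
    using E_closed a_closed by blast
  have 0: "\<forall>g\<in>carrier G. \<forall>h\<in>carrier G. cmt g (cmt g h) = \<one>" using all_class2 assms by simp
  note nc = elementary_center[OF assms(2)]
  show "type_index p = 3" if "d = 0"
  proof -
    have "\<exists>h\<in>carrier G. \<exists>k\<in>carrier G. g [^] p = cmt h k" if g: "g \<in> carrier G" for g
    proof -
      obtain i j k where "g = E i j \<otimes> a [^] (k::nat)" using normal_form[OF g] by blast
      then have "g [^] p = cmt a (E i 0)" using D assms \<open>d = 0\<close> by (simp add: pow_p)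
      then show ?thesis using a_closed E_closed by blast
    qed
    then show ?thesis unfolding type_index_def using 0 nc n5 assms by simp
  qed
  show "type_index p = 4" if "d = 1"
  proof -
    have "a [^] p \<noteq> cmt h k" if hk: "h \<in> carrier G" "k \<in> carrier G" for h k
      using cmt_elements[OF hk] assms \<open>d = 1\<close> not_p_dvd_1 by (auto simp: a_pow E_eq_iff)
    then have "\<not> (\<forall>g\<in>carrier G. \<exists>h\<in>carrier G. \<exists>k\<in>carrier G. g [^] p = cmt h k)" using a_closed by blast
    then show ?thesis unfolding type_index_def using 0 nc n5 assms by simp
  qed
qed

lemma index_5:
  assumes "\<alpha> = 0" "\<beta> = 0" "\<gamma> = 1" "c = 0" "d = 0" shows "type_index p = 5"
proof -
  have "g [^] p = \<one>" if ghk: "g \<in> carrier G" "h \<in> carrier G" "k \<in> carrier G" "g [^] p = cmt h k" for g h k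
  proof -
    obtain i j m where g: "g = E i j \<otimes> a [^] (m::nat)" using normal_form[OF ghk(1)] by blast
    then have "g [^] p = E (int p * i) 0" using assms by (simp add: pow_p)
    moreover obtain i' where "cmt h k = E 0 i'" using cmt_elements[OF ghk(2,3)] assms by auto
    ultimately show ?thesis using ghk(4) by (auto simp: E_eq_iff E_one_iff)
  qed
  then have "\<forall>g\<in>carrier G. \<forall>h\<in>carrier G. \<forall>k\<in>carrier G. g [^] p = cmt h k \<longrightarrow> g [^] p = \<one>" by blast
  then show ?thesis unfolding type_index_def using all_class2 elementary_center[OF assms(2)] assms by simp
qed

text \<open>The double commutator of \<open>x\<close> with an element of the coset of \<open>a\<^sup>k\<close> is \<open>x\<^sup>p\<close> to the power \<open>\<beta> k\<^sup>2\<close>, so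
  it can equal \<open>x\<^sup>p \<noteq> 1\<close> only if \<open>\<beta>\<close> is a square. For \<open>p = 3\<close> and \<open>\<beta> = -1\<close> modulo \<open>3\<close> the norm of
  \<open>\<tau>\<^sup>k\<close> vanishes, so the cube of an element in the coset of \<open>a\<^sup>k\<close> is \<open>v\<^sup>k\<close>.\<close>

lemma index_6_7_8:
  assumes "\<alpha> = 0" "\<gamma> = 1" "\<not> int p dvd \<beta>" "c = 0 \<or> c = int p" "d = 0"
  shows "\<beta> = 1 \<Longrightarrow> type_index p = 6"
    and "\<not> QuadRes (int p) \<beta> \<Longrightarrow> c = 0 \<Longrightarrow> type_index p = 7"
    and "\<not> QuadRes (int p) \<beta> \<Longrightarrow> c = int p \<Longrightarrow> p = 3 \<Longrightarrow> type_index p = 8"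
proof -
  have DD: "cmt a (cmt a (E i j)) = E (int p * (\<beta> * i)) 0" for i j using assms DD_E by simp
  have DD1: "cmt a (cmt a (E 1 0)) \<noteq> \<one>" using assms by (simp add: DD E_one_iff sq_dvd_mult_p)
  then have 0: "\<not> (\<forall>g\<in>carrier G. \<forall>h\<in>carrier G. cmt g (cmt g h) = \<one>)" using a_closed E_closed by blast
  have C: "commutators_centralizer = N" by (rule commutators_centralizer_eq[OF E_in DD1])
  have E1: "E 1 0 [^] p \<noteq> \<one>" by (simp add: E_pow_p E_one_iff not_sq_dvd_p)
  then have 1: "\<not> (\<forall>g\<in>commutators_centralizer. g [^] p = \<one>)" unfolding C using E_in by blast
  show "type_index p = 6" if "\<beta> = 1"
  proof -
    have "cmt a (cmt a (E 1 0)) = E 1 0 [^] p" using that by (simp add: DD E_pow_p)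
    then have "\<exists>g\<in>carrier G. \<exists>x\<in>commutators_centralizer. cmt g (cmt g x) = x [^] p \<and> x [^] p \<noteq> \<one>"
      unfolding C using a_closed E_in E1 by blast
    then show ?thesis unfolding type_index_def using 0 1 by simp
  qed
  have n6: "\<not> (\<exists>g\<in>carrier G. \<exists>x\<in>commutators_centralizer. cmt g (cmt g x) = x [^] p \<and> x [^] p \<noteq> \<one>)"
    if nq: "\<not> QuadRes (int p) \<beta>"
  proof
    assume "\<exists>g\<in>carrier G. \<exists>x\<in>commutators_centralizer. cmt g (cmt g x) = x [^] p \<and> x [^] p \<noteq> \<one>"
    then obtain g x where gx: "g \<in> carrier G" "x \<in> N" "cmt g (cmt g x) = x [^] p" "x [^] p \<noteq> \<one>"
      unfolding C by blast
    obtain i j where x: "x = E i j" using gx(2) N_eq by blast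
    obtain y k where g: "y \<in> N" "g = y \<otimes> a [^] (k::nat)" using decomp[OF gx(1)] by blast
    have pr: "prime (int p)" using prime_p by simp
    have "cmt g (cmt g x) = E (int k ^ 2 * (int p * (\<beta> * i))) 0"
      unfolding x double_commutator_pow[OF E_in g(1) DDD_E g(2)] DD E_int_pow by simp
    then have "int p ^ 2 dvd int k ^ 2 * (int p * (\<beta> * i)) - int p * i"
      using gx(3) by (simp add: x E_pow_p E_eq_iff)
    also have "int k ^ 2 * (int p * (\<beta> * i)) - int p * i = int p * (i * (\<beta> * int k ^ 2 - 1))"
      by (simp add: algebra_simps)
    finally have "int p dvd i * (\<beta> * int k ^ 2 - 1)" by (simp add: sq_dvd_mult_p)
    moreover have "\<not> int p dvd i" using gx(4) by (simp add: x E_pow_p E_one_iff sq_dvd_mult_p)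
    ultimately have "int p dvd \<beta> * int k ^ 2 - 1" using pr by (simp add: prime_dvd_mult_iff)
    then have "int p dvd \<beta> * (\<beta> * int k ^ 2 - 1)" by simp
    then have "[(\<beta> * int k) ^ 2 = \<beta>] (mod int p)"
      by (simp add: cong_iff_dvd_diff power2_eq_square algebra_simps)
    then show False using nq unfolding QuadRes_def by blast
  qed
  show "type_index p = 8" if "\<not> QuadRes (int p) \<beta>" "c = int p" "p = 3"
  proof -
    have "a [^] p \<noteq> \<one>" using that(2) assms(5) by (simp add: a_pow E_one_iff not_sq_dvd_p)
    then have "\<exists>g\<in>carrier G. g \<notin> commutators_centralizer \<and> g [^] p \<noteq> \<one>"
      unfolding C using a_closed a_notin by blast
    then show ?thesis unfolding type_index_def using 0 1 n6 that by simp
  qed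
  show "type_index p = 7" if "\<not> QuadRes (int p) \<beta>" "c = 0"
  proof -
    have "g [^] p = \<one>" if g: "g \<in> carrier G" "g \<notin> N" and p3: "p = 3" for g
    proof -
      obtain i j k where gk: "g = E i j \<otimes> a [^] (k::nat)" using normal_form[OF g(1)] by blast
      have "\<not> p dvd k" using g gk a_pow_in_N N_mult E_in by blast
      then have k: "\<not> int 3 dvd int k" using p3 by (simp only: int_dvd_int_iff not_False_eq_True)
      have b: "int 3 dvd \<beta> - 2"
      proof -
        have "\<not> 3 dvd \<beta>" using assms(3) p3 by simp
        moreover have "\<not> 3 dvd \<beta> - 1"
        proof
          assume "3 dvd \<beta> - 1"
          then have "[1 ^ 2 = \<beta>] (mod int p)" using p3 by (simp add: cong_iff_dvd_diff dvd_diff_commute)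
          then show False using \<open>\<not> QuadRes (int p) \<beta>\<close> unfolding QuadRes_def by blast
        qed
        ultimately show ?thesis by presburger
      qed
      have "int 3 dvd int k ^ 2 - 1"
      proof -
        have "int k ^ 2 - 1 = (int k - 1) * (int k + 1)" by (simp add: power2_eq_square algebra_simps)
        moreover have "3 dvd int k - 1 \<or> 3 dvd int k + 1" using k by simp presburger
        ultimately show ?thesis by auto
      qed
      then obtain q where q: "int k ^ 2 = 3 * q + 1" by (metis add_diff_cancel_right' diff_add_cancel dvdE of_nat_numeral)
      obtain r where r: "\<beta> = 3 * r + 2" using b by (metis diff_eq_eq dvdE of_nat_numeral)
      have "1 + \<beta> * int k ^ 2 = 3 * (1 + r + 3 * r * q + 2 * q)" unfolding q r by (simp add: algebra_simps)
      then have "i + \<beta> * i * int k ^ 2 = 3 * (i * (1 + r + 3 * r * q + 2 * q))"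
        by (metis (no_types, opaque_lifting) distrib_left mult.assoc mult.commute mult.left_commute mult.right_neutral)
      then have "int p dvd i + \<beta> * i * int k ^ 2" using p3 by simp
      moreover have "p choose 3 = 1" using p3 by simp
      ultimately show ?thesis
        unfolding gk pow_p assms(2,5) \<open>c = 0\<close> by (simp add: E_one_iff sq_dvd_mult_p)
    qed
    then have "\<not> (p = 3 \<and> (\<exists>g\<in>carrier G. g \<notin> commutators_centralizer \<and> g [^] p \<noteq> \<one>))"
      unfolding C by blast
    then show ?thesis unfolding type_index_def using 0 1 n6 that by simp
  qed
qed

end

lemma realizes_fam2D:
  assumes "group G" "prime p" "odd p" "int p dvd \<alpha> * c + \<beta> * d" "int p dvd \<gamma> * c"
    and "realizes G (fam2 p \<alpha> \<beta> \<gamma> c d)"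
  shows "\<exists>N a E. realization2 G N a p E \<alpha> \<beta> \<gamma> c d"
proof -
  let ?N = "cyclic_prod [p^2, p]"
  interpret T: abelian_ext_type ?N p "tau2 p \<alpha> \<beta> \<gamma>" "col [p^2, p] [c, d]"
    by (rule abelian_ext_type_fam2) fact+
  interpret group G by fact
  have p: "0 < p" "0 < p^2" using assms by (auto simp: prime_gt_0_nat)
  have tcl: "tau2 p \<alpha> \<beta> \<gamma> \<in> carrier ?N \<rightarrow> carrier ?N"
    using T.tau_hom by (simp add: hom_def)
  obtain \<phi> a where pr: "presents G (?N, p, tau2 p \<alpha> \<beta> \<gamma>, col [p^2, p] [c, d]) \<phi> a"
    using realizes_imp_presents[OF assms(1) T.N.is_group p(1) tcl] assms(6)
    unfolding fam2_def mat_ext_def by blast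
  interpret A: abelian_prime_index G "\<phi> ` carrier ?N" a p
    by (rule presents_imp_abelian_prime_index[OF assms(1) T.N.comm_group_axioms assms(2,3) pr tcl T.v_closed])
  have cc: "col [p^2, p] l \<in> carrier ?N" for l
    using p by (intro col_closed) auto
  interpret \<phi>: group_hom ?N G \<phi>
    using pr by (simp add: group_hom_def group_hom_axioms_def is_group T.N.is_group presents_def)
  have inj: "inj_on \<phi> (carrier ?N)" using pr by (simp add: presents_def)
  define E where "E = (\<lambda>i j. \<phi> (col [p^2, p] [i, j]))"
  have E_mult: "E i j \<otimes>\<^bsub>G\<^esub> E i' j' = E (i + i') (j + j')" for i j i' j'
    using cc by (simp add: E_def col2_mult[symmetric])
  have E_in: "E i j \<in> \<phi> ` carrier ?N" for i j using cc by (simp add: E_def)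
  have "realization2 G (\<phi> ` carrier ?N) a p E \<alpha> \<beta> \<gamma> c d"
  proof (unfold_locales)
    show "E i j \<otimes>\<^bsub>G\<^esub> E i' j' = E (i + i') (j + j')" for i j i' j' by (rule E_mult)
    show "E i j = \<one>\<^bsub>G\<^esub> \<longleftrightarrow> int p ^ 2 dvd i \<and> int p dvd j" for i j
    proof -
      have "E i j = \<one>\<^bsub>G\<^esub> \<longleftrightarrow> col [p^2, p] [i, j] = \<one>\<^bsub>?N\<^esub>"
        using inj_on_eq_iff[OF inj cc T.N.one_closed] by (simp add: E_def)
      then show ?thesis unfolding one_cyclic_prod col2_eq_iff by simp
    qed
    show "\<phi> ` carrier ?N = {E i j |i j. True}"
    proof
      show "\<phi> ` carrier ?N \<subseteq> {E i j |i j. True}"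
      proof
        fix x assume "x \<in> \<phi> ` carrier ?N"
        then obtain u where "u \<in> carrier ?N" "x = \<phi> u" by (rule imageE) blast
        then have "x = E (u 0) (u 1)" using col2_cases[OF _ p(2,1), of u] unfolding E_def by simp
        then show "x \<in> {E i j |i j. True}" by blast
      qed
    qed (use E_in in blast)
    show "a [^]\<^bsub>G\<^esub> p = E c d" using pr by (simp add: presents_def E_def)
    show "cmt a (E i j) = E (int p * (\<alpha> * i + \<beta> * j)) (\<gamma> * i)" for i j
    proof (rule A.D_eqI[OF E_in E_in])
      have "a \<otimes>\<^bsub>G\<^esub> E i j = \<phi> (tau2 p \<alpha> \<beta> \<gamma> (col [p^2, p] [i, j])) \<otimes>\<^bsub>G\<^esub> a"
        using pr cc by (simp add: presents_def E_def)
      then show "a \<otimes>\<^bsub>G\<^esub> E i j = E i j \<otimes>\<^bsub>G\<^esub> E (int p * (\<alpha> * i + \<beta> * j)) (\<gamma> * i) \<otimes>\<^bsub>G\<^esub> a"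
        unfolding tau2_col[OF p(1)] E_mult by (simp add: E_def)
    qed
  qed
  then show ?thesis by blast
qed

subsection \<open>Realizations over the elementary abelian group\<close>

locale realization3 = abelian_prime_index +
  fixes E :: "int \<Rightarrow> int \<Rightarrow> int \<Rightarrow> 'a" and \<gamma> c :: int
  assumes E_mult: "E i j l \<otimes> E i' j' l' = E (i + i') (j + j') (l + l')"
    and E_one_iff: "E i j l = \<one> \<longleftrightarrow> int p dvd i \<and> int p dvd j \<and> int p dvd l"
    and N_eq: "N = {E i j l |i j l. True}"
    and D_E: "cmt a (E i j l) = E j (\<gamma> * l) 0"
    and a_pow: "a [^] p = E c 0 0"
begin

lemma E_in: "E i j l \<in> N" using N_eq by blast

lemma E_closed: "E i j l \<in> carrier G" using N_closed[OF E_in] .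

lemma E_0: "E 0 0 0 = \<one>" by (simp add: E_one_iff)

lemma E_nat_pow: "E i j l [^] (k::nat) = E (int k * i) (int k * j) (int k * l)"
  by (induction k) (auto simp: E_0 E_mult algebra_simps)

lemma N_pow_p: "x \<in> N \<Longrightarrow> x [^] p = \<one>"
  using N_eq by (auto simp: E_nat_pow E_one_iff)

lemma DD_E: "cmt a (cmt a (E i j l)) = E (\<gamma> * l) 0 0"
  unfolding D_E by simp

lemma DDD: "x \<in> N \<Longrightarrow> cmt a (cmt a (cmt a x)) = \<one>"
  using N_eq by (auto simp: D_E E_0)

lemma not_p_dvd_1: "\<not> int p dvd 1" using prime_gt_1_nat[OF prime_p] by (auto dest: zdvd_imp_le)

lemma exponent_p:
  assumes "c = 0" "\<gamma> = 0 \<or> p \<noteq> 3" "g \<in> carrier G" shows "g [^] p = \<one>"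
proof -
  obtain x k where x: "x \<in> N" "g = x \<otimes> a [^] (k::nat)" using decomp[OF assms(3)] by blast
  have xc: "cmt a (cmt a x) \<in> N" using x D_closed by blast
  have "cmt a (cmt a x) [^] (int k ^ 2 * int (p choose 3)) = \<one>"
  proof (cases "p = 3")
    case True
    then have "cmt a (cmt a x) = \<one>" using assms(2) x(1) N_eq by (auto simp: DD_E E_0)
    then show ?thesis by simp
  next
    case False
    then have "int p dvd int k ^ 2 * int (p choose 3)" using prime_dvd_choose_3[OF prime_p odd_p] by simp
    then show ?thesis using pow_dvd_one[OF N_closed[OF xc] N_pow_p[OF xc]] by blast
  qed
  then show ?thesis
    unfolding x(2) pow_p_formula[OF x(1) DDD[OF x(1)]] a_pow
    using assms(1) N_pow_p[OF x(1)] by (simp add: E_0)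
qed

lemma index_9:
  assumes "\<gamma> = 0" "c = 0" shows "type_index p = 9"
proof -
  have "cmt a (cmt a x) = \<one>" if "x \<in> N" for x
    using that N_eq DD_E assms by (auto simp: E_0)
  then have "\<forall>g\<in>carrier G. \<forall>h\<in>carrier G. cmt g (cmt g h) = \<one>" using two_engel by blast
  moreover have e: "\<forall>g\<in>carrier G. g [^] p = \<one>" using exponent_p assms by blast
  moreover have "\<not> (\<exists>z\<in>center. z [^] p \<noteq> \<one>)" using e center_closed by blast
  ultimately show ?thesis unfolding type_index_def by simp
qed

lemma index_10_11:
  assumes "\<gamma> = 1"
  shows "c = 0 \<Longrightarrow> type_index p = 10" and "c = 1 \<Longrightarrow> p \<noteq> 3 \<Longrightarrow> type_index p = 11"
proof -
  have DD1: "cmt a (cmt a (E 0 0 1)) \<noteq> \<one>" using assms not_p_dvd_1 by (simp add: DD_E E_one_iff)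
  then have 0: "\<not> (\<forall>g\<in>carrier G. \<forall>h\<in>carrier G. cmt g (cmt g h) = \<one>)" using a_closed E_closed by blast
  have C: "commutators_centralizer = N" by (rule commutators_centralizer_eq[OF E_in DD1])
  have 1: "\<forall>g\<in>commutators_centralizer. g [^] p = \<one>" unfolding C using N_pow_p by blast
  show "type_index p = 10" if "c = 0"
  proof -
    have "p = 3 \<or> (\<forall>g\<in>carrier G. g [^] p = \<one>)" using exponent_p[OF that] by blast
    then show ?thesis unfolding type_index_def using 0 1 by simp
  qed
  show "type_index p = 11" if "c = 1" "p \<noteq> 3"
  proof -
    have "a [^] p \<noteq> \<one>" using that not_p_dvd_1 by (simp add: a_pow E_one_iff)
    then have "\<not> (p = 3 \<or> (\<forall>g\<in>carrier G. g [^] p = \<one>))" using a_closed that by blast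
    then show ?thesis unfolding type_index_def using 0 1 by simp
  qed
qed

end

lemma realizes_fam3D:
  assumes "group G" "prime p" "odd p" "realizes G (fam3 p \<gamma> c)"
  shows "\<exists>N a E. realization3 G N a p E \<gamma> c"
proof -
  let ?N = "cyclic_prod [p, p, p]"
  interpret T: abelian_ext_type ?N p "tau3 p \<gamma>" "col [p, p, p] [c, 0, 0]"
    by (rule abelian_ext_type_fam3) fact+
  interpret group G by fact
  have p: "0 < p" using assms by (auto simp: prime_gt_0_nat)
  have tcl: "tau3 p \<gamma> \<in> carrier ?N \<rightarrow> carrier ?N"
    using T.tau_hom by (simp add: hom_def)
  obtain \<phi> a where pr: "presents G (?N, p, tau3 p \<gamma>, col [p, p, p] [c, 0, 0]) \<phi> a"
    using realizes_imp_presents[OF assms(1) T.N.is_group p(1) tcl] assms(4)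
    unfolding fam3_def mat_ext_def by blast
  interpret A: abelian_prime_index G "\<phi> ` carrier ?N" a p
    by (rule presents_imp_abelian_prime_index[OF assms(1) T.N.comm_group_axioms assms(2,3) pr tcl T.v_closed])
  have cc: "col [p, p, p] l \<in> carrier ?N" for l
    using p by (intro col_closed) auto
  interpret \<phi>: group_hom ?N G \<phi>
    using pr by (simp add: group_hom_def group_hom_axioms_def is_group T.N.is_group presents_def)
  have inj: "inj_on \<phi> (carrier ?N)" using pr by (simp add: presents_def)
  define E where "E = (\<lambda>i j l. \<phi> (col [p, p, p] [i, j, l]))"
  have E_mult: "E i j l \<otimes>\<^bsub>G\<^esub> E i' j' l' = E (i + i') (j + j') (l + l')" for i j l i' j' l'
    using cc by (simp add: E_def col3_mult[symmetric])
  have E_in: "E i j l \<in> \<phi> ` carrier ?N" for i j l using cc by (simp add: E_def)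
  have "realization3 G (\<phi> ` carrier ?N) a p E \<gamma> c"
  proof (unfold_locales)
    show "E i j l \<otimes>\<^bsub>G\<^esub> E i' j' l' = E (i + i') (j + j') (l + l')" for i j l i' j' l' by (rule E_mult)
    show "E i j l = \<one>\<^bsub>G\<^esub> \<longleftrightarrow> int p dvd i \<and> int p dvd j \<and> int p dvd l" for i j l
    proof -
      have "E i j l = \<one>\<^bsub>G\<^esub> \<longleftrightarrow> col [p, p, p] [i, j, l] = \<one>\<^bsub>?N\<^esub>"
        using inj_on_eq_iff[OF inj cc T.N.one_closed] by (simp add: E_def)
      then show ?thesis unfolding one_cyclic_prod col3_eq_iff by simp
    qed
    show "\<phi> ` carrier ?N = {E i j l |i j l. True}"
    proof
      show "\<phi> ` carrier ?N \<subseteq> {E i j l |i j l. True}"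
      proof
        fix x assume "x \<in> \<phi> ` carrier ?N"
        then obtain u where "u \<in> carrier ?N" "x = \<phi> u" by (rule imageE) blast
        then have "x = E (u 0) (u 1) (u 2)" using col3_cases[OF _ p p p, of u] unfolding E_def by simp
        then show "x \<in> {E i j l |i j l. True}" by blast
      qed
    qed (use E_in in blast)
    show "a [^]\<^bsub>G\<^esub> p = E c 0 0" using pr by (simp add: presents_def E_def)
    show "cmt a (E i j l) = E j (\<gamma> * l) 0" for i j l
    proof (rule A.D_eqI[OF E_in E_in])
      have "a \<otimes>\<^bsub>G\<^esub> E i j l = \<phi> (tau3 p \<gamma> (col [p, p, p] [i, j, l])) \<otimes>\<^bsub>G\<^esub> a"
        using pr cc by (simp add: presents_def E_def)
      then show "a \<otimes>\<^bsub>G\<^esub> E i j l = E i j l \<otimes>\<^bsub>G\<^esub> E j (\<gamma> * l) 0 \<otimes>\<^bsub>G\<^esub> a"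
        unfolding tau3_col[OF p] E_mult by (simp add: E_def)
    qed
  qed
  then show ?thesis by blast
qed

section \<open>The list of types\<close>

text \<open>The numbering does not depend on \<open>p\<close>, so that it can be compared with \<open>type_index\<close>; the entries
  8 and 11 are used only for some \<open>p\<close>.\<close>

definition listed_type :: "nat \<Rightarrow> int \<Rightarrow> nat \<Rightarrow> (nat \<Rightarrow> int) ext_data" where
  "listed_type p \<epsilon> k =
     [fam2 p 0 1 0 0 0, fam2 p 0 1 0 1 0, fam2 p 1 0 0 0 0, fam2 p 1 0 0 0 1, fam2 p 0 0 1 0 0,
      fam2 p 0 1 1 0 0, fam2 p 0 \<epsilon> 1 0 0, fam2 p 0 \<epsilon> 1 (int p) 0,
      fam3 p 0 0, fam3 p 1 0, fam3 p 1 1] ! (k - 1)"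

definition type_indices :: "nat \<Rightarrow> nat list" where
  "type_indices p =
     [1, 2, 3, 4, 5, 6, 7] @ (if p = 3 then [8] else []) @ [9, 10] @ (if p > 3 then [11] else [])"

lemma ext_list_eq: "ext_list p \<epsilon> = map (listed_type p \<epsilon>) (type_indices p)"
  by (simp add: ext_list_def type_indices_def listed_type_def fam2_def fam3_def eval_nat_numeral)

lemma type_indices_cases:
  assumes "k \<in> set (type_indices p)"
  obtains "k = 1" | "k = 2" | "k = 3" | "k = 4" | "k = 5" | "k = 6" | "k = 7" | "k = 8" "p = 3"
    | "k = 9" | "k = 10" | "k = 11" "p > 3"
  using assms by (auto simp: type_indices_def split: if_splits)

lemma nonresidue_not_dvd:
  assumes "\<not> QuadRes (int p) \<epsilon>" shows "\<not> int p dvd \<epsilon>"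
proof
  assume "int p dvd \<epsilon>"
  then have "[0 ^ 2 = \<epsilon>] (mod int p)" by (simp add: cong_iff_dvd_diff)
  then show False using assms unfolding QuadRes_def by blast
qed

lemma type_index_listed_type:
  assumes "group G" "prime p" "odd p" "\<not> QuadRes (int p) \<epsilon>" "k \<in> set (type_indices p)"
    and "realizes G (listed_type p \<epsilon> k)"
  shows "group.type_index G p = k"
proof -
  note f2 = realizes_fam2D[OF assms(1-3)] and f3 = realizes_fam3D[OF assms(1-3)]
  have p1: "\<not> int p dvd 1" using prime_gt_1_nat[OF assms(2)] by (auto dest: zdvd_imp_le)
  note e = nonresidue_not_dvd[OF assms(4)]
  show ?thesis
    using assms(5)
  proof (cases rule: type_indices_cases)
    case 1
    then show ?thesis using f2[of 0 0 1 0 0] realization2.index_1 assms(6)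
      by (fastforce simp: listed_type_def)
  next
    case 2
    then show ?thesis using f2[of 0 1 1 0 0] realization2.index_2 assms(6)
      by (fastforce simp: listed_type_def)
  next
    case 3
    then show ?thesis using f2[of 1 0 0 0 0] realization2.index_3_4(1) assms(6)
      by (fastforce simp: listed_type_def)
  next
    case 4
    then show ?thesis using f2[of 1 0 0 1 0] realization2.index_3_4(2) assms(6)
      by (fastforce simp: listed_type_def)
  next
    case 5
    then show ?thesis using f2[of 0 0 0 0 1] realization2.index_5 assms(6)
      by (fastforce simp: listed_type_def)
  next
    case 6
    then show ?thesis using f2[of 0 0 1 0 1] realization2.index_6_7_8(1) assms(6) p1
      by (fastforce simp: listed_type_def)
  next
    case 7
    then show ?thesis using f2[of 0 0 \<epsilon> 0 1] realization2.index_6_7_8(2) assms(4,6) e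
      by (fastforce simp: listed_type_def)
  next
    case 8
    then show ?thesis using f2[of 0 "int p" \<epsilon> 0 1] realization2.index_6_7_8(3) assms(4,6) e
      by (fastforce simp: listed_type_def)
  next
    case 9
    then show ?thesis using f3[of 0 0] realization3.index_9 assms(6)
      by (fastforce simp: listed_type_def)
  next
    case 10
    then show ?thesis using f3[of 1 0] realization3.index_10_11(1) assms(6)
      by (fastforce simp: listed_type_def)
  next
    case 11
    then show ?thesis using f3[of 1 1] realization3.index_10_11(2) assms(6)
      by (fastforce simp: listed_type_def)
  qed
qed

text \<open>As \<open>\<tau>\<close> moves an element, every realization is nonabelian.\<close>

definition nontrivial_abelian_type :: "nat \<Rightarrow> (nat \<Rightarrow> int) ext_data \<Rightarrow> bool" where
  "nontrivial_abelian_type p T \<longleftrightarrow> (\<exists>N \<tau> v. T = (N, p, \<tau>, v) \<and> abelian_ext_type N p \<tau> v \<and>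
     \<tau> \<in> extensional (carrier N) \<and> order N = p ^ 3 \<and> (\<exists>u\<in>carrier N. \<tau> u \<noteq> u))"

lemma nontrivial_abelian_fam2:
  assumes "prime p" "odd p" "int p dvd \<alpha> * c + \<beta> * d" "int p dvd \<gamma> * c"
    and "\<not> int p dvd \<alpha> \<or> \<not> int p dvd \<beta> \<or> \<not> int p dvd \<gamma>"
  shows "nontrivial_abelian_type p (fam2 p \<alpha> \<beta> \<gamma> c d)"
proof -
  have p: "0 < p" using assms by (auto simp: prime_gt_0_nat)
  have cc: "col [p^2, p] l \<in> carrier (cyclic_prod [p^2, p])" for l
    using p by (intro col_closed) auto
  have "tau2 p \<alpha> \<beta> \<gamma> (col [p^2, p] [1, 0]) \<noteq> col [p^2, p] [1, 0] \<or>
    tau2 p \<alpha> \<beta> \<gamma> (col [p^2, p] [0, 1]) \<noteq> col [p^2, p] [0, 1]"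
    unfolding tau2_col[OF p] col2_eq_iff using assms(5) p by (auto simp: power2_eq_square)
  then have "\<exists>u\<in>carrier (cyclic_prod [p^2, p]). tau2 p \<alpha> \<beta> \<gamma> u \<noteq> u" using cc by blast
  moreover have "order (cyclic_prod [p^2, p]) = p ^ 3"
    using p order_cyclic_prod[of "[p^2, p]"] by (simp add: power2_eq_square power3_eq_cube)
  ultimately show ?thesis
    unfolding nontrivial_abelian_type_def fam2_def mat_ext_def
    using abelian_ext_type_fam2[OF assms(1-4)] by (fastforce simp: mat_map_def)
qed

lemma nontrivial_abelian_fam3:
  assumes "prime p" "odd p"
  shows "nontrivial_abelian_type p (fam3 p \<gamma> c)"
proof -
  have p: "0 < p" using assms by (auto simp: prime_gt_0_nat)
  have cc: "col [p, p, p] l \<in> carrier (cyclic_prod [p, p, p])" for l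
    using p by (intro col_closed) auto
  have "\<not> int p dvd 1" using prime_gt_1_nat[OF assms(1)] by (auto dest: zdvd_imp_le)
  then have "tau3 p \<gamma> (col [p, p, p] [0, 1, 0]) \<noteq> col [p, p, p] [0, 1, 0]"
    unfolding tau3_col[OF p] col3_eq_iff by simp
  then have "\<exists>u\<in>carrier (cyclic_prod [p, p, p]). tau3 p \<gamma> u \<noteq> u" using cc by blast
  moreover have "order (cyclic_prod [p, p, p]) = p ^ 3"
    using p order_cyclic_prod[of "[p, p, p]"] by (simp add: power3_eq_cube)
  ultimately show ?thesis
    unfolding nontrivial_abelian_type_def fam3_def mat_ext_def
    using abelian_ext_type_fam3[OF assms(1-2)] by (fastforce simp: mat_map_def)
qed

lemma nontrivial_abelian_listed_type:
  assumes "prime p" "odd p" "\<not> QuadRes (int p) \<epsilon>" "k \<in> set (type_indices p)"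
  shows "nontrivial_abelian_type p (listed_type p \<epsilon> k)"
proof -
  have p1: "\<not> int p dvd 1" using prime_gt_1_nat[OF assms(1)] by (auto dest: zdvd_imp_le)
  show ?thesis
    using assms(4)
  proof (cases rule: type_indices_cases)
    case 8
    show ?thesis using nontrivial_abelian_fam2[OF assms(1,2), of 0 "int p" \<epsilon> 0 1] p1 by (simp add: 8(1) listed_type_def)
  qed (use p1 in \<open>auto simp: listed_type_def intro!: nontrivial_abelian_fam2[OF assms(1,2)] nontrivial_abelian_fam3[OF assms(1,2)]\<close>)
qed

lemma nontrivial_abelian_extension_type:
  assumes "nontrivial_abelian_type p T" shows "extension_type T"
proof -
  obtain N \<tau> v where T: "T = (N, p, \<tau>, v)" and ab: "abelian_ext_type N p \<tau> v"
    and ext: "\<tau> \<in> extensional (carrier N)"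
    using assms unfolding nontrivial_abelian_type_def by (elim exE conjE) (rule that)
  show ?thesis unfolding T by (rule abelian_ext_type.extension_typeI[OF ab ext])
qed

text \<open>The model is the group constructed from the type, copied to the natural numbers. Groups that
  realize the type are isomorphic to the construction, and presentations pass along isomorphisms.\<close>

lemma nat_model:
  assumes "nontrivial_abelian_type p T" "prime p"
  obtains H :: "nat monoid" where "nonabelian_group_of_order (p ^ 4) H" "realizes H T"
    "\<And>G :: ('g, 'm) monoid_scheme. group G \<Longrightarrow> realizes G T \<Longrightarrow> G \<cong> H"
    "\<And>K :: nat monoid. group K \<Longrightarrow> H \<cong> K \<Longrightarrow> realizes K T"
proof -
  obtain N \<tau> v where T: "T = (N, p, \<tau>, v)" and ab: "abelian_ext_type N p \<tau> v"
    and oN: "order N = p ^ 3" and nt: "\<exists>u\<in>carrier N. \<tau> u \<noteq> u"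
    using assms(1) unfolding nontrivial_abelian_type_def by (elim exE conjE) (rule that)
  interpret T: abelian_ext_type N p \<tau> v by (rule ab)
  let ?E = "T.ext_group"
  interpret E: group ?E by (rule T.ext_group_is_group)
  have p1: "1 < p" using assms(2) prime_gt_1_nat by blast
  have tcl: "\<tau> \<in> carrier N \<rightarrow> carrier N" using T.tau_hom by (simp add: hom_def)
  have oE: "order ?E = p ^ 4" by (simp add: T.order_ext_group oN power_eq_if)
  have fE: "finite (carrier ?E)" using oE p1 E.order_gt_0_iff_finite by simp
  obtain H :: "nat monoid" where H: "group H" "?E \<cong> H"
    using finite_group_iso_nat_group[OF E.is_group fE] by blast
  have trans: "realizes K T" if "group K" and EK: "?E \<cong> K" for K :: "nat monoid"
  proof -
    obtain \<psi> where \<psi>: "\<psi> \<in> iso ?E K" using EK by (auto simp: is_iso_def)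
    show ?thesis
      unfolding T
      by (rule presents_imp_realizes[OF \<open>group K\<close> T.N.is_group T.n_pos tcl
          presents_iso[OF T.presents_ext_group[OF p1] E.is_group \<open>group K\<close> T.N.is_group \<psi> T.v_closed tcl]])
  qed
  have nc: "\<not> comm_group ?E"
  proof
    assume "comm_group ?E"
    then interpret C: comm_group ?E .
    obtain u where u: "u \<in> carrier N" "\<tau> u \<noteq> u" using nt by blast
    have "\<tau> u \<in> carrier N" using tcl u by blast
    then show False using C.m_comm[of "(\<one>\<^bsub>N\<^esub>, 1)" "(u, 0)"] u p1 by simp
  qed
  have "\<not> comm_group H"
  proof
    assume "comm_group H"
    then have "comm_group ?E"
      using comm_group.iso_imp_comm_group[of H ?E] E.iso_sym[OF H(2)] E.is_monoid by blast
    then show False using nc by blast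
  qed
  moreover have "order H = p ^ 4" using iso_same_card[OF H(2)] oE by (simp add: order_def)
  ultimately have "nonabelian_group_of_order (p ^ 4) H"
    using H by (simp add: nonabelian_group_of_order_def)
  moreover have "realizes H T" by (rule trans[OF H])
  moreover have "G \<cong> H" if "group G" and GT: "realizes G T" for G :: "('g, 'm) monoid_scheme"
  proof -
    obtain \<phi> a where "presents G (N, p, \<tau>, v) \<phi> a"
      using realizes_imp_presents[OF \<open>group G\<close> T.N.is_group T.n_pos tcl] GT unfolding T by blast
    then have "?E \<cong> G" by (rule T.presents_imp_iso_ext_group[OF \<open>group G\<close>])
    then show ?thesis using E.iso_sym iso_trans H(2) by blast
  qed
  moreover have "realizes K T" if "group K" "H \<cong> K" for K :: "nat monoid"
    using trans[OF that(1) iso_trans[OF H(2) that(2)]] .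
  ultimately show thesis using that by blast
qed

theorem mainTheorem1:
  fixes p :: nat and \<epsilon> :: int
  assumes "prime p" and "odd p" and "\<not> QuadRes (int p) \<epsilon>"
  shows "(\<forall>T\<in>set (ext_list p \<epsilon>). extension_type T) \<and>
    (\<forall>G :: ('g, 'm) monoid_scheme. nonabelian_group_of_order (p^4) G \<longrightarrow>
       (\<exists>!T. T \<in> set (ext_list p \<epsilon>) \<and> realizes G T)) \<and>
    distinct (ext_list p \<epsilon>) \<and> length (ext_list p \<epsilon>) = 10 \<and>
    (\<exists>R :: nat monoid set. card R = 10 \<and>
       (\<forall>H\<in>R. nonabelian_group_of_order (p^4) H) \<and>
       (\<forall>H\<in>R. \<forall>K\<in>R. H \<cong> K \<longrightarrow> H = K) \<and>
       (\<forall>G :: ('g, 'm) monoid_scheme. nonabelian_group_of_order (p^4) G \<longrightarrow> (\<exists>H\<in>R. G \<cong> H)))"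
proof -
  define I where "I = set (type_indices p)"
  define ty where "ty = listed_type p \<epsilon>"
  have set_list: "set (ext_list p \<epsilon>) = ty ` I" by (simp add: ext_list_eq ty_def I_def)
  have good: "nontrivial_abelian_type p (ty k)" if "k \<in> I" for k
    using nontrivial_abelian_listed_type[OF assms] that by (simp add: I_def ty_def)
  have index: "group.type_index G p = k" if "group G" "k \<in> I" "realizes G (ty k)"
    for G :: "('h, 'n) monoid_scheme" and k
    using type_index_listed_type[OF that(1) assms] that(2,3) by (simp add: I_def ty_def)
  have "\<forall>k\<in>I. \<exists>H :: nat monoid. nonabelian_group_of_order (p ^ 4) H \<and> realizes H (ty k) \<and>
    (\<forall>G :: ('g, 'm) monoid_scheme. group G \<longrightarrow> realizes G (ty k) \<longrightarrow> G \<cong> H) \<and>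
    (\<forall>K :: nat monoid. group K \<longrightarrow> H \<cong> K \<longrightarrow> realizes K (ty k))"
  proof
    fix k assume "k \<in> I"
    show "\<exists>H :: nat monoid. nonabelian_group_of_order (p ^ 4) H \<and> realizes H (ty k) \<and>
      (\<forall>G :: ('g, 'm) monoid_scheme. group G \<longrightarrow> realizes G (ty k) \<longrightarrow> G \<cong> H) \<and>
      (\<forall>K :: nat monoid. group K \<longrightarrow> H \<cong> K \<longrightarrow> realizes K (ty k))"
      by (rule nat_model[OF good[OF \<open>k \<in> I\<close>] assms(1)]) blast
  qed
  from bchoice[OF this] obtain H :: "nat \<Rightarrow> nat monoid" where
    model: "\<And>k. k \<in> I \<Longrightarrow> nonabelian_group_of_order (p ^ 4) (H k) \<and> realizes (H k) (ty k) \<and>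
      (\<forall>G :: ('g, 'm) monoid_scheme. group G \<longrightarrow> realizes G (ty k) \<longrightarrow> G \<cong> H k) \<and>
      (\<forall>K :: nat monoid. group K \<longrightarrow> H k \<cong> K \<longrightarrow> realizes K (ty k))"
    by blast
  have H: "nonabelian_group_of_order (p ^ 4) (H k)" "realizes (H k) (ty k)" if "k \<in> I" for k
    using model[OF that] by blast+
  have iso: "G \<cong> H k" if "k \<in> I" "group G" "realizes G (ty k)" for k and G :: "('g, 'm) monoid_scheme"
    using model[OF that(1)] that(2,3) by blast
  have tr: "realizes K (ty k)" if "k \<in> I" "group K" "H k \<cong> K" for k and K :: "nat monoid"
    using model[OF that(1)] that(2,3) by blast
  have grp: "group G" if "nonabelian_group_of_order (p ^ 4) G" for G :: "('h, 'n) monoid_scheme"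
    using that by (simp add: nonabelian_group_of_order_def)
  have iso_index: "k = l" if "k \<in> I" "l \<in> I" "H k \<cong> H l" for k l
  proof -
    have "group (H l)" using H(1)[OF that(2)] by (rule grp)
    moreover have "realizes (H l) (ty k)" using tr[OF that(1) \<open>group (H l)\<close> that(3)] .
    ultimately show ?thesis using index that H(2) by metis
  qed
  have injH: "inj_on H I" using iso_index by (metis inj_onI iso_refl)
  have injty: "inj_on ty I"
  proof (rule inj_onI)
    fix k l assume "k \<in> I" "l \<in> I" "ty k = ty l"
    moreover have "group (H k)" using H(1) \<open>k \<in> I\<close> grp by blast
    ultimately show "k = l" using index H(2) by metis
  qed
  have p3: "p = 3 \<or> p > 3" using prime_ge_2_nat[OF assms(1)] assms(2) by (cases "p = 2") auto
  have d: "distinct (type_indices p)" and len: "length (type_indices p) = 10"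
    using p3 by (auto simp: type_indices_def)
  have cardI: "card I = 10" using d len by (simp add: I_def distinct_card)
  have ex: "\<exists>k\<in>I. realizes G (ty k)" if "nonabelian_group_of_order (p ^ 4) G" for G :: "('g, 'm) monoid_scheme"
    using realizes_some_type[OF that assms] unfolding set_list bex_simps(7) .
  show ?thesis
  proof (intro conjI)
    show "\<forall>T\<in>set (ext_list p \<epsilon>). extension_type T"
      unfolding set_list using good nontrivial_abelian_extension_type by blast
    show "\<forall>G :: ('g, 'm) monoid_scheme. nonabelian_group_of_order (p^4) G \<longrightarrow>
       (\<exists>!T. T \<in> set (ext_list p \<epsilon>) \<and> realizes G T)"
    proof (intro allI impI)
      fix G :: "('g, 'm) monoid_scheme" assume G: "nonabelian_group_of_order (p^4) G"
      obtain k where k: "k \<in> I" "realizes G (ty k)" using ex[OF G] by blast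
      show "\<exists>!T. T \<in> set (ext_list p \<epsilon>) \<and> realizes G T"
      proof (rule ex1I)
        show "ty k \<in> set (ext_list p \<epsilon>) \<and> realizes G (ty k)" using k set_list by blast
        fix T assume "T \<in> set (ext_list p \<epsilon>) \<and> realizes G T"
        then have T: "T \<in> ty ` I" "realizes G T" unfolding set_list by simp_all
        from T(1) obtain l where l: "T = ty l" "l \<in> I" by (rule imageE)
        have "group.type_index G p = l" "group.type_index G p = k"
          using index[OF grp[OF G] l(2)] index[OF grp[OF G] k] T(2) l(1) by simp_all
        then show "T = ty k" using l by simp
      qed
    qed
    show "distinct (ext_list p \<epsilon>)"
      using d injty by (simp add: ext_list_eq distinct_map I_def ty_def)
    show "length (ext_list p \<epsilon>) = 10" using len by (simp add: ext_list_eq)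
    show "\<exists>R :: nat monoid set. card R = 10 \<and>
       (\<forall>H\<in>R. nonabelian_group_of_order (p^4) H) \<and>
       (\<forall>H\<in>R. \<forall>K\<in>R. H \<cong> K \<longrightarrow> H = K) \<and>
       (\<forall>G :: ('g, 'm) monoid_scheme. nonabelian_group_of_order (p^4) G \<longrightarrow> (\<exists>H\<in>R. G \<cong> H))"
    proof (intro exI[of _ "H ` I"] conjI)
      show "card (H ` I) = 10" using injH cardI by (simp add: card_image)
      show "\<forall>K\<in>H ` I. nonabelian_group_of_order (p^4) K" using H(1) by blast
      show "\<forall>K\<in>H ` I. \<forall>L\<in>H ` I. K \<cong> L \<longrightarrow> K = L" using iso_index by blast
      show "\<forall>G :: ('g, 'm) monoid_scheme. nonabelian_group_of_order (p^4) G \<longrightarrow> (\<exists>K\<in>H ` I. G \<cong> K)"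
        using ex iso grp by blast
    qed
  qed
qed

end
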